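(* Let $\mathsf{C},\mathsf{E}$ be finite-dimensional Hilbert spaces and $\mathsf{A}\cong\mathsf{A}'$ finite-dimensional with $d=\dim\mathsf{A}$. For every operator $Y\in\mathcal{B}(\mathsf{C}\otimes\mathsf{E}\otimes\mathsf{A}\otimes\mathsf{A}')$ and every $\alpha\in[1,2]$, \[ \mathbf{E}_{U\sim\mathds{U}(\mathsf{A})}\Big\|\Theta(Y)(U)-\mathbf{E}_{V\sim\mathds{U}(\mathsf{A})}\Theta(Y)(V)\Big\|_1\le 2\cdot3^{\frac{1-\alpha}{\alpha}}\,\|Y\|_{S_1(\mathsf{C}\otimes\mathsf{E},\,S_\alpha(\mathsf{A}\otimes\mathsf{A}'))}. \] In particular, for every positive operator $\tau=\tau_{A'ACE}$ and every $\alpha\in(1,2]$, \[ \mathbf{E}_{U\sim\mathds{U}(\mathsf{A})}\Big\|\Theta(\tau)(U)-\mathbf{E}_{V\sim\mathds{U}(\mathsf{A})}\Theta(\tau)(V)\Big\|_1\le 2\exp\!\Big(\tfrac{1-\alpha}{\alpha}\big(H_\alpha^*(AA'|CE)_\tau+\log3\big)\Big). \]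
   Context: $|\Phi\rangle=d^{-1/2}\sum_i|i\rangle_{A'}|i\rangle_A$. $\Theta(Y)(U)=d^2\,(\langle\Phi|_{A'A}\otimes\mathds{1}_{CE})\,U_AYU_A^\dagger\,(|\Phi\rangle_{A'A}\otimes\mathds{1}_{CE})\in\mathcal{B}(\mathsf{C}\otimes\mathsf{E})$, $U_A$ acting on $\mathsf{A}$ only; $\mathbf{E}$ is the Haar average over the unitary group $\mathds{U}(\mathsf{A})$. For finite-dimensional $\mathsf{B},\mathsf{D}$, $1\le\alpha\le\infty$, $\frac1\alpha+\frac1{\alpha'}=1$, and $X\in\mathcal{B}(\mathsf{D}\otimes\mathsf{B})$, the (Pisier) vector-valued norm is $\|X\|_{S_1(\mathsf{B},S_\alpha(\mathsf{D}))}:=\inf\{\|a\|_{2\alpha'}\|Z\|_\alpha\|b\|_{2\alpha'}: X=(\mathds{1}_D\otimes a)Z(\mathds{1}_D\otimes b),\ a,b\in\mathcal{B}(\mathsf{B})\}$; for $X$ positive it equals $\inf_{\sigma_B}\|(\mathds{1}\otimes\sigma_B^{-1/(2\alpha')})X(\mathds{1}\otimes\sigma_B^{-1/(2\alpha')})\|_\alpha$ over (full-rank) density operators $\sigma_B$. Here $\mathsf{B}=\mathsf{C}\otimes\mathsf{E}$, $\mathsf{D}=\mathsf{A}\otimes\mathsf{A}'$. For a positive operator $\tau$ and $\alpha>1$, $H_\alpha^*(AA'|CE)_\tau:=-\alpha'\log\|\tau\|_{S_1(\mathsf{C}\otimes\mathsf{E},S_\alpha(\mathsf{A}\otimes\mathsf{A}'))}$,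 which for density operators coincides with the sandwiched conditional Rényi entropy $-\inf_{\sigma}D_\alpha^*(\tau\|\mathds{1}_{AA'}\otimes\sigma_{CE})$. Logarithms are natural. *)

theory Defs
  imports "HOL-Analysis.Analysis" "Jordan_Normal_Form.Char_Poly"
begin

definition adj :: "complex mat \<Rightarrow> complex mat" where
  "adj A = Matrix.mat (dim_col A) (dim_row A) (\<lambda>(i,j). cnj (A $$ (j,i)))"

definition kron :: "complex mat \<Rightarrow> complex mat \<Rightarrow> complex mat" where
  "kron A B = Matrix.mat (dim_row A * dim_row B) (dim_col A * dim_col B)
     (\<lambda>(i,j). A $$ (i div dim_row B, j div dim_col B) * B $$ (i mod dim_row B, j mod dim_col B))"

definition unitary_mat :: "nat \<Rightarrow> complex mat \<Rightarrow> bool" where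
  "unitary_mat n U \<longleftrightarrow> U \<in> carrier_mat n n \<and> adj U * U = 1\<^sub>m n \<and> U * adj U = 1\<^sub>m n"

definition positive_op :: "nat \<Rightarrow> complex mat \<Rightarrow> bool" where
  "positive_op n X \<longleftrightarrow> X \<in> carrier_mat n n \<and>
     (\<forall>v \<in> carrier_vec n. let q = (\<Sum>i<n. \<Sum>j<n. cnj (v $ i) * X $$ (i,j) * v $ j)
                             in Im q = 0 \<and> Re q \<ge> 0)"

definition sing_vals :: "complex mat \<Rightarrow> real multiset" where
  "sing_vals A = image_mset (\<lambda>z. sqrt (Re z)) (proots (char_poly (adj A * A)))"

definition schatten :: "ereal \<Rightarrow> complex mat \<Rightarrow> real" where
  "schatten p A = (if p = \<infinity> then Max (insert 0 (set_mset (sing_vals A)))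
     else (\<Sum>s \<in># sing_vals A. s powr real_of_ereal p) powr (1 / real_of_ereal p))"

abbreviation trace_norm :: "complex mat \<Rightarrow> real" where
  "trace_norm A \<equiv> schatten 1 A"

definition conj_exp :: "real \<Rightarrow> ereal" where
  "conj_exp \<alpha> = (if \<alpha> = 1 then \<infinity> else ereal (\<alpha> / (\<alpha> - 1)))"

text \<open>Pisier's vector-valued norm \<open>\<parallel>X\<parallel>_{S_1(B, S_\<alpha>(D))}\<close> for \<open>X\<close> on \<open>B \<otimes> D\<close>
  (tensor factor \<open>B\<close> first), \<open>dB = dim B\<close>, \<open>dD = dim D\<close>.\<close>
definition pisier_norm :: "real \<Rightarrow> nat \<Rightarrow> nat \<Rightarrow> complex mat \<Rightarrow> real" where
  "pisier_norm \<alpha> dB dD X = Inf {schatten (2 * conj_exp \<alpha>) a * schatten (ereal \<alpha>) Z * schatten (2 * conj_exp \<alpha>) b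
      | a Z b. a \<in> carrier_mat dB dB \<and> b \<in> carrier_mat dB dB \<and> Z \<in> carrier_mat (dB * dD) (dB * dD) \<and>
               X = kron a (1\<^sub>m dD) * Z * kron b (1\<^sub>m dD)}"

definition H_alpha :: "real \<Rightarrow> nat \<Rightarrow> nat \<Rightarrow> nat \<Rightarrow> complex mat \<Rightarrow> real" where
  "H_alpha \<alpha> dC dE d \<tau> = - (\<alpha> / (\<alpha> - 1)) * ln (pisier_norm \<alpha> (dC * dE) (d * d) \<tau>)"

text \<open>Maximally entangled vector \<open>\<Phi> = d^{-1/2} \<Sum>_i |i\<rangle>|i\<rangle>\<close> as a \<open>d\<^sup>2 \<times> 1\<close> matrix.\<close>
definition Phi :: "nat \<Rightarrow> complex mat" where
  "Phi d = Matrix.mat (d * d) 1 (\<lambda>(k,_). if k div d = k mod d then complex_of_real (1 / sqrt (real d)) else 0)"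

text \<open>\<open>\<Theta>(Y)(U) = d\<^sup>2 (\<langle>\<Phi>| \<otimes> 1_{CE}) U_A Y U_A\<^sup>* (|\<Phi>\<rangle> \<otimes> 1_{CE})\<close>, with the ordering
  \<open>C \<otimes> E \<otimes> A \<otimes> A'\<close> of tensor factors.\<close>
definition Theta :: "nat \<Rightarrow> nat \<Rightarrow> nat \<Rightarrow> complex mat \<Rightarrow> complex mat \<Rightarrow> complex mat" where
  "Theta dC dE d Y U = (of_nat d)^2 \<cdot>\<^sub>m
     (kron (1\<^sub>m (dC * dE)) (adj (Phi d)) * kron (1\<^sub>m (dC * dE)) (kron U (1\<^sub>m d)) * Y *
      kron (1\<^sub>m (dC * dE)) (kron (adj U) (1\<^sub>m d)) * kron (1\<^sub>m (dC * dE)) (Phi d))"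

text \<open>A \<open>d \<times> d\<close> matrix is encoded by its entry function on \<open>{..<d} \<times> {..<d}\<close>.\<close>
abbreviation mat_space :: "nat \<Rightarrow> (nat \<times> nat \<Rightarrow> complex) measure" where
  "mat_space d \<equiv> PiM ({..<d} \<times> {..<d}) (\<lambda>_. borel)"

definition entries :: "nat \<Rightarrow> complex mat \<Rightarrow> (nat \<times> nat \<Rightarrow> complex)" where
  "entries d M = restrict (\<lambda>ij. M $$ ij) ({..<d} \<times> {..<d})"

text \<open>(Left-invariant) Haar probability measure on \<open>\<UU>(d)\<close>; it exists and is unique.\<close>
definition haar :: "nat \<Rightarrow> (nat \<times> nat \<Rightarrow> complex) measure \<Rightarrow> bool" where
  "haar d \<mu> \<longleftrightarrow> sets \<mu> = sets (mat_space d) \<and> emeasure \<mu> (space \<mu>) = 1 \<and>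
     (AE U in \<mu>. unitary_mat d (Matrix.mat d d U)) \<and>
     (\<forall>W. unitary_mat d W \<longrightarrow> distr \<mu> \<mu> (\<lambda>U. entries d (W * Matrix.mat d d U)) = \<mu>)"

definition haar_mean :: "nat \<Rightarrow> (nat \<times> nat \<Rightarrow> complex) measure \<Rightarrow> nat \<Rightarrow> (complex mat \<Rightarrow> complex mat) \<Rightarrow> complex mat" where
  "haar_mean d \<mu> n F = Matrix.mat n n (\<lambda>ij. \<integral>V. F (Matrix.mat d d V) $$ ij \<partial>\<mu>)"

end

(* The map Y |-> Theta(Y)(U) - E Theta(Y) is linear and commutes with the multiplications by a and b on
   C (x) E, so for Y = (a (x) 1) Z (b (x) 1) the trace norm of its value, tested against an almost optimal
   unitary X(U) chosen measurably, is a trilinear form in the singular values of a, Z and b.  This form is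
   bounded by 2 on l^inf x l^1 x l^inf (second Haar moments and the triangle inequality) and by
   2 / sqrt 3 on l^4 x l^2 x l^4 (the fourth Haar moments bound the variance by d^2 / (d^2 - 1) <= 4 / 3).
   Complex interpolation of the trilinear form between the two endpoints, by the three lines theorem, gives
   the bound 2 * 3^((1 - alpha) / alpha) on l^(2 alpha') x l^alpha x l^(2 alpha'). *)
theory Submission
  imports Defs "HOL-Complex_Analysis.Conformal_Mappings" "HOL-Real_Asymp.Real_Asymp"
begin

text \<open>Complex interpolation needs a family that is linear in fixed coefficients, but an
  expected norm is not linear and \<open>pisier_norm\<close> is an infimum over factorizations.
  Hence one factorization and the unitary parts of its three singular value decompositions are
  frozen, and the norm is replaced by a pairing with a unitary \<open>X U\<close> that stays fixed
  while the singular values vary. What remains is a scalar form on finite sequences, in which only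
  the singular values are turned into complex powers. The exponents 2 \<alpha>', \<alpha>, 2
  \<alpha>' equal \<infinity>, 1, \<infinity> at \<alpha> = 1 and 4, 2, 4 at \<alpha> = 2, which
  dictates the endpoints. At the first one the l^1 ball reduces Z to rank one, where the random term
  and its mean contribute 1 each. At the second the constant is sqrt (4 / 3), the square root of the
  variance factor in its worst dimension d = 2; for d = 1 the variance is 0. The endpoint constants
  have ratio 1 / sqrt 3, and its power with exponent \<theta> = 2 (\<alpha> - 1) / \<alpha> is 3^((1
  - \<alpha>) / \<alpha>).\<close>

subsection \<open>Complex interpolation of trilinear forms\<close>

text \<open>The maximum principle needs a bounded region, and the strip is unbounded. Dividing by
  A^(1 - z) B^z makes both edges at most 1, and a Gaussian factor with parameter
  \<open>\<epsilon>\<close> makes the function small on the far horizontal sides; in the end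
  \<open>\<epsilon>\<close> tends to 0.\<close>

lemma three_lines:
  fixes f :: "complex \<Rightarrow> complex" and t A B K :: real
  assumes hol: "f holomorphic_on UNIV"
    and bdd: "\<And>z. 0 \<le> Re z \<Longrightarrow> Re z \<le> 1 \<Longrightarrow> norm (f z) \<le> K"
    and left: "\<And>z. Re z = 0 \<Longrightarrow> norm (f z) \<le> A"
    and right: "\<And>z. Re z = 1 \<Longrightarrow> norm (f z) \<le> B"
    and pos: "0 < A" "0 < B" and t: "0 \<le> t" "t \<le> 1"
  shows "norm (f (of_real t)) \<le> A powr (1 - t) * B powr t"
proof -
  define K' where "K' = max 1 (max (1 / A) (1 / B))"
  have K': "K' \<ge> 1" "1 / A \<le> K'" "1 / B \<le> K'" by (auto simp: K'_def)
  have K0: "0 \<le> K" using bdd[of 0] norm_ge_zero[of "f 0"] by (simp del: norm_ge_zero)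
  have damped: "norm (f t) \<le> exp (\<epsilon> * (1 - t\<^sup>2)) * (A powr (1 - t) * B powr t)" if \<epsilon>: "\<epsilon> > 0" for \<epsilon> :: real
  proof -
    \<comment> \<open>On the strip Re (z^2 - 1) <= - (Im z)^2, so the first factor has modulus at
      most 1 and decays for large |Im z|; at the point t it costs the factor exp (\<epsilon> (1 -
      t^2)). The second factor is the reciprocal of A^(1 - z) B^z.\<close>
    define h where "h z = exp (of_real \<epsilon> * (z\<^sup>2 - 1)) * exp (- ((1 - z) * of_real (ln A) + z * of_real (ln B)))" for z :: complex
    define g where "g z = f z * h z" for z
    have nh: "norm (h z) = exp (\<epsilon> * ((Re z)\<^sup>2 - (Im z)\<^sup>2 - 1)) * ((1 / A) powr (1 - Re z) * (1 / B) powr Re z)" for z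
      using pos by (simp add: h_def norm_mult power2_eq_square powr_def ln_div exp_add[symmetric] algebra_simps)
    have nh_le: "norm (h z) \<le> exp (- \<epsilon> * (Im z)\<^sup>2) * (K' * K')" if z: "0 \<le> Re z" "Re z \<le> 1" for z
    proof -
      have "(Re z)\<^sup>2 \<le> 1" using z by (simp add: abs_square_le_1)
      then have "\<epsilon> * ((Re z)\<^sup>2 - (Im z)\<^sup>2 - 1) \<le> \<epsilon> * (- (Im z)\<^sup>2)"
        using \<epsilon> by (intro mult_left_mono) auto
      moreover have "(1 / A) powr (1 - Re z) \<le> K'"
      proof -
        have "(1 / A) powr (1 - Re z) \<le> K' powr (1 - Re z)" using z pos K' by (intro powr_mono2) auto
        also have "\<dots> \<le> K' powr 1" using z K' by (intro powr_mono) auto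
        finally show ?thesis using K' by simp
      qed
      moreover have "(1 / B) powr (Re z) \<le> K'"
      proof -
        have "(1 / B) powr (Re z) \<le> K' powr (Re z)" using z pos K' by (intro powr_mono2) auto
        also have "\<dots> \<le> K' powr 1" using z K' by (intro powr_mono) auto
        finally show ?thesis using K' by simp
      qed
      ultimately show ?thesis unfolding nh using K' by (intro mult_mono) auto
    qed
    \<comment> \<open>The height at which the Gaussian decay beats the crude bounds for f and for
      the reciprocal powers of A and B.\<close>
    obtain R where R: "R > 0" "K * (exp (- \<epsilon> * R\<^sup>2) * (K' * K')) \<le> 1"
    proof -
      have "((\<lambda>R::real. K * (exp (- \<epsilon> * R\<^sup>2) * (K' * K'))) \<longlongrightarrow> K * (0 * (K' * K'))) at_top"
        using \<epsilon> by (intro tendsto_intros) real_asymp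
      then have "\<forall>\<^sub>F R in at_top. K * (exp (- \<epsilon> * R\<^sup>2) * (K' * K')) < 1"
        by (rule order_tendstoD) simp
      then have "\<forall>\<^sub>F R in at_top. 0 < R \<and> K * (exp (- \<epsilon> * R\<^sup>2) * (K' * K')) < 1"
        using eventually_gt_at_top[of "0::real"] by eventually_elim auto
      then obtain R where "0 < R \<and> K * (exp (- \<epsilon> * R\<^sup>2) * (K' * K')) < 1"
        using eventually_happens'[OF trivial_limit_at_top_linorder] by blast
      then show ?thesis using that by (auto intro: less_imp_le)
    qed
    define S where "S = cbox (Complex 0 (- R)) (Complex 1 R)"
    have "norm (g t) \<le> 1"
    proof (rule maximum_modulus_frontier[of g S])
      have holg: "g holomorphic_on UNIV" unfolding g_def h_def by (intro holomorphic_intros hol)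
      show "g holomorphic_on interior S" using holg holomorphic_on_subset by blast
      show "continuous_on (closure S) g"
        using holg holomorphic_on_imp_continuous_on continuous_on_subset by blast
      show "bounded S" by (simp add: S_def bounded_cbox)
      show "complex_of_real t \<in> S" using t R by (simp add: S_def in_cbox_complex_iff)
      fix z assume "z \<in> frontier S"
      then have zS: "z \<in> S" and zI: "z \<notin> box (Complex 0 (- R)) (Complex 1 R)"
        by (auto simp: S_def frontier_cbox)
      have z: "0 \<le> Re z" "Re z \<le> 1" "- R \<le> Im z" "Im z \<le> R"
        using zS by (auto simp: S_def in_cbox_complex_iff)
      consider "Re z = 0" | "Re z = 1" | "(Im z)\<^sup>2 = R\<^sup>2"
        using z zI by (force simp: in_box_complex_iff power2_eq_iff)
      then show "norm (g z) \<le> 1"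
      proof cases
        case 1
        have "- (Im z)\<^sup>2 - 1 \<le> 0" using zero_le_power2[of "Im z"] by linarith
        then have "\<epsilon> * (- (Im z)\<^sup>2 - 1) \<le> 0" using \<epsilon> by (intro mult_nonneg_nonpos) auto
        then have "norm (h z) \<le> 1 / A" unfolding nh using 1 pos by (simp add: divide_right_mono)
        then have "norm (f z) * norm (h z) \<le> A * (1 / A)"
          using left[OF 1] pos by (intro mult_mono) auto
        then show ?thesis using pos by (simp add: g_def norm_mult)
      next
        case 2
        have "norm (h z) \<le> 1 / B" unfolding nh using 2 \<epsilon> pos by (simp add: divide_right_mono)
        then have "norm (f z) * norm (h z) \<le> B * (1 / B)"
          using right[OF 2] pos by (intro mult_mono) auto
        then show ?thesis using pos by (simp add: g_def norm_mult)
      next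
        case 3
        have "norm (f z) * norm (h z) \<le> K * (exp (- \<epsilon> * R\<^sup>2) * (K' * K'))"
          using nh_le[OF z(1,2)] bdd[OF z(1,2)] K0 unfolding 3 by (intro mult_mono) auto
        then show ?thesis using R by (simp add: g_def norm_mult)
      qed
    qed
    moreover have "norm (h t) = exp (- (\<epsilon> * (1 - t\<^sup>2))) / (A powr (1 - t) * B powr t)"
      unfolding nh using pos by (simp add: powr_divide algebra_simps)
    moreover have "a \<le> exp u * P" if "a * (exp (- u) / P) \<le> 1" "0 < P" for a u P :: real
      using that by (simp add: exp_minus field_simps)
    ultimately show ?thesis using pos by (simp add: g_def norm_mult)
  qed
  have "((\<lambda>\<epsilon>. exp (\<epsilon> * (1 - t\<^sup>2)) * (A powr (1 - t) * B powr t)) \<longlongrightarrow>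
      exp (0 * (1 - t\<^sup>2)) * (A powr (1 - t) * B powr t)) (at_right 0)"
    by (intro tendsto_intros)
  moreover have "\<forall>\<^sub>F \<epsilon> in at_right 0. norm (f t) \<le> exp (\<epsilon> * (1 - t\<^sup>2)) * (A powr (1 - t) * B powr t)"
    using eventually_at_right_less[of "0::real"] by eventually_elim (rule damped)
  ultimately have "norm (f t) \<le> exp (0 * (1 - t\<^sup>2)) * (A powr (1 - t) * B powr t)"
    by (intro tendsto_lowerbound[where F = "at_right 0"]) auto
  then show ?thesis by simp
qed

text \<open>For base 0 the value is 0 even at exponent 0, as for \<open>powr\<close>. Singular
  values may vanish, and this convention keeps the power entire in the exponent, with modulus
  \<open>x powr Re s\<close> for every nonnegative base.\<close>

definition cpower :: "real \<Rightarrow> complex \<Rightarrow> complex" where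
  "cpower x s = (if x = 0 then 0 else exp (s * of_real (ln x)))"

lemma norm_cpower: "0 \<le> x \<Longrightarrow> norm (cpower x s) = x powr Re s"
  by (simp add: cpower_def powr_def)

lemma cpower_of_real: "0 \<le> x \<Longrightarrow> cpower x (of_real r) = of_real (x powr r)"
  by (simp add: cpower_def powr_def flip: exp_of_real)

lemma holomorphic_on_cpower [holomorphic_intros]:
  "s holomorphic_on S \<Longrightarrow> (\<lambda>z. cpower x (s z)) holomorphic_on S"
  by (cases "x = 0") (auto simp: cpower_def intro!: holomorphic_intros)

lemma powr_sum_le_one_imp_le_one:
  assumes "finite I" "(\<Sum>i\<in>I. x i powr p) \<le> 1" "\<And>i. i \<in> I \<Longrightarrow> 0 \<le> x i" "0 < p" "i \<in> I"
  shows "x i \<le> (1::real)"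
proof (rule ccontr)
  assume "\<not> x i \<le> 1"
  then have "1 < x i powr p" using assms by (intro gr_one_powr) auto
  moreover have "x i powr p \<le> (\<Sum>i\<in>I. x i powr p)" using assms by (intro member_le_sum) auto
  ultimately show False using assms by simp
qed

text \<open>Thorin's analytic family: each argument is raised to a power affine in z, such that Re z
  = 0 lands in the unit balls of l^inf, l^1, l^inf, Re z = 1 in those of l^4, l^2, l^4, and z =
  \<theta> returns the given arguments. This forces the exponents 1 / p = \<theta> / 4 for x and w
  and 1 / q = 1 - \<theta> / 2 for y.\<close>

lemma trilinear_riesz_thorin:
  fixes c :: "'i \<Rightarrow> 'j \<Rightarrow> 'k \<Rightarrow> complex" and \<theta> A B :: real
  assumes fin: "finite I" "finite J" "finite L"
    and b0: "\<And>\<xi> \<eta> \<omega>. (\<And>i. i \<in> I \<Longrightarrow> norm (\<xi> i) \<le> 1) \<Longrightarrow> (\<Sum>j\<in>J. norm (\<eta> j)) \<le> 1 \<Longrightarrow>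
       (\<And>k. k \<in> L \<Longrightarrow> norm (\<omega> k) \<le> 1) \<Longrightarrow>
       norm (\<Sum>i\<in>I. \<Sum>j\<in>J. \<Sum>k\<in>L. c i j k * \<xi> i * \<eta> j * \<omega> k) \<le> A"
    and b1: "\<And>\<xi> \<eta> \<omega>. (\<Sum>i\<in>I. norm (\<xi> i) ^ 4) \<le> 1 \<Longrightarrow> (\<Sum>j\<in>J. norm (\<eta> j) ^ 2) \<le> 1 \<Longrightarrow>
       (\<Sum>k\<in>L. norm (\<omega> k) ^ 4) \<le> 1 \<Longrightarrow>
       norm (\<Sum>i\<in>I. \<Sum>j\<in>J. \<Sum>k\<in>L. c i j k * \<xi> i * \<eta> j * \<omega> k) \<le> B"
    and pos: "0 < A" "0 < B" and \<theta>: "0 < \<theta>" "\<theta> \<le> 1"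
    and nn: "\<And>i. i \<in> I \<Longrightarrow> 0 \<le> x i" "\<And>j. j \<in> J \<Longrightarrow> 0 \<le> y j" "\<And>k. k \<in> L \<Longrightarrow> 0 \<le> w k"
    and x: "(\<Sum>i\<in>I. x i powr (4 / \<theta>)) \<le> 1"
    and y: "(\<Sum>j\<in>J. y j powr (1 / (1 - \<theta> / 2))) \<le> 1"
    and w: "(\<Sum>k\<in>L. w k powr (4 / \<theta>)) \<le> 1"
  shows "norm (\<Sum>i\<in>I. \<Sum>j\<in>J. \<Sum>k\<in>L. c i j k * of_real (x i) * of_real (y j) * of_real (w k))
    \<le> A powr (1 - \<theta>) * B powr \<theta>"
proof -
  define \<alpha> where "\<alpha> = 1 / (1 - \<theta> / 2)"
  have \<alpha>: "0 < \<alpha>" using \<theta> by (simp add: \<alpha>_def)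
  define X where "X i z = cpower (x i) (z / of_real \<theta>)" for i z
  define Y where "Y j z = cpower (y j) (of_real \<alpha> * (1 - z / 2))" for j z
  define W where "W k z = cpower (w k) (z / of_real \<theta>)" for k z
  define f where "f z = (\<Sum>i\<in>I. \<Sum>j\<in>J. \<Sum>k\<in>L. c i j k * X i z * Y j z * W k z)" for z
  have nX: "norm (X i z) = x i powr (Re z / \<theta>)" if "i \<in> I" for i z
    using nn that \<theta> by (simp add: X_def norm_cpower)
  have nY: "norm (Y j z) = y j powr (\<alpha> * (1 - Re z / 2))" if "j \<in> J" for j z
    using nn that by (simp add: Y_def norm_cpower)
  have nW: "norm (W k z) = w k powr (Re z / \<theta>)" if "k \<in> L" for k z
    using nn that \<theta> by (simp add: W_def norm_cpower)
  \<comment> \<open>Entries in [0, 1] stay there under powers with nonnegative exponent, which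
    supplies the uniform bound on the strip.\<close>
  have x1: "x i \<le> 1" if "i \<in> I" for i
    using powr_sum_le_one_imp_le_one[OF fin(1) x] nn that \<theta> by auto
  have y1: "y j \<le> 1" if "j \<in> J" for j
    using powr_sum_le_one_imp_le_one[OF fin(2) y] nn that \<alpha> by (auto simp: \<alpha>_def)
  have w1: "w k \<le> 1" if "k \<in> L" for k
    using powr_sum_le_one_imp_le_one[OF fin(3) w] nn that \<theta> by auto
  have "norm (f \<theta>) \<le> A powr (1 - \<theta>) * B powr \<theta>"
  proof (rule three_lines[where K = "\<Sum>i\<in>I. \<Sum>j\<in>J. \<Sum>k\<in>L. norm (c i j k)"])
    show "f holomorphic_on UNIV" unfolding f_def X_def Y_def W_def using \<theta>
      by (intro holomorphic_intros) auto
  next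
    fix z :: complex assume z: "0 \<le> Re z" "Re z \<le> 1"
    have "norm (c i j k * X i z * Y j z * W k z) \<le> norm (c i j k)" if "i \<in> I" "j \<in> J" "k \<in> L" for i j k
    proof -
      have "norm (X i z) \<le> 1" "norm (Y j z) \<le> 1" "norm (W k z) \<le> 1"
        using that z \<theta> \<alpha> nn x1 y1 w1 by (auto simp: nX nY nW intro!: powr_le1)
      then have "norm (X i z) * norm (Y j z) * norm (W k z) \<le> 1"
        by (metis mult_le_one norm_ge_zero zero_le_mult_iff)
      then show ?thesis
        using mult_left_mono[of "norm (X i z) * norm (Y j z) * norm (W k z)" 1 "norm (c i j k)"]
        by (simp add: norm_mult mult.assoc)
    qed
    then show "norm (f z) \<le> (\<Sum>i\<in>I. \<Sum>j\<in>J. \<Sum>k\<in>L. norm (c i j k))"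
      unfolding f_def by (intro order.trans[OF norm_sum] sum_mono) auto
  next
    fix z :: complex assume z: "Re z = 0"
    show "norm (f z) \<le> A" unfolding f_def
    proof (rule b0)
      show "(\<Sum>j\<in>J. norm (Y j z)) \<le> 1" using y by (simp add: nY z \<alpha>_def)
    \<comment> \<open>With real part 0 the moduli are \<open>x i powr 0\<close> and
      \<open>w k powr 0\<close>, hence 0 or 1.\<close>
    qed (use z in \<open>auto simp: nX nW powr_def\<close>)
  next
    fix z :: complex assume z: "Re z = 1"
    have p: "(u powr r) ^ n = u powr (of_nat n * r)" if "0 < n" for u r :: real and n :: nat
      using that by (simp add: powr_def exp_of_nat_mult[symmetric] zero_power)
    show "norm (f z) \<le> B" unfolding f_def
    proof (rule b1)
      show "(\<Sum>i\<in>I. norm (X i z) ^ 4) \<le> 1" using x by (simp add: nX z p)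
      have "norm (Y j z) ^ 2 = y j powr \<alpha>" if "j \<in> J" for j using that by (simp add: nY z p)
      then show "(\<Sum>j\<in>J. norm (Y j z) ^ 2) \<le> 1" using y[folded \<alpha>_def] by simp
      show "(\<Sum>k\<in>L. norm (W k z) ^ 4) \<le> 1" using w by (simp add: nW z p)
    qed
  qed (use pos \<theta> in auto)
  moreover have "X i \<theta> = of_real (x i)" if "i \<in> I" for i
    using nn that \<theta> cpower_of_real[of "x i" 1] by (simp add: X_def)
  moreover have "Y j \<theta> = of_real (y j)" if "j \<in> J" for j
  proof -
    have "complex_of_real \<alpha> * (1 - complex_of_real \<theta> / 2) = of_real (\<alpha> * (1 - \<theta> / 2))" by simp
    also have "\<alpha> * (1 - \<theta> / 2) = 1" using \<theta> by (simp add: \<alpha>_def)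
    finally show ?thesis using nn that cpower_of_real[of "y j" 1] by (simp add: Y_def)
  qed
  moreover have "W k \<theta> = of_real (w k)" if "k \<in> L" for k
    using nn that \<theta> cpower_of_real[of "w k" 1] by (simp add: W_def)
  ultimately show ?thesis by (simp add: f_def)
qed

subsection \<open>Moments of the Haar measure\<close>

text \<open>Unitarity in terms of entry functions, so that Haar samples, singular bases and
  rotations are all handled by finite sums. Rows and columns are both asked to be orthonormal;
  values at indices from n on are left free.\<close>

definition unitary_fun :: "nat \<Rightarrow> (nat \<Rightarrow> nat \<Rightarrow> complex) \<Rightarrow> bool" where
  "unitary_fun n W \<longleftrightarrow>
     (\<forall>i<n. \<forall>k<n. (\<Sum>p<n. W i p * cnj (W k p)) = (if i = k then 1 else 0)) \<and>
     (\<forall>i<n. \<forall>k<n. (\<Sum>p<n. cnj (W p i) * W p k) = (if i = k then 1 else 0))"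

lemma unitary_mat_iff_unitary_fun:
  "unitary_mat n (Matrix.mat n n (\<lambda>(i,j). W i j)) \<longleftrightarrow> unitary_fun n W"
proof -
  have "adj (Matrix.mat n n (\<lambda>(i,j). W i j)) * Matrix.mat n n (\<lambda>(i,j). W i j) = 1\<^sub>m n \<longleftrightarrow>
     (\<forall>i<n. \<forall>k<n. (\<Sum>p<n. cnj (W p i) * W p k) = (if i = k then 1 else 0))"
    by (auto simp: adj_def mat_eq_iff scalar_prod_def lessThan_atLeast0)
  moreover have "Matrix.mat n n (\<lambda>(i,j). W i j) * adj (Matrix.mat n n (\<lambda>(i,j). W i j)) = 1\<^sub>m n \<longleftrightarrow>
     (\<forall>i<n. \<forall>k<n. (\<Sum>p<n. W i p * cnj (W k p)) = (if i = k then 1 else 0))"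
    by (auto simp: adj_def mat_eq_iff scalar_prod_def lessThan_atLeast0)
  ultimately show ?thesis by (auto simp: unitary_mat_def unitary_fun_def)
qed

lemma unitary_fun_norm_le_1:
  assumes "unitary_fun n W" "i < n" "j < n"
  shows "norm (W i j) \<le> 1"
proof -
  have "of_real (\<Sum>p<n. (norm (W i p))\<^sup>2) = (\<Sum>p<n. W i p * cnj (W i p))"
    by (simp add: complex_norm_square del: of_real_power)
  also have "\<dots> = 1" using assms by (simp add: unitary_fun_def)
  finally have "(\<Sum>p<n. (norm (W i p))\<^sup>2) = 1" using of_real_eq_1_iff by blast
  moreover have "(norm (W i j))\<^sup>2 \<le> (\<Sum>p<n. (norm (W i p))\<^sup>2)" using assms by (intro member_le_sum) auto
  ultimately show ?thesis by (simp add: power2_le_iff_abs_le abs_square_le_1)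
qed

text \<open>Permutations with phases are the first supply of test unitaries for the invariance
  argument below.\<close>

lemma unitary_fun_monomial:
  assumes "\<pi> permutes {..<n}" "\<And>i. norm (\<phi> i) = 1"
  shows "unitary_fun n (\<lambda>i p. if p = \<pi> i then \<phi> i else 0)"
proof -
  have inj: "\<pi> i = \<pi> k \<longleftrightarrow> i = k" for i k using permutes_inj[OF assms(1)] by (simp add: inj_eq)
  have lt: "\<pi> i < n" if "i < n" for i using permutes_in_image[OF assms(1), of i] that by simp
  have u: "\<phi> i * cnj (\<phi> i) = 1" "cnj (\<phi> i) * \<phi> i = 1" for i
    using assms(2)[of i] by (simp_all add: complex_norm_square[symmetric] mult.commute)
  show ?thesis unfolding unitary_fun_def
  proof (intro conjI allI impI)
    fix i k assume ik: "i < n" "k < n"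
    show "(\<Sum>p<n. (if p = \<pi> i then \<phi> i else 0) * cnj (if p = \<pi> k then \<phi> k else 0)) = (if i = k then 1 else 0)"
      using ik lt u by (simp add: if_distrib[of "\<lambda>x. x * _"] inj cong: if_cong)
    have "(\<Sum>p<n. cnj (if i = \<pi> p then \<phi> p else 0) * (if k = \<pi> p then \<phi> p else 0)) =
      (\<Sum>p<n. if p = inv_into UNIV \<pi> i then (if k = i then 1 else 0) else 0)"
      using u permutes_inverses[OF assms(1)] by (intro sum.cong) auto
    also have "\<dots> = (if i = k then 1 else 0)"
      using permutes_in_image[OF permutes_inv[OF assms(1)], of i] ik by simp
    finally show "(\<Sum>p<n. cnj (if i = \<pi> p then \<phi> p else 0) * (if k = \<pi> p then \<phi> p else 0)) = (if i = k then 1 else 0)" .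
  qed
qed

definition inv_sqrt2 :: complex where "inv_sqrt2 = of_real (1 / sqrt 2)"

lemma inv_sqrt2_mult_self: "inv_sqrt2 * inv_sqrt2 = 1 / 2"
  by (simp add: inv_sqrt2_def flip: of_real_mult)

lemma cnj_inv_sqrt2: "cnj inv_sqrt2 = inv_sqrt2"
  by (simp add: inv_sqrt2_def)

text \<open>For distinct i and k, the matrix with rows (1, 1) and (1, -1) divided by sqrt 2 in the
  plane of these coordinates, and the identity elsewhere. It is real and symmetric. Mixing two
  coordinates is what permutations and phases cannot do.\<close>

definition hadamard_rotation :: "nat \<Rightarrow> nat \<Rightarrow> nat \<Rightarrow> nat \<Rightarrow> complex" where
  "hadamard_rotation i k p q =
    (if p = i then (if q = i then inv_sqrt2 else 0) + (if q = k then inv_sqrt2 else 0)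
     else if p = k then (if q = i then inv_sqrt2 else 0) - (if q = k then inv_sqrt2 else 0)
     else (if q = p then 1 else 0))"

lemma sum_hadamard_rotation:
  fixes i k n :: nat
  assumes "i < n" "k < n" "i \<noteq> k" "a < n"
  shows "(\<Sum>p<n. hadamard_rotation i k a p * F p) =
    (if a = i then inv_sqrt2 * (F i + F k) else if a = k then inv_sqrt2 * (F i - F k) else F a)"
proof -
  have delta: "(\<Sum>p<n. (if p = m then c else 0) * F p) = c * F m" if "m < n" for c m
  proof -
    have "(\<Sum>p<n. (if p = m then c else 0) * F p) = (\<Sum>p<n. if p = m then c * F p else 0)"
      by (intro sum.cong refl) simp
    then show ?thesis using that by simp
  qed
  consider "a = i" | "a = k" "a \<noteq> i" | "a \<noteq> i" "a \<noteq> k" by blast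
  then show ?thesis
  proof cases
    case 3
    then show ?thesis using delta[OF \<open>a < n\<close>, of 1] by (simp add: hadamard_rotation_def)
  qed (use delta[OF assms(1), of inv_sqrt2] delta[OF assms(2), of inv_sqrt2] in
      \<open>simp_all add: hadamard_rotation_def distrib_right left_diff_distrib sum.distrib
        sum_subtractf distrib_left right_diff_distrib\<close>)
qed

lemma unitary_fun_hadamard_rotation:
  fixes i k n :: nat
  assumes ik: "i < n" "k < n" "i \<noteq> k"
  shows "unitary_fun n (hadamard_rotation i k)"
proof -
  let ?H = "hadamard_rotation i k"
  have ss: "inv_sqrt2 * (inv_sqrt2 + inv_sqrt2) = 1" by (simp only: distrib_left inv_sqrt2_mult_self) simp
  have sym: "?H p q = cnj (?H q p)" for p q using ik(3) by (auto simp: hadamard_rotation_def cnj_inv_sqrt2)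
  have row: "(\<Sum>p<n. ?H a p * cnj (?H b p)) = (if a = b then 1 else 0)" if ab: "a < n" "b < n" for a b
    unfolding sum_hadamard_rotation[OF ik ab(1)] using ik ss
    by (cases "a = i"; cases "a = k"; cases "b = i"; cases "b = k")
      (simp_all add: hadamard_rotation_def cnj_inv_sqrt2)
  have "(\<Sum>p<n. cnj (?H p a) * ?H p b) = (\<Sum>p<n. ?H a p * cnj (?H b p))" for a b
    by (intro sum.cong refl arg_cong2[where f = "(*)"]) (metis sym complex_cnj_cnj)+
  with row show ?thesis unfolding unitary_fun_def by simp
qed

text \<open>A tensor with two covariant and two contravariant indices that is invariant under the unitary
  group is a combination of the two pairings: phases kill the unpaired entries, permutations
  make the paired ones constant, and a Hadamard rotation settles the fully diagonal entries.\<close>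
lemma unitary_invariant_tensor:
  fixes e :: "nat \<Rightarrow> nat \<Rightarrow> nat \<Rightarrow> nat \<Rightarrow> complex"
  assumes d: "2 \<le> d"
    and inv: "\<And>W i1 i2 k1 k2. unitary_fun d W \<Longrightarrow> i1 < d \<Longrightarrow> i2 < d \<Longrightarrow> k1 < d \<Longrightarrow> k2 < d \<Longrightarrow>
      e i1 i2 k1 k2 = (\<Sum>p<d. W i1 p * (\<Sum>q<d. W i2 q * (\<Sum>r<d. cnj (W k1 r) * (\<Sum>t<d. cnj (W k2 t) * e p q r t))))"
  obtains \<alpha> \<beta> where "\<And>i1 i2 k1 k2. i1 < d \<Longrightarrow> i2 < d \<Longrightarrow> k1 < d \<Longrightarrow> k2 < d \<Longrightarrow>
      e i1 i2 k1 k2 = (if i1 = k1 \<and> i2 = k2 then \<alpha> else 0) + (if i1 = k2 \<and> i2 = k1 then \<beta> else 0)"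
proof -
  have mono: "e i1 i2 k1 k2 = \<phi> i1 * \<phi> i2 * cnj (\<phi> k1) * cnj (\<phi> k2) * e (\<pi> i1) (\<pi> i2) (\<pi> k1) (\<pi> k2)"
    if "\<pi> permutes {..<d}" "\<And>i. norm (\<phi> i) = 1" "i1 < d" "i2 < d" "k1 < d" "k2 < d" for \<pi> \<phi> i1 i2 k1 k2
  proof -
    have lt: "\<pi> i < d" if "i < d" for i using permutes_in_image[OF \<open>\<pi> permutes {..<d}\<close>, of i] that by simp
    have delta: "(\<Sum>p<d. g (if p = \<pi> i then \<phi> i else 0) * F p) = g (\<phi> i) * F (\<pi> i)"
      if "i < d" "g 0 = 0" for i F and g :: "complex \<Rightarrow> complex"
    proof -
      have "(\<Sum>p<d. g (if p = \<pi> i then \<phi> i else 0) * F p) = (\<Sum>p<d. if p = \<pi> i then g (\<phi> i) * F p else 0)"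
        using that(2) by (intro sum.cong refl) simp
      then show ?thesis using lt[OF that(1)] by simp
    qed
    have "e i1 i2 k1 k2 = (\<Sum>p<d. (if p = \<pi> i1 then \<phi> i1 else 0) * (\<Sum>q<d. (if q = \<pi> i2 then \<phi> i2 else 0) *
        (\<Sum>r<d. cnj (if r = \<pi> k1 then \<phi> k1 else 0) * (\<Sum>t<d. cnj (if t = \<pi> k2 then \<phi> k2 else 0) * e p q r t))))"
      by (rule inv[OF unitary_fun_monomial[OF that(1,2)] that(3-6)])
    also have "\<dots> = \<phi> i1 * (\<phi> i2 * (cnj (\<phi> k1) * (cnj (\<phi> k2) * e (\<pi> i1) (\<pi> i2) (\<pi> k1) (\<pi> k2))))"
      by (simp only: delta[where g = "\<lambda>x. x"] delta[where g = cnj] that complex_cnj_zero)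
    finally show ?thesis by (simp only: mult.assoc)
  qed
  have perm: "e i1 i2 k1 k2 = e (\<pi> i1) (\<pi> i2) (\<pi> k1) (\<pi> k2)"
    if "\<pi> permutes {..<d}" "i1 < d" "i2 < d" "k1 < d" "k2 < d" for \<pi> i1 i2 k1 k2
    using mono[of \<pi> "\<lambda>_. 1"] that by simp
  have phase: "e i1 i2 k1 k2 = 0" if lt: "i1 < d" "i2 < d" "k1 < d" "k2 < d"
    and ne: "\<not> (i1 = k1 \<and> i2 = k2)" "\<not> (i1 = k2 \<and> i2 = k1)" for i1 i2 k1 k2
  proof -
    \<comment> \<open>The phase at the index m is the imaginary unit rather than -1: in an entry
      such as \<open>e i i k k\<close> it occurs twice, and only a phase whose square differs from 1
      forces the entry to vanish.\<close>
    have *: "e i1 i2 k1 k2 = (if i1 = m then \<i> else 1) * (if i2 = m then \<i> else 1) *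
       cnj (if k1 = m then \<i> else 1) * cnj (if k2 = m then \<i> else 1) * e i1 i2 k1 k2" for m
      using mono[OF permutes_id, of "\<lambda>j. if j = m then \<i> else 1"] lt by simp
    show ?thesis
    proof (rule ccontr)
      assume "e i1 i2 k1 k2 \<noteq> 0"
      then have "(if i1 = m then \<i> else 1) * (if i2 = m then \<i> else 1) *
         cnj (if k1 = m then \<i> else 1) * cnj (if k2 = m then \<i> else 1) = 1" for m
        using *[of m] by (simp only: mult_cancel_right1 simp_thms)
      note P = this[of i1] this[of i2]
      consider "i1 = k1" "i2 \<noteq> k2" | "i1 = k2" "i2 \<noteq> k1" | "i1 \<noteq> k1" "i1 \<noteq> k2" using ne by blast
      then show False
      proof cases
        case 1 then show ?thesis using P(2) by (cases "k1 = i2") auto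
      next
        case 2 then show ?thesis using P(2) by (cases "i1 = i2") auto
      next
        case 3 then show ?thesis using P(1) by (cases "i2 = i1") auto
      qed
    qed
  qed
  \<comment> \<open>Ordered pairs of distinct indices form a single orbit, so one constant serves
    all entries of each mixed type.\<close>
  have two_transitive: "\<exists>\<pi>. \<pi> permutes {..<d} \<and> \<pi> i = 0 \<and> \<pi> k = 1" if "i < d" "k < d" "i \<noteq> k" for i k :: nat
  proof -
    define k' where "k' = Transposition.transpose i 0 k"
    have k': "k' < d" "k' \<noteq> 0" using that d by (auto simp: k'_def Transposition.transpose_def)
    have "(Transposition.transpose k' 1 \<circ> Transposition.transpose i 0) permutes {..<d}"
      using that d k' by (intro permutes_compose permutes_swap_id) auto
    moreover have "(Transposition.transpose k' 1 \<circ> Transposition.transpose i 0) i = 0"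
      using k' by (simp add: Transposition.transpose_def)
    moreover have "(Transposition.transpose k' 1 \<circ> Transposition.transpose i 0) k = 1"
      by (simp add: k'_def)
    ultimately show ?thesis by blast
  qed
  define \<alpha> where "\<alpha> = e 0 1 0 1"
  define \<beta> where "\<beta> = e 0 1 1 0"
  have a: "e i k i k = \<alpha>" and b: "e i k k i = \<beta>" if ik: "i < d" "k < d" "i \<noteq> k" for i k
  proof -
    obtain \<pi> where \<pi>: "\<pi> permutes {..<d}" "\<pi> i = 0" "\<pi> k = 1" using two_transitive[OF ik] by blast
    show "e i k i k = \<alpha>" using perm[OF \<pi>(1), of i k i k] \<pi> ik by (simp add: \<alpha>_def)
    show "e i k k i = \<beta>" using perm[OF \<pi>(1), of i k k i] \<pi> ik by (simp add: \<beta>_def)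
  qed
  have g: "e i i i i = \<alpha> + \<beta>" if i: "i < d" for i
  proof -
    define k :: nat where "k = (if i = 0 then 1 else 0)"
    have k: "k < d" "k \<noteq> i" using d by (auto simp: k_def)
    define H where "H = hadamard_rotation i k"
    have H: "unitary_fun d H" using unitary_fun_hadamard_rotation[of i d k] i k by (simp add: H_def)
    have sum: "(\<Sum>p<d. H i p * F p) = inv_sqrt2 * (F i + F k)" for F
      using sum_hadamard_rotation[of i d k i F] i k by (simp add: H_def)
    have cnj_H: "cnj (H i p) = H i p" for p by (simp add: H_def hadamard_rotation_def cnj_inv_sqrt2)
    have kk: "e k k k k = e i i i i"
      using perm[OF permutes_swap_id[of k "{..<d}" i], of k k k k] i k by simp
    \<comment> \<open>Of the sixteen entries with indices in {i, k}, phases leave six: two diagonal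
      ones, equal by a transposition, two equal to \<open>\<alpha>\<close> and two equal to
      \<open>\<beta>\<close>. Each has the weight (1 / sqrt 2)^4 = 1 / 4.\<close>
    have "e i i i i = (inv_sqrt2 * inv_sqrt2) * (inv_sqrt2 * inv_sqrt2) * (2 * e i i i i + 2 * \<alpha> + 2 * \<beta>)"
      by (subst inv[OF H i i i i], unfold cnj_H sum) (use i k in \<open>simp add: phase a b kk algebra_simps\<close>)
    then have *: "e i i i i = (1 / 2) * (1 / 2) * (2 * e i i i i + 2 * \<alpha> + 2 * \<beta>)" unfolding inv_sqrt2_mult_self .
    have "x = a + b" if "x = (1 / 2) * (1 / 2) * (2 * x + 2 * a + 2 * b)" for x a b :: complex
    proof -
      have 4: "4 * x = 2 * x + 2 * (a + b)"
        by (rule trans[OF arg_cong[OF that, of "\<lambda>y. 4 * y"]]) (simp add: algebra_simps)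
      have "2 * x = 4 * x - 2 * x" by simp
      also have "\<dots> = 2 * (a + b)" unfolding 4 by simp
      finally show ?thesis by (simp only: mult_cancel_left) simp
    qed
    then show ?thesis using * .
  qed
  show thesis
  proof (rule that)
    fix i1 i2 k1 k2 assume lt: "i1 < d" "i2 < d" "k1 < d" "k2 < d"
    consider "i1 = i2" "k1 = i1" "k2 = i1" | "i1 \<noteq> i2" "k1 = i1" "k2 = i2" | "i1 \<noteq> i2" "k1 = i2" "k2 = i1"
      | "\<not> (i1 = k1 \<and> i2 = k2)" "\<not> (i1 = k2 \<and> i2 = k1)" by blast
    then show "e i1 i2 k1 k2 = (if i1 = k1 \<and> i2 = k2 then \<alpha> else 0) + (if i1 = k2 \<and> i2 = k1 then \<beta> else 0)"
    proof cases
      case 1 then show ?thesis using g[OF lt(1)] by simp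
    next
      case 2 then show ?thesis using a[OF lt(1,2)] by simp
    next
      case 3 then show ?thesis using b[OF lt(1,2)] by simp
    next
      case 4 then show ?thesis using phase[OF lt 4] by (simp only: if_not_P[OF 4(1)] if_not_P[OF 4(2)] if_False add_0)
    qed
  qed
qed

section \<open>Integration against the Haar measure, second and fourth moments\<close>

lemma entries_mult_index:
  assumes "i < d" "j < d"
  shows "entries d (Matrix.mat d d (\<lambda>(i,j). W i j) * Matrix.mat d d U) (i,j) = (\<Sum>k<d. W i k * U (k,j))"
  using assms by (simp add: entries_def scalar_prod_def lessThan_atLeast0)

lemma borel_measurable_cnj [measurable]: "cnj \<in> borel_measurable borel"
  by (intro borel_measurable_continuous_onI continuous_intros)

lemma integral_double_sum:
  fixes f :: "'i \<Rightarrow> 'j \<Rightarrow> 'a \<Rightarrow> 'b :: {banach, second_countable_topology}"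
  assumes "\<And>i j. i \<in> I \<Longrightarrow> j \<in> J \<Longrightarrow> integrable M (f i j)"
  shows "(\<integral>x. (\<Sum>i\<in>I. \<Sum>j\<in>J. f i j x) \<partial>M) = (\<Sum>i\<in>I. \<Sum>j\<in>J. \<integral>x. f i j x \<partial>M)"
  using assms by (simp add: Bochner_Integration.integral_sum)

locale haar_measure =
  fixes d :: nat and \<mu> :: "(nat \<times> nat \<Rightarrow> complex) measure"
  assumes haar: "haar d \<mu>"
begin

lemma finite_measure_haar: "finite_measure \<mu>"
  using haar by (intro finite_measureI) (simp add: haar_def)

lemma measure_space_haar: "measure \<mu> (space \<mu>) = 1"
  using haar by (simp add: haar_def measure_def)

lemma sets_haar: "sets \<mu> = sets (mat_space d)"
  using haar by (simp add: haar_def)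

lemma measurable_entry [measurable]: "i < d \<Longrightarrow> j < d \<Longrightarrow> (\<lambda>U. U (i,j)) \<in> borel_measurable \<mu>"
  by (subst measurable_cong_sets[OF sets_haar refl]) (rule measurable_component_singleton, auto)

lemma AE_unitary_fun: "AE U in \<mu>. unitary_fun d (\<lambda>i j. U (i,j))"
  using haar unfolding haar_def unitary_mat_iff_unitary_fun[symmetric] by simp

text \<open>\<open>haar\<close> places U in the unitary group only almost everywhere, so a bound at
  unitary arguments has to be enough.\<close>

lemma integrable_AE_bound:
  fixes F :: "_ \<Rightarrow> 'b :: {banach, second_countable_topology}"
  assumes "F \<in> borel_measurable \<mu>" "AE U in \<mu>. unitary_fun d (\<lambda>i j. U (i,j)) \<longrightarrow> norm (F U) \<le> B"
  shows "integrable \<mu> F"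
proof (rule finite_measure.integrable_const_bound[OF finite_measure_haar _ assms(1)])
  show "AE U in \<mu>. norm (F U) \<le> B" using AE_unitary_fun assms(2) by eventually_elim auto
qed

lemma integral_left_translate:
  fixes F :: "_ \<Rightarrow> 'b :: {banach, second_countable_topology}"
  assumes W: "unitary_fun d W" and F: "F \<in> borel_measurable \<mu>"
  shows "(\<integral>U. F (entries d (Matrix.mat d d (\<lambda>(i,j). W i j) * Matrix.mat d d U)) \<partial>\<mu>) = (\<integral>U. F U \<partial>\<mu>)"
proof -
  let ?\<phi> = "\<lambda>U. entries d (Matrix.mat d d (\<lambda>(i,j). W i j) * Matrix.mat d d U)"
  have "?\<phi> = (\<lambda>U. \<lambda>ij\<in>{..<d} \<times> {..<d}. \<Sum>k<d. W (fst ij) k * U (k, snd ij))"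
    by (auto simp: entries_def restrict_def scalar_prod_def lessThan_atLeast0 fun_eq_iff)
  moreover have "(\<lambda>U. \<lambda>ij\<in>{..<d} \<times> {..<d}. \<Sum>k<d. W (fst ij) k * U (k, snd ij)) \<in> measurable \<mu> (mat_space d)"
    by (rule measurable_restrict) (auto intro!: borel_measurable_sum borel_measurable_times measurable_entry)
  ultimately have \<phi>: "?\<phi> \<in> measurable \<mu> \<mu>"
    by (subst measurable_cong_sets[OF refl sets_haar]) simp
  have "distr \<mu> \<mu> ?\<phi> = \<mu>"
    using haar W unfolding haar_def unitary_mat_iff_unitary_fun[symmetric] by blast
  then have "(\<integral>U. F U \<partial>\<mu>) = (\<integral>U. F U \<partial>distr \<mu> \<mu> ?\<phi>)" by simp
  also have "\<dots> = (\<integral>U. F (?\<phi> U) \<partial>\<mu>)" by (rule integral_distr[OF \<phi> F])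
  finally show ?thesis ..
qed

text \<open>The column indices come first: with them fixed, the moment is a tensor in the row
  indices, and it is on these that left translation by a unitary acts.\<close>

definition mom4 :: "nat \<Rightarrow> nat \<Rightarrow> nat \<Rightarrow> nat \<Rightarrow> nat \<Rightarrow> nat \<Rightarrow> nat \<Rightarrow> nat \<Rightarrow> complex" where
  "mom4 j1 j2 l1 l2 i1 i2 k1 k2 = (\<integral>U. U (i1,j1) * U (i2,j2) * cnj (U (k1,l1)) * cnj (U (k2,l2)) \<partial>\<mu>)"

lemma integrable_mom4:
  assumes "i1 < d" "i2 < d" "k1 < d" "k2 < d" "j1 < d" "j2 < d" "l1 < d" "l2 < d"
  shows "integrable \<mu> (\<lambda>U. U (i1,j1) * U (i2,j2) * cnj (U (k1,l1)) * cnj (U (k2,l2)))"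
proof (rule integrable_AE_bound[where B = 1])
  show "(\<lambda>U. U (i1,j1) * U (i2,j2) * cnj (U (k1,l1)) * cnj (U (k2,l2))) \<in> borel_measurable \<mu>"
    using assms by measurable
  show "AE U in \<mu>. unitary_fun d (\<lambda>i j. U (i, j)) \<longrightarrow>
      norm (U (i1,j1) * U (i2,j2) * cnj (U (k1,l1)) * cnj (U (k2,l2))) \<le> 1"
    using assms unitary_fun_norm_le_1 by (auto simp: norm_mult intro!: mult_le_one AE_I2)
qed

lemma mom4_invariant:
  assumes W: "unitary_fun d W" and lt: "i1 < d" "i2 < d" "k1 < d" "k2 < d" "j1 < d" "j2 < d" "l1 < d" "l2 < d"
  shows "mom4 j1 j2 l1 l2 i1 i2 k1 k2 = (\<Sum>p<d. W i1 p * (\<Sum>q<d. W i2 q * (\<Sum>r<d. cnj (W k1 r) *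
    (\<Sum>t<d. cnj (W k2 t) * mom4 j1 j2 l1 l2 p q r t))))"
proof -
  have "(\<lambda>U. U (i1,j1) * U (i2,j2) * cnj (U (k1,l1)) * cnj (U (k2,l2))) \<in> borel_measurable \<mu>"
    using lt by measurable
  from integral_left_translate[OF W this]
  have "mom4 j1 j2 l1 l2 i1 i2 k1 k2 = (\<integral>U. (\<Sum>p<d. W i1 p * U (p,j1)) * (\<Sum>q<d. W i2 q * U (q,j2)) *
      cnj (\<Sum>r<d. W k1 r * U (r,l1)) * cnj (\<Sum>t<d. W k2 t * U (t,l2)) \<partial>\<mu>)"
    using lt by (simp add: mom4_def entries_mult_index)
  also have "\<dots> = (\<integral>U. (\<Sum>p<d. W i1 p * (\<Sum>q<d. W i2 q * (\<Sum>r<d. cnj (W k1 r) *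
    (\<Sum>t<d. cnj (W k2 t) * (U (p,j1) * U (q,j2) * cnj (U (r,l1)) * cnj (U (t,l2))))))) \<partial>\<mu>)"
  proof (intro Bochner_Integration.integral_cong refl)
    fix U :: "nat \<times> nat \<Rightarrow> complex"
    have pull: "(\<Sum>t<d. y t * (k * z t)) = k * (\<Sum>t<d. y t * z t)"
      "(\<Sum>t<d. y t * (z t * k)) = (\<Sum>t<d. y t * z t) * k" for y z and k :: complex
      by (simp_all add: sum_distrib_left sum_distrib_right mult_ac)
    show "(\<Sum>p<d. W i1 p * U (p,j1)) * (\<Sum>q<d. W i2 q * U (q,j2)) *
        cnj (\<Sum>r<d. W k1 r * U (r,l1)) * cnj (\<Sum>t<d. W k2 t * U (t,l2)) =
      (\<Sum>p<d. W i1 p * (\<Sum>q<d. W i2 q * (\<Sum>r<d. cnj (W k1 r) *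
        (\<Sum>t<d. cnj (W k2 t) * (U (p,j1) * U (q,j2) * cnj (U (r,l1)) * cnj (U (t,l2)))))))"
      by (simp only: mult.assoc pull) simp
  qed
  also have "\<dots> = (\<Sum>p<d. W i1 p * (\<Sum>q<d. W i2 q * (\<Sum>r<d. cnj (W k1 r) *
    (\<Sum>t<d. cnj (W k2 t) * mom4 j1 j2 l1 l2 p q r t))))"
  proof -
    have int: "integrable \<mu> (\<lambda>U. \<Sum>p<d. a p * G p U)" if "\<And>p. p < d \<Longrightarrow> integrable \<mu> (G p)"
      for a and G :: "nat \<Rightarrow> _ \<Rightarrow> complex" using that by auto
    have eq: "(\<integral>U. (\<Sum>p<d. a p * G p U) \<partial>\<mu>) = (\<Sum>p<d. a p * H p)"
      if "\<And>p. p < d \<Longrightarrow> integrable \<mu> (G p)" "\<And>p. p < d \<Longrightarrow> (\<integral>U. G p U \<partial>\<mu>) = H p"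
      for a H and G :: "nat \<Rightarrow> _ \<Rightarrow> complex"
      using that by (subst Bochner_Integration.integral_sum) auto
    show ?thesis by (intro eq int integrable_mom4 mom4_def[symmetric] lt)
  qed
  finally show ?thesis .
qed

text \<open>Contracting row indices turns the integrand into products of inner products of columns
  of U, which are constant almost everywhere. These values determine the two constants that
  invariance leaves open.\<close>

lemma mom4_contract:
  assumes lt: "j1 < d" "j2 < d" "l1 < d" "l2 < d"
  shows "(\<Sum>i1<d. \<Sum>i2<d. mom4 j1 j2 l1 l2 i1 i2 i1 i2) = (if j1 = l1 \<and> j2 = l2 then 1 else 0)" (is ?A)
    and "(\<Sum>i1<d. \<Sum>i2<d. mom4 j1 j2 l1 l2 i1 i2 i2 i1) = (if j1 = l2 \<and> j2 = l1 then 1 else 0)" (is ?B)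
proof -
  have const: "(\<integral>U. F U \<partial>\<mu>) = c" if "AE U in \<mu>. unitary_fun d (\<lambda>i j. U (i,j)) \<longrightarrow> F U = c"
    "F \<in> borel_measurable \<mu>" for F and c :: complex
  proof -
    have "(\<integral>U. F U \<partial>\<mu>) = (\<integral>U. c \<partial>\<mu>)"
      by (rule integral_cong_AE) (use that AE_unitary_fun in \<open>auto elim: eventually_elim2\<close>)
    then show ?thesis by (simp add: measure_space_haar)
  qed
  have "(\<Sum>i1<d. \<Sum>i2<d. mom4 j1 j2 l1 l2 i1 i2 i1 i2) =
    (\<integral>U. (\<Sum>i1<d. \<Sum>i2<d. U (i1,j1) * U (i2,j2) * cnj (U (i1,l1)) * cnj (U (i2,l2))) \<partial>\<mu>)"
    unfolding mom4_def by (rule integral_double_sum[symmetric], rule integrable_mom4) (use lt in auto)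
  also have "\<dots> = (\<integral>U. (\<Sum>i1<d. cnj (U (i1,l1)) * U (i1,j1)) * (\<Sum>i2<d. cnj (U (i2,l2)) * U (i2,j2)) \<partial>\<mu>)"
    (is "_ = (\<integral>U. ?F U \<partial>\<mu>)")
    by (intro Bochner_Integration.integral_cong refl) (simp add: sum_product mult_ac)
  also have "\<dots> = (if j1 = l1 \<and> j2 = l2 then 1 else 0)" (is "_ = (if ?c then 1 else 0)")
  proof (rule const)
    show "AE U in \<mu>. unitary_fun d (\<lambda>i j. U (i,j)) \<longrightarrow> ?F U = (if ?c then 1 else 0)"
      using lt by (intro AE_I2) (simp add: unitary_fun_def)
  qed (use lt in measurable)
  finally show ?A .
  have "(\<Sum>i1<d. \<Sum>i2<d. mom4 j1 j2 l1 l2 i1 i2 i2 i1) =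
    (\<integral>U. (\<Sum>i1<d. \<Sum>i2<d. U (i1,j1) * U (i2,j2) * cnj (U (i2,l1)) * cnj (U (i1,l2))) \<partial>\<mu>)"
    unfolding mom4_def by (rule integral_double_sum[symmetric], rule integrable_mom4) (use lt in auto)
  also have "\<dots> = (\<integral>U. (\<Sum>i1<d. cnj (U (i1,l2)) * U (i1,j1)) * (\<Sum>i2<d. cnj (U (i2,l1)) * U (i2,j2)) \<partial>\<mu>)"
    (is "_ = (\<integral>U. ?F U \<partial>\<mu>)")
    by (intro Bochner_Integration.integral_cong refl) (simp add: sum_product mult_ac)
  also have "\<dots> = (if j1 = l2 \<and> j2 = l1 then 1 else 0)" (is "_ = (if ?c then 1 else 0)")
  proof (rule const)
    show "AE U in \<mu>. unitary_fun d (\<lambda>i j. U (i,j)) \<longrightarrow> ?F U = (if ?c then 1 else 0)"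
      using lt by (intro AE_I2) (simp add: unitary_fun_def)
  qed (use lt in measurable)
  finally show ?B .
qed

text \<open>The Weingarten formula for fourth moments, with the denominator d (d^2 - 1) cleared.
  Invariance leaves two constants, and the two contractions give the linear system d^2 \<alpha> + d
  \<beta> = D1, d \<alpha> + d^2 \<beta> = D2.\<close>

lemma mom4_eq:
  assumes d: "2 \<le> d" and lt: "i1 < d" "i2 < d" "k1 < d" "k2 < d" "j1 < d" "j2 < d" "l1 < d" "l2 < d"
  defines "D1 \<equiv> (if j1 = l1 \<and> j2 = l2 then 1 else 0)" and "D2 \<equiv> (if j1 = l2 \<and> j2 = l1 then 1 else 0)"
  shows "of_nat d * (of_nat d ^ 2 - 1) * mom4 j1 j2 l1 l2 i1 i2 k1 k2 =
    (if i1 = k1 \<and> i2 = k2 then of_nat d * D1 - D2 else 0) + (if i1 = k2 \<and> i2 = k1 then of_nat d * D2 - D1 else 0)"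
proof -
  obtain \<alpha> \<beta> where ab: "\<And>i1 i2 k1 k2. i1 < d \<Longrightarrow> i2 < d \<Longrightarrow> k1 < d \<Longrightarrow> k2 < d \<Longrightarrow>
      mom4 j1 j2 l1 l2 i1 i2 k1 k2 = (if i1 = k1 \<and> i2 = k2 then \<alpha> else 0) + (if i1 = k2 \<and> i2 = k1 then \<beta> else 0)"
  proof (rule unitary_invariant_tensor[OF d])
    show "mom4 j1 j2 l1 l2 i1 i2 k1 k2 = (\<Sum>p<d. W i1 p * (\<Sum>q<d. W i2 q * (\<Sum>r<d. cnj (W k1 r) *
      (\<Sum>t<d. cnj (W k2 t) * mom4 j1 j2 l1 l2 p q r t))))"
      if "unitary_fun d W" "i1 < d" "i2 < d" "k1 < d" "k2 < d" for W i1 i2 k1 k2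
      by (rule mom4_invariant[OF that lt(5-8)])
  qed (rule that)
  have "(\<Sum>i1<d. \<Sum>i2<d. mom4 j1 j2 l1 l2 i1 i2 i1 i2) = (\<Sum>i1<d. \<Sum>i2<d. \<alpha> + (if i1 = i2 then \<beta> else 0))"
    by (intro sum.cong refl) (simp add: ab)
  also have "\<dots> = of_nat d ^ 2 * \<alpha> + of_nat d * \<beta>" by (simp add: sum.distrib power2_eq_square distrib_left mult.assoc)
  finally have 1: "of_nat d ^ 2 * \<alpha> + of_nat d * \<beta> = D1" using mom4_contract(1)[of j1 j2 l1 l2] lt by (simp add: D1_def)
  have "(\<Sum>i1<d. \<Sum>i2<d. mom4 j1 j2 l1 l2 i1 i2 i2 i1) = (\<Sum>i1<d. \<Sum>i2<d. (if i1 = i2 then \<alpha> else 0) + \<beta>)"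
    by (intro sum.cong refl) (simp add: ab)
  also have "\<dots> = of_nat d * \<alpha> + of_nat d ^ 2 * \<beta>" by (simp add: sum.distrib power2_eq_square distrib_left mult.assoc)
  finally have 2: "of_nat d * \<alpha> + of_nat d ^ 2 * \<beta> = D2" using mom4_contract(2)[of j1 j2 l1 l2] lt by (simp add: D2_def)
  have "of_nat d * (of_nat d ^ 2 - 1) * \<alpha> = of_nat d * (of_nat d ^ 2 * \<alpha> + of_nat d * \<beta>)
      - (of_nat d * \<alpha> + of_nat d ^ 2 * \<beta>)"
    by (simp add: algebra_simps power2_eq_square)
  moreover have "of_nat d * (of_nat d ^ 2 - 1) * \<beta> = of_nat d * (of_nat d * \<alpha> + of_nat d ^ 2 * \<beta>)
      - (of_nat d ^ 2 * \<alpha> + of_nat d * \<beta>)"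
    by (simp add: algebra_simps power2_eq_square)
  moreover have "C * ((if P then \<alpha> else 0) + (if Q then \<beta> else 0)) = (if P then a else 0) + (if Q then b else 0)"
    if "C * \<alpha> = a" "C * \<beta> = b" for C a b P Q using that by (auto simp: distrib_left)
  ultimately show ?thesis unfolding 1 2 ab[OF lt(1-4)] by blast
qed


text \<open>The second moments are read off the fourth ones: the squared moduli in column 0 of U sum
  to 1, so this sum can be inserted as a factor. The fourth-moment formula asks for d >= 2; for d =
  1 the only entry has modulus 1.\<close>

lemma mom2_eq:
  assumes lt: "i < d" "j < d" "a < d" "b < d"
  shows "(\<integral>U. U (i,a) * cnj (U (j,b)) \<partial>\<mu>) = (if i = j \<and> a = b then 1 / of_nat d else 0)"
proof (cases "d = 1")
  case True
  have "(\<integral>U. U (i,a) * cnj (U (j,b)) \<partial>\<mu>) = (\<integral>U. 1 \<partial>\<mu>)"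
  proof (rule integral_cong_AE)
    show "AE U in \<mu>. U (i,a) * cnj (U (j,b)) = 1"
      using AE_unitary_fun by eventually_elim (use True lt in \<open>simp add: unitary_fun_def\<close>)
  qed (use lt in measurable)
  then show ?thesis using True lt by (simp add: measure_space_haar)
next
  case False
  then have d: "2 \<le> d" using lt by linarith
  have "0 < d" using d by simp
  have "(\<integral>U. U (i,a) * cnj (U (j,b)) \<partial>\<mu>) = (\<integral>U. (\<Sum>p<d. U (i,a) * U (p,0) * cnj (U (j,b)) * cnj (U (p,0))) \<partial>\<mu>)"
  proof (rule integral_cong_AE)
    show "AE U in \<mu>. U (i,a) * cnj (U (j,b)) = (\<Sum>p<d. U (i,a) * U (p,0) * cnj (U (j,b)) * cnj (U (p,0)))"
      using AE_unitary_fun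
    proof eventually_elim
      case (elim U)
      have "(\<Sum>p<d. U (i,a) * U (p,0) * cnj (U (j,b)) * cnj (U (p,0))) =
          U (i,a) * cnj (U (j,b)) * (\<Sum>p<d. cnj (U (p,0)) * U (p,0))"
        by (simp only: sum_distrib_left mult_ac)
      then show ?case using elim \<open>0 < d\<close> by (simp add: unitary_fun_def)
    qed
  qed (use lt \<open>0 < d\<close> in measurable)
  also have "\<dots> = (\<Sum>p<d. mom4 a 0 b 0 i p j p)"
    unfolding mom4_def by (rule Bochner_Integration.integral_sum, rule integrable_mom4) (use lt \<open>0 < d\<close> in auto)
  finally have "of_nat d * (of_nat d ^ 2 - 1) * (\<integral>U. U (i,a) * cnj (U (j,b)) \<partial>\<mu>) =
     (\<Sum>p<d. of_nat d * (of_nat d ^ 2 - 1) * mom4 a 0 b 0 i p j p)"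
    by (simp only: sum_distrib_left)
  also have "\<dots> = (\<Sum>p<d. (if i = j then of_nat d * (if a = b then 1 else 0) - (if a = 0 \<and> b = 0 then 1 else 0) else 0)
       + (if p = i then if i = j then of_nat d * (if a = 0 \<and> b = 0 then 1 else 0) - (if a = b then 1 else 0) else 0 else 0))"
  proof (intro sum.cong refl)
    fix p assume "p \<in> {..<d}"
    then show "of_nat d * (of_nat d ^ 2 - 1) * mom4 a 0 b 0 i p j p =
      (if i = j then of_nat d * (if a = b then 1 else 0) - (if a = 0 \<and> b = 0 then 1 else 0) else 0)
       + (if p = i then if i = j then of_nat d * (if a = 0 \<and> b = 0 then 1 else 0) - (if a = b then 1 else 0) else 0 else 0)"
      by (subst mom4_eq[OF d]) (use lt \<open>0 < d\<close> in auto)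
  qed
  also have "\<dots> = (if i = j \<and> a = b then of_nat d ^ 2 - 1 else 0)"
    using lt by (auto simp: sum.distrib algebra_simps power2_eq_square)
  finally have *: "of_nat d * (of_nat d ^ 2 - 1) * (\<integral>U. U (i,a) * cnj (U (j,b)) \<partial>\<mu>) = (if i = j \<and> a = b then of_nat d ^ 2 - 1 else 0)" .
  have "of_nat d ^ 2 \<noteq> (1::complex)" using d by (auto simp flip: of_nat_power)
  then have nz: "of_nat d ^ 2 - 1 \<noteq> (0::complex)" "of_nat d \<noteq> (0::complex)" using \<open>0 < d\<close> by auto
  show ?thesis
  proof (cases "i = j \<and> a = b")
    case True
    have "(of_nat d ^ 2 - 1) * (of_nat d * (\<integral>U. U (i,a) * cnj (U (j,b)) \<partial>\<mu>)) = (of_nat d ^ 2 - 1) * 1"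
      using * unfolding if_P[OF True] by (simp only: mult_ac mult_1_right mult_1_left)
    then have "of_nat d * (\<integral>U. U (i,a) * cnj (U (j,b)) \<partial>\<mu>) = 1"
      using nz by (simp only: mult_cancel_left) simp
    then show ?thesis unfolding if_P[OF True] using nz by (simp add: field_simps)
  next
    case False
    from * nz show ?thesis unfolding if_not_P[OF False] by simp
  qed
qed

end

section \<open>Mean and variance of sesquilinear forms in the entries of U\<close>

lemma sum_if_const: "(\<Sum>x\<in>A. if P then f x else 0) = (if P then sum f A else (0 :: 'b :: comm_monoid_add))"
  by simp

context haar_measure
begin

text \<open>Read w as a matrix on a tensor product, with rows (a, i) and columns (b, j). Then
  \<open>t\<close> is its trace and \<open>R1\<close>, \<open>R2\<close> are its partial traces, and
  each of the four terms of the moment formula contracts w to one of these or to an entry of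
  w.\<close>

lemma mom4_contract_tensor:
  fixes w :: "nat \<Rightarrow> nat \<Rightarrow> nat \<Rightarrow> nat \<Rightarrow> complex"
  assumes d: "2 \<le> d" and lt: "a < d" "i < d" "b < d" "j < d"
  defines "t \<equiv> \<Sum>a<d. \<Sum>i<d. w a i a i" and "R1 \<equiv> \<lambda>a b. \<Sum>i<d. w a i b i" and "R2 \<equiv> \<lambda>i j. \<Sum>a<d. w a i a j"
  shows "of_nat d * (of_nat d ^ 2 - 1) * (\<Sum>a'<d. \<Sum>i'<d. \<Sum>b'<d. \<Sum>j'<d. w a' i' b' j' * mom4 a b' b a' i j' j i') =
    (if i = j then (if a = b then of_nat d * t else 0) - R1 a b else 0) +
    (of_nat d * w a i b j - (if a = b then R2 i j else 0))"
    (is "?L = ?R")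
proof -
  have "?L =
    (\<Sum>a'<d. \<Sum>i'<d. \<Sum>b'<d. \<Sum>j'<d. w a' i' b' j' * (of_nat d * (of_nat d ^ 2 - 1) * mom4 a b' b a' i j' j i'))"
    by (simp only: sum_distrib_left mult.left_commute[of "of_nat d * (of_nat d ^ 2 - 1)"])
  also have "\<dots> = (\<Sum>a'<d. \<Sum>i'<d. \<Sum>b'<d. \<Sum>j'<d.
      (if i = j then (if a = b then of_nat d * (if j' = i' then if b' = a' then w a' i' b' j' else 0 else 0) else 0)
        - (if j' = i' then if b' = b then if a' = a then w a' i' b' j' else 0 else 0 else 0) else 0) +
      (of_nat d * (if j' = j then if b' = b then if i' = i then if a' = a then w a' i' b' j' else 0 else 0 else 0 else 0)
        - (if a = b then (if j' = j then if b' = a' then if i' = i then w a' i' b' j' else 0 else 0 else 0) else 0)))"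
  proof (intro sum.cong refl)
    fix a' i' b' j' assume "a' \<in> {..<d}" "i' \<in> {..<d}" "b' \<in> {..<d}" "j' \<in> {..<d}"
    then have lt': "a' < d" "i' < d" "b' < d" "j' < d" by auto
    show "w a' i' b' j' * (of_nat d * (of_nat d ^ 2 - 1) * mom4 a b' b a' i j' j i') =
      (if i = j then (if a = b then of_nat d * (if j' = i' then if b' = a' then w a' i' b' j' else 0 else 0) else 0)
        - (if j' = i' then if b' = b then if a' = a then w a' i' b' j' else 0 else 0 else 0) else 0) +
      (of_nat d * (if j' = j then if b' = b then if i' = i then if a' = a then w a' i' b' j' else 0 else 0 else 0 else 0)
        - (if a = b then (if j' = j then if b' = a' then if i' = i then w a' i' b' j' else 0 else 0 else 0) else 0))"
      unfolding mom4_eq[OF d lt(2) lt'(4) lt(4) lt'(2) lt(1) lt'(3) lt(3) lt'(1)]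
      by (cases "a = b"; cases "i = j"; cases "j' = i'"; cases "b' = a'"; cases "a' = a"; cases "i' = i";
          simp add: algebra_simps eq_commute[of b b'] eq_commute[of a a'] eq_commute[of i i'] eq_commute[of j j'])
  qed
  also have "\<dots> = ?R"
    by (simp only: sum.distrib sum_subtractf sum_if_const sum_distrib_left[symmetric] sum.delta finite_lessThan
        lessThan_iff lt if_True t_def R1_def R2_def)
      (use lt in \<open>simp add: sum_if_const cong: if_cong\<close>)
  finally show ?thesis .
qed

lemma integrable_mom2:
  assumes lt: "a < d" "i < d" "b < d" "j < d"
  shows "integrable \<mu> (\<lambda>U. U (i,a) * cnj (U (j,b)))"
proof (rule integrable_AE_bound[where B = 1])
  show "(\<lambda>U. U (i,a) * cnj (U (j,b))) \<in> borel_measurable \<mu>" using lt by measurable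
  show "AE U in \<mu>. unitary_fun d (\<lambda>i j. U (i, j)) \<longrightarrow> norm (U (i,a) * cnj (U (j,b))) \<le> 1"
    using lt unitary_fun_norm_le_1 by (auto simp: norm_mult intro!: mult_le_one AE_I2)
qed

lemma integrable_entry_form:
  fixes w :: "nat \<Rightarrow> nat \<Rightarrow> nat \<Rightarrow> nat \<Rightarrow> complex"
  shows "integrable \<mu> (\<lambda>U. \<Sum>a<d. \<Sum>i<d. \<Sum>b<d. \<Sum>j<d. w a i b j * (U (i,a) * cnj (U (j,b))))"
  by (intro Bochner_Integration.integrable_sum integrable_mult_right integrable_mom2) auto

lemma integral_entry_form:
  fixes w :: "nat \<Rightarrow> nat \<Rightarrow> nat \<Rightarrow> nat \<Rightarrow> complex"
  assumes "0 < d"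
  shows "of_nat d * (\<integral>U. (\<Sum>a<d. \<Sum>i<d. \<Sum>b<d. \<Sum>j<d. w a i b j * (U (i,a) * cnj (U (j,b)))) \<partial>\<mu>) =
    (\<Sum>a<d. \<Sum>i<d. w a i a i)"
proof -
  have "(\<integral>U. (\<Sum>a<d. \<Sum>i<d. \<Sum>b<d. \<Sum>j<d. w a i b j * (U (i,a) * cnj (U (j,b)))) \<partial>\<mu>) =
    (\<Sum>a<d. \<Sum>i<d. \<integral>U. (\<Sum>b<d. \<Sum>j<d. w a i b j * (U (i,a) * cnj (U (j,b)))) \<partial>\<mu>)"
    by (rule integral_double_sum, intro Bochner_Integration.integrable_sum integrable_mult_right integrable_mom2) auto
  also have "\<dots> = (\<Sum>a<d. \<Sum>i<d. \<Sum>b<d. \<Sum>j<d. w a i b j * (if i = j \<and> a = b then 1 / of_nat d else 0))"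
  proof (intro sum.cong refl)
    fix a i assume ai: "a \<in> {..<d}" "i \<in> {..<d}"
    have "(\<integral>U. (\<Sum>b<d. \<Sum>j<d. w a i b j * (U (i,a) * cnj (U (j,b)))) \<partial>\<mu>) =
      (\<Sum>b<d. \<Sum>j<d. \<integral>U. w a i b j * (U (i,a) * cnj (U (j,b))) \<partial>\<mu>)"
      by (rule integral_double_sum, intro integrable_mult_right integrable_mom2) (use ai in auto)
    also have "\<dots> = (\<Sum>b<d. \<Sum>j<d. w a i b j * (if i = j \<and> a = b then 1 / of_nat d else 0))"
      using ai by (intro sum.cong refl) (simp add: mom2_eq)
    finally show "(\<integral>U. (\<Sum>b<d. \<Sum>j<d. w a i b j * (U (i,a) * cnj (U (j,b)))) \<partial>\<mu>) =
      (\<Sum>b<d. \<Sum>j<d. w a i b j * (if i = j \<and> a = b then 1 / of_nat d else 0))" .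
  qed
  also have "\<dots> = (\<Sum>a<d. \<Sum>i<d. \<Sum>b<d. \<Sum>j<d. if j = i then if b = a then w a i b j / of_nat d else 0 else 0)"
    by (intro sum.cong refl) auto
  also have "\<dots> = (\<Sum>a<d. \<Sum>i<d. w a i a i / of_nat d)" by simp
  finally show ?thesis using assms by (simp add: sum_distrib_left)
qed

text \<open>Expanding the squared modulus produces fourth moments. Contracting the conjugate copy of
  w by \<open>mom4_contract_tensor\<close> and then summing against w turns the four terms into
  squared Hilbert-Schmidt norms, those of the partial traces with a negative sign.\<close>

lemma integral_entry_form_sq:
  fixes w :: "nat \<Rightarrow> nat \<Rightarrow> nat \<Rightarrow> nat \<Rightarrow> complex"
  assumes d: "2 \<le> d"
  defines "\<Phi> \<equiv> \<lambda>U. \<Sum>a<d. \<Sum>i<d. \<Sum>b<d. \<Sum>j<d. w a i b j * (U (i,a) * cnj (U (j,b)))"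
    and "R1 \<equiv> \<lambda>a b. \<Sum>i<d. w a i b i" and "R2 \<equiv> \<lambda>i j. \<Sum>a<d. w a i a j"
  shows "real d * (real d ^ 2 - 1) * (\<integral>U. (norm (\<Phi> U))\<^sup>2 \<partial>\<mu>) =
      real d * (norm (\<Sum>a<d. \<Sum>i<d. w a i a i))\<^sup>2 + real d * (\<Sum>a<d. \<Sum>i<d. \<Sum>b<d. \<Sum>j<d. (norm (w a i b j))\<^sup>2)
      - (\<Sum>a<d. \<Sum>b<d. (norm (R1 a b))\<^sup>2) - (\<Sum>i<d. \<Sum>j<d. (norm (R2 i j))\<^sup>2)"
proof -
  define t where "t = (\<Sum>a<d. \<Sum>i<d. w a i a i)"
  define C :: complex where "C = of_nat d * (of_nat d ^ 2 - 1)"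
  define M where "M a i b j a' i' b' j' U = U (i,a) * U (j',b') * cnj (U (j,b)) * cnj (U (i',a'))"
    for a i b j a' i' b' j' and U :: "nat \<times> nat \<Rightarrow> complex"
  let ?E = "\<lambda>a i b j. \<Sum>a'<d. \<Sum>i'<d. \<Sum>b'<d. \<Sum>j'<d. cnj (w a' i' b' j') * mom4 a b' b a' i j' j i'"
  let ?F = "\<lambda>U a i b j. \<Sum>a'<d. \<Sum>i'<d. \<Sum>b'<d. \<Sum>j'<d. cnj (w a' i' b' j') * M a i b j a' i' b' j' U"
  have intM: "integrable \<mu> (M a i b j a' i' b' j')"
    if "a < d" "i < d" "b < d" "j < d" "a' < d" "i' < d" "b' < d" "j' < d" for a i b j a' i' b' j'
    unfolding M_def by (rule integrable_mom4) (use that in auto)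
  have "\<Phi> U * cnj (\<Phi> U) = (\<Sum>a<d. \<Sum>i<d. \<Sum>b<d. \<Sum>j<d. w a i b j * ?F U a i b j)" for U
  proof -
    have "\<Phi> U * cnj (\<Phi> U) = (\<Sum>a<d. \<Sum>i<d. \<Sum>b<d. \<Sum>j<d. w a i b j * (U (i,a) * cnj (U (j,b))) * cnj (\<Phi> U))"
      by (simp only: \<Phi>_def sum_distrib_right)
    also have "\<dots> = (\<Sum>a<d. \<Sum>i<d. \<Sum>b<d. \<Sum>j<d. w a i b j * ?F U a i b j)"
    proof (intro sum.cong refl)
      fix a i b j
      have "w a i b j * (U (i,a) * cnj (U (j,b))) * cnj (\<Phi> U) =
        w a i b j * (\<Sum>a'<d. \<Sum>i'<d. \<Sum>b'<d. \<Sum>j'<d. (U (i,a) * cnj (U (j,b))) * cnj (w a' i' b' j' * (U (i',a') * cnj (U (j',b')))))"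
        by (simp only: \<Phi>_def cnj_sum sum_distrib_left mult.assoc)
      also have "\<dots> = w a i b j * ?F U a i b j"
        by (rule arg_cong2[where f = "(*)", OF refl], intro sum.cong refl) (simp add: M_def mult_ac)
      finally show "w a i b j * (U (i,a) * cnj (U (j,b))) * cnj (\<Phi> U) =
        w a i b j * ?F U a i b j" .
    qed
    finally show ?thesis .
  qed
  then have "(\<integral>U. \<Phi> U * cnj (\<Phi> U) \<partial>\<mu>) = (\<integral>U. (\<Sum>a<d. \<Sum>i<d. \<Sum>b<d. \<Sum>j<d. w a i b j * ?F U a i b j) \<partial>\<mu>)" by (simp only:)
  also have "\<dots> = (\<Sum>a<d. \<Sum>i<d. \<Sum>b<d. \<Sum>j<d. w a i b j * ?E a i b j)"
  proof -
    have int: "integrable \<mu> (\<lambda>U. \<Sum>p<d. G p U)" if "\<And>p. p < d \<Longrightarrow> integrable \<mu> (G p)"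
      for G :: "nat \<Rightarrow> _ \<Rightarrow> complex" using that by auto
    have eq: "(\<integral>U. (\<Sum>p<d. G p U) \<partial>\<mu>) = (\<Sum>p<d. H p)"
      if "\<And>p. p < d \<Longrightarrow> integrable \<mu> (G p)" "\<And>p. p < d \<Longrightarrow> (\<integral>U. G p U \<partial>\<mu>) = H p"
      for H and G :: "nat \<Rightarrow> _ \<Rightarrow> complex"
      using that by (subst Bochner_Integration.integral_sum) auto
    have mul: "(\<integral>U. c * G U \<partial>\<mu>) = c * H" if "(\<integral>U. G U \<partial>\<mu>) = H" for c H :: complex and G
      using that by simp
    show ?thesis
      by (intro eq int mul integrable_mult_right intM) (simp_all add: M_def mom4_def)
  qed
  finally have "C * (\<integral>U. \<Phi> U * cnj (\<Phi> U) \<partial>\<mu>) = (\<Sum>a<d. \<Sum>i<d. \<Sum>b<d. \<Sum>j<d. w a i b j * (C * ?E a i b j))"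
    by (simp only: sum_distrib_left mult.left_commute[of C])
  also have "\<dots> = (\<Sum>a<d. \<Sum>i<d. \<Sum>b<d. \<Sum>j<d.
      (if j = i then if b = a then of_nat d * cnj t * w a i b j else 0 else 0)
      - (if j = i then w a i b j * cnj (R1 a b) else 0) + of_nat d * (w a i b j * cnj (w a i b j))
      - (if b = a then w a i b j * cnj (R2 i j) else 0))"
  proof (intro sum.cong refl)
    fix a i b j assume "a \<in> {..<d}" "i \<in> {..<d}" "b \<in> {..<d}" "j \<in> {..<d}"
    then have lt: "a < d" "i < d" "b < d" "j < d" by auto
    have *: "C * ?E a i b j =
      (if i = j then (if a = b then of_nat d * cnj t else 0) - cnj (R1 a b) else 0) +
      (of_nat d * cnj (w a i b j) - (if a = b then cnj (R2 i j) else 0))"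
      unfolding C_def t_def R1_def R2_def cnj_sum by (rule mom4_contract_tensor[OF d lt])
    show "w a i b j * (C * ?E a i b j) =
      (if j = i then if b = a then of_nat d * cnj t * w a i b j else 0 else 0)
      - (if j = i then w a i b j * cnj (R1 a b) else 0) + of_nat d * (w a i b j * cnj (w a i b j))
      - (if b = a then w a i b j * cnj (R2 i j) else 0)"
      unfolding * by (cases "a = b"; cases "i = j") (simp_all add: algebra_simps)
  qed
  also have "\<dots> = of_nat d * (t * cnj t) - (\<Sum>a<d. \<Sum>b<d. R1 a b * cnj (R1 a b))
     + of_nat d * (\<Sum>a<d. \<Sum>i<d. \<Sum>b<d. \<Sum>j<d. w a i b j * cnj (w a i b j)) - (\<Sum>i<d. \<Sum>j<d. R2 i j * cnj (R2 i j))"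
  proof -
    have "(\<Sum>a<d. \<Sum>i<d. \<Sum>b<d. \<Sum>j<d. if j = i then if b = a then of_nat d * cnj t * w a i b j else 0 else 0) = of_nat d * (t * cnj t)"
      (is "?X = _")
    proof -
      have "?X =
        (\<Sum>a<d. \<Sum>i<d. of_nat d * cnj t * w a i a i)" by simp
      also have "\<dots> = of_nat d * cnj t * t" by (simp only: t_def sum_distrib_left)
      finally show ?thesis by (simp only: mult_ac)
    qed
    moreover have "(\<Sum>a<d. \<Sum>i<d. \<Sum>b<d. \<Sum>j<d. if j = i then w a i b j * cnj (R1 a b) else 0) = (\<Sum>a<d. \<Sum>b<d. R1 a b * cnj (R1 a b))"
    proof (rule sum.cong[OF refl])
      fix a
      have "(\<Sum>i<d. \<Sum>b<d. \<Sum>j<d. if j = i then w a i b j * cnj (R1 a b) else 0) = (\<Sum>i<d. \<Sum>b<d. w a i b i * cnj (R1 a b))"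
        by simp
      also have "\<dots> = (\<Sum>b<d. \<Sum>i<d. w a i b i * cnj (R1 a b))" by (rule sum.swap)
      also have "\<dots> = (\<Sum>b<d. (\<Sum>i<d. w a i b i) * cnj (R1 a b))" by (simp only: sum_distrib_right)
      finally show "(\<Sum>i<d. \<Sum>b<d. \<Sum>j<d. if j = i then w a i b j * cnj (R1 a b) else 0) = (\<Sum>b<d. R1 a b * cnj (R1 a b))"
        by (simp only: R1_def)
    qed
    moreover have "(\<Sum>a<d. \<Sum>i<d. \<Sum>b<d. \<Sum>j<d. if b = a then w a i b j * cnj (R2 i j) else 0) = (\<Sum>i<d. \<Sum>j<d. R2 i j * cnj (R2 i j))"
      (is "?Z = _")
    proof -
      have "?Z = (\<Sum>a<d. \<Sum>i<d. \<Sum>j<d. w a i a j * cnj (R2 i j))"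
        by (simp only: sum_if_const) simp
      also have "\<dots> = (\<Sum>i<d. \<Sum>a<d. \<Sum>j<d. w a i a j * cnj (R2 i j))" by (rule sum.swap)
      also have "\<dots> = (\<Sum>i<d. \<Sum>j<d. \<Sum>a<d. w a i a j * cnj (R2 i j))" by (intro sum.cong refl sum.swap)
      also have "\<dots> = (\<Sum>i<d. \<Sum>j<d. (\<Sum>a<d. w a i a j) * cnj (R2 i j))" by (simp only: sum_distrib_right)
      finally show ?thesis by (simp only: R2_def)
    qed
    ultimately show ?thesis by (simp only: sum.distrib sum_subtractf sum_distrib_left)
  qed
  finally have main: "C * (\<integral>U. \<Phi> U * cnj (\<Phi> U) \<partial>\<mu>) = of_nat d * (t * cnj t) - (\<Sum>a<d. \<Sum>b<d. R1 a b * cnj (R1 a b))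
     + of_nat d * (\<Sum>a<d. \<Sum>i<d. \<Sum>b<d. \<Sum>j<d. w a i b j * cnj (w a i b j)) - (\<Sum>i<d. \<Sum>j<d. R2 i j * cnj (R2 i j))" .
  have "complex_of_real (real d * (real d ^ 2 - 1) * (\<integral>U. (norm (\<Phi> U))\<^sup>2 \<partial>\<mu>)) = C * (\<integral>U. complex_of_real ((norm (\<Phi> U))\<^sup>2) \<partial>\<mu>)"
    by (simp only: integral_complex_of_real) (simp add: C_def)
  also have "\<dots> = complex_of_real (real d * (norm t)\<^sup>2 + real d * (\<Sum>a<d. \<Sum>i<d. \<Sum>b<d. \<Sum>j<d. (norm (w a i b j))\<^sup>2)
      - (\<Sum>a<d. \<Sum>b<d. (norm (R1 a b))\<^sup>2) - (\<Sum>i<d. \<Sum>j<d. (norm (R2 i j))\<^sup>2))"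
    unfolding complex_norm_square main of_real_diff of_real_add of_real_mult of_real_sum of_real_of_nat_eq
    by (simp only: algebra_simps)
  finally show ?thesis unfolding t_def of_real_eq_iff .
qed

text \<open>For d >= 2 the variance v satisfies (d^2 - 1) v = |t|^2 + d^2 |w|^2 - d |R1|^2 - d
  |R2|^2 in Hilbert-Schmidt norms, with the partial traces \<open>R1\<close>, \<open>R2\<close> of
  w. Cauchy-Schwarz for the trace of \<open>R1\<close> absorbs |t|^2. For d = 1 the form is constant
  almost everywhere.\<close>

lemma entry_form_variance:
  fixes w :: "nat \<Rightarrow> nat \<Rightarrow> nat \<Rightarrow> nat \<Rightarrow> complex"
  defines "\<Phi> \<equiv> \<lambda>U. \<Sum>a<d. \<Sum>i<d. \<Sum>b<d. \<Sum>j<d. w a i b j * (U (i,a) * cnj (U (j,b)))"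
    and "t \<equiv> \<Sum>a<d. \<Sum>i<d. w a i a i"
  shows "(\<integral>U. (norm (of_nat d * \<Phi> U - t))\<^sup>2 \<partial>\<mu>) \<le> 4 / 3 * (\<Sum>a<d. \<Sum>i<d. \<Sum>b<d. \<Sum>j<d. (norm (w a i b j))\<^sup>2)"
    (is "_ \<le> 4 / 3 * ?N")
proof -
  have N0: "0 \<le> ?N" by (intro sum_nonneg) auto
  consider "d = 0" | "d = 1" | "2 \<le> d" by linarith
  then show ?thesis
  proof cases
    case 1 then show ?thesis by (simp add: \<Phi>_def t_def)
  next
    case 2
    have "(\<integral>U. (norm (of_nat d * \<Phi> U - t))\<^sup>2 \<partial>\<mu>) = (\<integral>U. 0 \<partial>\<mu>)"
    proof (rule integral_cong_AE)
      show "AE U in \<mu>. (norm (of_nat d * \<Phi> U - t))\<^sup>2 = 0"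
        using AE_unitary_fun by eventually_elim (use 2 in \<open>simp add: unitary_fun_def \<Phi>_def t_def\<close>)
      show "(\<lambda>U. (norm (of_nat d * \<Phi> U - t))\<^sup>2) \<in> borel_measurable \<mu>"
        using borel_measurable_integrable[OF integrable_entry_form[of w]] unfolding \<Phi>_def by measurable
    qed simp
    then show ?thesis using N0 by simp
  next
    case 3
    define R1 where "R1 a b = (\<Sum>i<d. w a i b i)" for a b
    define R2 where "R2 i j = (\<Sum>a<d. w a i a j)" for i j
    define I where "I = (\<integral>U. (norm (\<Phi> U))\<^sup>2 \<partial>\<mu>)"
    have mean: "of_nat d * (\<integral>U. \<Phi> U \<partial>\<mu>) = t"
      unfolding \<Phi>_def t_def using 3 by (intro integral_entry_form) simp
    have int: "integrable \<mu> \<Phi>" unfolding \<Phi>_def by (rule integrable_entry_form)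
    have int2: "integrable \<mu> (\<lambda>U. (norm (\<Phi> U))\<^sup>2)"
    proof (rule integrable_AE_bound)
      show "(\<lambda>U. (norm (\<Phi> U))\<^sup>2) \<in> borel_measurable \<mu>"
        using borel_measurable_integrable[OF int] by measurable
      show "AE U in \<mu>. unitary_fun d (\<lambda>i j. U (i, j)) \<longrightarrow>
         norm ((norm (\<Phi> U))\<^sup>2) \<le> (\<Sum>a<d. \<Sum>i<d. \<Sum>b<d. \<Sum>j<d. norm (w a i b j))\<^sup>2"
      proof (intro AE_I2 impI)
        fix U :: "nat \<times> nat \<Rightarrow> complex" assume U: "unitary_fun d (\<lambda>i j. U (i, j))"
        have "norm (\<Phi> U) \<le> (\<Sum>a<d. \<Sum>i<d. \<Sum>b<d. \<Sum>j<d. norm (w a i b j))"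
          unfolding \<Phi>_def
          by (intro sum_norm_le)
            (auto simp: norm_mult intro!: mult_left_le mult_le_one unitary_fun_norm_le_1[OF U])
        then show "norm ((norm (\<Phi> U))\<^sup>2) \<le> (\<Sum>a<d. \<Sum>i<d. \<Sum>b<d. \<Sum>j<d. norm (w a i b j))\<^sup>2"
          by (simp add: power_mono)
      qed
    qed
    have "(norm (of_nat d * \<Phi> U - t))\<^sup>2 = real d ^ 2 * (norm (\<Phi> U))\<^sup>2 - 2 * Re (cnj t * (of_nat d * \<Phi> U)) + (norm t)\<^sup>2" for U
      unfolding cmod_power2 by (simp add: power2_eq_square algebra_simps)
    then have "(\<integral>U. (norm (of_nat d * \<Phi> U - t))\<^sup>2 \<partial>\<mu>) =
      (\<integral>U. real d ^ 2 * (norm (\<Phi> U))\<^sup>2 - 2 * Re (cnj t * (of_nat d * \<Phi> U)) + (norm t)\<^sup>2 \<partial>\<mu>)" by (simp only:)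
    also have "\<dots> = real d ^ 2 * I - 2 * Re (cnj t * (of_nat d * (\<integral>U. \<Phi> U \<partial>\<mu>))) + (norm t)\<^sup>2"
    proof -
      have a: "integrable \<mu> (\<lambda>U. real d ^ 2 * (norm (\<Phi> U))\<^sup>2)" using int2 by simp
      have b: "integrable \<mu> (\<lambda>U. cnj t * (of_nat d * \<Phi> U))" using int by simp
      have b': "integrable \<mu> (\<lambda>U. 2 * Re (cnj t * (of_nat d * \<Phi> U)))"
        by (rule integrable_mult_right[OF integrable_Re[OF b]])
      have c: "integrable \<mu> (\<lambda>U. (norm t)\<^sup>2)"
        by (rule finite_measure.integrable_const[OF finite_measure_haar])
      have "(\<integral>U. 2 * Re (cnj t * (of_nat d * \<Phi> U)) \<partial>\<mu>) = 2 * Re (cnj t * (of_nat d * (\<integral>U. \<Phi> U \<partial>\<mu>)))"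
      proof -
        have "(\<integral>U. 2 * Re (cnj t * (of_nat d * \<Phi> U)) \<partial>\<mu>) = 2 * (\<integral>U. Re (cnj t * (of_nat d * \<Phi> U)) \<partial>\<mu>)"
          by (rule integral_mult_right_zero)
        also have "\<dots> = 2 * Re (\<integral>U. cnj t * (of_nat d * \<Phi> U) \<partial>\<mu>)" by (simp only: integral_Re[OF b])
        finally show ?thesis by (simp only: integral_mult_right_zero)
      qed
      then show ?thesis
        by (simp only: Bochner_Integration.integral_add[OF Bochner_Integration.integrable_diff[OF a b'] c]
            Bochner_Integration.integral_diff[OF a b'] I_def integral_mult_right_zero)
          (simp add: measure_space_haar)
    qed
    also have "\<dots> = real d ^ 2 * I - (norm t)\<^sup>2"
      unfolding mean cmod_power2 by (simp add: power2_eq_square)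
    finally have var: "(\<integral>U. (norm (of_nat d * \<Phi> U - t))\<^sup>2 \<partial>\<mu>) = real d ^ 2 * I - (norm t)\<^sup>2" .
    have "(norm t)\<^sup>2 \<le> real d * (\<Sum>a<d. (norm (R1 a a))\<^sup>2)"
    proof -
      have "norm t \<le> (\<Sum>a<d. norm (R1 a a))" unfolding t_def R1_def by (rule norm_sum)
      then have "(norm t)\<^sup>2 \<le> (\<Sum>a<d. norm (R1 a a))\<^sup>2" by (simp add: power_mono)
      also have "\<dots> \<le> (\<Sum>a<d. (norm (R1 a a))\<^sup>2) * real (card {..<d})"
        by (rule sum_squared_le_sum_of_squares)
      finally show ?thesis by (simp add: mult.commute)
    qed
    also have "\<dots> \<le> real d * (\<Sum>a<d. \<Sum>b<d. (norm (R1 a b))\<^sup>2)"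
      by (intro mult_left_mono sum_mono member_le_sum) auto
    finally have r1: "(norm t)\<^sup>2 \<le> real d * (\<Sum>a<d. \<Sum>b<d. (norm (R1 a b))\<^sup>2)" .
    have r2: "0 \<le> (\<Sum>i<d. \<Sum>j<d. (norm (R2 i j))\<^sup>2)" by (intro sum_nonneg) auto
    have I: "real d * (real d ^ 2 - 1) * I = real d * (norm t)\<^sup>2 + real d * ?N
      - (\<Sum>a<d. \<Sum>b<d. (norm (R1 a b))\<^sup>2) - (\<Sum>i<d. \<Sum>j<d. (norm (R2 i j))\<^sup>2)"
      unfolding I_def \<Phi>_def t_def R1_def R2_def by (rule integral_entry_form_sq[OF 3])
    have "v \<le> 4 / 3 * N" if "D \<ge> 2" "D * (D ^ 2 - 1) * I = D * T + D * N - r1 - r2" "T \<le> D * r1" "0 \<le> r2" "0 \<le> N"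
      "v = D ^ 2 * I - T" for v N D I T r1 r2 :: real
    proof -
      \<comment> \<open>The source of 4 / 3: for D >= 2 one has D^2 <= 4 / 3 (D^2 - 1), with
        equality at D = 2.\<close>
      have D: "3 \<le> D ^ 2 - 1" using power_mono[OF \<open>D \<ge> 2\<close>, of 2] by simp
      have "(D ^ 2 - 1) * v = D * (D * (D ^ 2 - 1) * I) - (D ^ 2 - 1) * T"
        unfolding that(6) by (simp add: power2_eq_square algebra_simps)
      also have "\<dots> = T + D ^ 2 * N - D * r1 - D * r2"
        unfolding that(2) by (simp add: power2_eq_square algebra_simps)
      also have "\<dots> \<le> D ^ 2 * N" using that(1,3,4) mult_nonneg_nonneg[of D r2] by linarith
      also have "\<dots> \<le> (D ^ 2 - 1) * (4 / 3 * N)"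
        using mult_right_mono[OF D \<open>0 \<le> N\<close>] by (simp add: algebra_simps)
      finally show ?thesis using D by (simp add: mult_le_cancel_left)
    qed
    from this[OF _ I r1 r2 N0 var] 3 show ?thesis by simp
  qed
qed

end

subsection \<open>Singular value decomposition\<close>


definition cdot :: "nat \<Rightarrow> (nat \<Rightarrow> complex) \<Rightarrow> (nat \<Rightarrow> complex) \<Rightarrow> complex" where
  "cdot n u v = (\<Sum>i<n. cnj (u i) * v i)"

definition apply_fun :: "nat \<Rightarrow> (nat \<Rightarrow> nat \<Rightarrow> complex) \<Rightarrow> (nat \<Rightarrow> complex) \<Rightarrow> nat \<Rightarrow> complex" where
  "apply_fun n A v i = (\<Sum>l<n. A i l * v l)"

definition adjoint_fun :: "(nat \<Rightarrow> nat \<Rightarrow> complex) \<Rightarrow> nat \<Rightarrow> nat \<Rightarrow> complex" where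
  "adjoint_fun A i j = cnj (A j i)"

lemma cdot_cong: "(\<And>i. i < n \<Longrightarrow> u i = u' i) \<Longrightarrow> (\<And>i. i < n \<Longrightarrow> v i = v' i) \<Longrightarrow> cdot n u v = cdot n u' v'"
  by (simp add: cdot_def)

lemma cdot_add_right: "cdot n u (\<lambda>i. v i + w i) = cdot n u v + cdot n u w"
  by (simp add: cdot_def distrib_left sum.distrib)

lemma cdot_diff_right: "cdot n u (\<lambda>i. v i - w i) = cdot n u v - cdot n u w"
  by (simp add: cdot_def right_diff_distrib sum_subtractf)

lemma cdot_scale_right: "cdot n u (\<lambda>i. c * v i) = c * cdot n u v"
  by (simp add: cdot_def sum_distrib_left mult_ac)

lemma cdot_commute: "cdot n u v = cnj (cdot n v u)"
  by (simp add: cdot_def mult.commute)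

lemma cdot_self: "cdot n u u = of_real (\<Sum>i<n. (norm (u i))\<^sup>2)"
  by (simp add: cdot_def complex_norm_square mult.commute del: of_real_power)

lemma cdot_self_eq_0_iff: "cdot n u u = 0 \<longleftrightarrow> (\<forall>i<n. u i = 0)"
  unfolding cdot_self of_real_eq_0_iff by (subst sum_nonneg_eq_0_iff) auto

lemma cdot_apply_fun: "cdot n u (apply_fun n A v) = cdot n (apply_fun n (adjoint_fun A) u) v"
  unfolding cdot_def apply_fun_def adjoint_fun_def
  by (simp add: sum_distrib_left sum_distrib_right) (subst sum.swap, simp add: mult_ac)

lemma apply_fun_combination:
  "apply_fun n A (\<lambda>i. v i + c * w i) = (\<lambda>i. apply_fun n A v i + c * apply_fun n A w i)"
  by (simp add: apply_fun_def distrib_left sum.distrib sum_distrib_left mult_ac fun_eq_iff)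

lemma apply_fun_scale: "apply_fun n A (\<lambda>i. c * w i) = (\<lambda>i. c * apply_fun n A w i)"
  by (simp add: apply_fun_def sum_distrib_left mult_ac fun_eq_iff)

lemma adjoint_fun_adjoint_fun: "adjoint_fun (adjoint_fun A) = A"
  by (simp add: adjoint_fun_def fun_eq_iff)

text \<open>The matrix whose rows are the conjugates of the v_j, padded by zero rows, is singular
  because k < n, and a kernel vector is orthogonal to every v_j. Coordinates from n on are set to 0
  so that the candidates form a compact set.\<close>

lemma ex_unit_orthogonal:
  assumes "k < n"
  shows "\<exists>w. (\<forall>i\<ge>n. w i = 0) \<and> cdot n w w = 1 \<and> (\<forall>j<k. cdot n (v j) w = 0)"
proof -
  define r where "r j = vec n (\<lambda>i. if j < k then cnj (v j i) else 0)" for j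
  define M where "M = mat\<^sub>r n n r"
  have M: "M \<in> carrier_mat n n" by (simp add: M_def)
  have "M = mat\<^sub>r n n (\<lambda>i. if i = k then 0\<^sub>v n else r i)"
    unfolding M_def by (intro eq_matI) (auto simp: r_def)
  also have "det \<dots> = 0" by (rule det_row_0[OF assms]) (auto simp: r_def)
  finally obtain x where x: "x \<in> carrier_vec n" "x \<noteq> 0\<^sub>v n" "M *\<^sub>v x = 0\<^sub>v n"
    using det_0_iff_vec_prod_zero[OF M] by blast
  define u where "u i = (if i < n then x $ i else 0)" for i
  define S where "S = (\<Sum>i<n. (norm (u i))\<^sup>2)"
  have uu: "cdot n u u = of_real S" by (simp only: cdot_self S_def)
  have "cdot n u u \<noteq> 0" using x(1,2) by (auto simp: cdot_self_eq_0_iff u_def)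
  then have "S \<noteq> 0" unfolding uu by simp
  moreover have "S \<ge> 0" by (simp add: S_def sum_nonneg)
  ultimately have S: "S > 0" "cdot n u u = of_real S" using uu by auto
  have orth: "cdot n (v j) u = 0" if "j < k" for j
  proof -
    have "(M *\<^sub>v x) $ j = 0" using that assms x(3) by simp
    moreover have "(M *\<^sub>v x) $ j = cdot n (v j) u"
      using that assms x(1) by (simp add: M_def r_def cdot_def u_def scalar_prod_def lessThan_atLeast0)
    ultimately show ?thesis by simp
  qed
  define w where "w i = of_real (1 / sqrt S) * u i" for i
  have "cdot n w w = cnj (of_real (1 / sqrt S)) * (of_real (1 / sqrt S) * cdot n u u)"
    unfolding w_def by (subst cdot_scale_right, subst cdot_commute, subst cdot_scale_right) (simp add: cdot_self)
  also have "\<dots> = of_real (1 / sqrt S * (1 / sqrt S * S))"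
    by (simp only: S(2) complex_cnj_complex_of_real of_real_mult)
  also have "1 / sqrt S * (1 / sqrt S * S) = 1" using S(1) by (simp add: real_div_sqrt)
  finally have "cdot n w w = 1" by simp
  moreover have "cdot n (v j) w = 0" if "j < k" for j
    unfolding w_def cdot_scale_right orth[OF that] by simp
  moreover have "\<forall>i\<ge>n. w i = 0" by (simp add: w_def u_def)
  ultimately show ?thesis by blast
qed

text \<open>Vectors are functions on all natural numbers, so compactness refers to the product
  topology: the set is closed in a product of discs and, from coordinate n on, of singletons, which
  is compact by Tychonoff.\<close>

lemma compact_unit_orthogonal:
  "compact {w :: nat \<Rightarrow> complex. (\<forall>i\<ge>n. w i = 0) \<and> cdot n w w = 1 \<and> (\<forall>j<k. cdot n (v j) w = 0)}" (is "compact ?K")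
proof -
  define B where "B = (\<Pi>\<^sub>E i\<in>UNIV. if i < n then cball (0::complex) 1 else {0})"
  have "compactin (product_topology (\<lambda>i. euclidean) UNIV) B"
    unfolding B_def by (subst compactin_PiE) auto
  then have "compact B" by (simp add: euclidean_product_topology compactin_euclidean_iff)
  have "closed ?K"
    unfolding cdot_def
    by (intro closed_Collect_conj closed_Collect_all closed_Collect_imp closed_Collect_eq open_Collect_const
        continuous_intros continuous_on_product_coordinates)
  have "?K \<subseteq> B"
  proof
    fix w assume "w \<in> ?K"
    then have w: "\<And>i. i \<ge> n \<Longrightarrow> w i = 0" "cdot n w w = 1" by auto
    have "norm (w i) \<le> 1" if "i < n" for i
    proof -
      have "(\<Sum>i<n. (norm (w i))\<^sup>2) = 1" using w(2) unfolding cdot_self of_real_eq_1_iff .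
      moreover have "(norm (w i))\<^sup>2 \<le> (\<Sum>i<n. (norm (w i))\<^sup>2)" using that by (intro member_le_sum) auto
      ultimately show ?thesis by (simp add: abs_square_le_1)
    qed
    then show "w \<in> B" using w(1) by (auto simp: B_def)
  qed
  then have "?K = B \<inter> ?K" by blast
  then show ?thesis using compact_Int_closed[OF \<open>compact B\<close> \<open>closed ?K\<close>] by simp
qed

text \<open>First-order optimality of the Rayleigh quotient at v: along v + c w with w orthogonal to
  v the denominator changes only in second order, so the linear term 2 Re (c z) of the numerator has
  to vanish.\<close>

lemma quadratic_form_maximal_imp_orthogonal:
  fixes n :: nat and A :: "nat \<Rightarrow> nat \<Rightarrow> complex"
  defines "q \<equiv> \<lambda>x. Re (cdot n (apply_fun n A x) (apply_fun n A x))"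
  assumes max: "\<And>c. q (\<lambda>i. v i + c * w i) \<le> q v * Re (cdot n (\<lambda>i. v i + c * w i) (\<lambda>i. v i + c * w i))"
    and v: "cdot n v v = 1" and w: "cdot n v w = 0"
  shows "cdot n (apply_fun n A v) (apply_fun n A w) = 0"
proof (rule ccontr)
  define z where "z = cdot n (apply_fun n A v) (apply_fun n A w)"
  assume "\<not> ?thesis"
  then have z: "(norm z)\<^sup>2 > 0" by (simp add: z_def)
  define N where "N = Re (cdot n w w)"
  define K where "K = q v * N - q w"
  have expand: "Re (cdot n (\<lambda>i. x i + c * y i) (\<lambda>i. x i + c * y i)) =
      Re (cdot n x x) + 2 * Re (c * cdot n x y) + (norm c)\<^sup>2 * Re (cdot n y y)" for x y c
  proof -
    have "cdot n (\<lambda>i. x i + c * y i) (\<lambda>i. x i + c * y i) =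
      cdot n x x + c * cdot n x y + cnj (c * cdot n x y) + (c * cnj c) * cdot n y y"
      by (simp only: cdot_add_right cdot_scale_right cdot_commute[of n "\<lambda>i. x i + c * y i"] complex_cnj_add
          complex_cnj_mult cdot_commute[of n x y, symmetric] cdot_commute[of n x x, symmetric] cdot_commute[of n y y, symmetric]
          distrib_left distrib_right)
        (simp add: algebra_simps cdot_commute[of n y x])
    moreover have "c * cnj c = of_real ((norm c)\<^sup>2)" by (rule complex_norm_square[symmetric])
    ultimately show ?thesis by (simp only: plus_complex.simps Re_complex_of_real complex_cnj cnj.simps Re_complex_div_eq_0) simp
  qed
  have "2 * Re (c * z) \<le> (norm c)\<^sup>2 * K" for c
    using max[of c] unfolding q_def apply_fun_combination expand w z_def[symmetric] K_def N_def
    by (simp add: v algebra_simps)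
  \<comment> \<open>A small multiple of \<open>cnj z\<close> makes the linear term positive; the
    factor 1 / (|K| + 1) is small enough for it to exceed the quadratic term.\<close>
  from this[of "of_real (1 / (\<bar>K\<bar> + 1)) * cnj z"]
  have "2 * (1 / (\<bar>K\<bar> + 1)) * (norm z)\<^sup>2 \<le> (1 / (\<bar>K\<bar> + 1))\<^sup>2 * (norm z)\<^sup>2 * K"
  proof -
    have "Re (of_real r * cnj z * z) = r * (norm z)\<^sup>2" for r
      unfolding cmod_power2 by (simp add: power2_eq_square algebra_simps)
    moreover have "(norm (of_real r * cnj z))\<^sup>2 = r\<^sup>2 * (norm z)\<^sup>2" for r :: real
      by (simp add: norm_mult power_mult_distrib)
    ultimately show ?thesis
      using \<open>2 * Re (of_real (1 / (\<bar>K\<bar> + 1)) * cnj z * z) \<le> (norm (of_real (1 / (\<bar>K\<bar> + 1)) * cnj z))\<^sup>2 * K\<close>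
      by (simp only: mult.assoc)
  qed
  then have "(norm z)\<^sup>2 * (2 * (1 / (\<bar>K\<bar> + 1))) \<le> (norm z)\<^sup>2 * ((1 / (\<bar>K\<bar> + 1))\<^sup>2 * K)" by (simp only: mult_ac)
  then have "2 * (1 / (\<bar>K\<bar> + 1)) \<le> (1 / (\<bar>K\<bar> + 1))\<^sup>2 * K" using z by (simp only: mult_le_cancel_left_pos)
  then have "2 * (\<bar>K\<bar> + 1) \<le> K" by (simp add: power2_eq_square divide_simps split: if_splits)
  then show False using abs_ge_self[of K] by simp
qed

text \<open>A partial singular value decomposition with k triples. The relations for A and for its
  adjoint are kept together: they make A map the complement of the v_i into that of the u_i, and the
  adjoint map back.\<close>

definition singular_system ::
    "nat \<Rightarrow> (nat \<Rightarrow> nat \<Rightarrow> complex) \<Rightarrow> nat \<Rightarrow> (nat \<Rightarrow> nat \<Rightarrow> complex) \<Rightarrow> (nat \<Rightarrow> nat \<Rightarrow> complex) \<Rightarrow> (nat \<Rightarrow> real) \<Rightarrow> bool" where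
  "singular_system n A k u v s \<longleftrightarrow>
    (\<forall>i<k. \<forall>j<k. cdot n (u i) (u j) = (if i = j then 1 else 0)) \<and>
    (\<forall>i<k. \<forall>j<k. cdot n (v i) (v j) = (if i = j then 1 else 0)) \<and>
    (\<forall>i<k. 0 \<le> s i) \<and>
    (\<forall>i<k. \<forall>l<n. apply_fun n A (v i) l = of_real (s i) * u i l) \<and>
    (\<forall>i<k. \<forall>l<n. apply_fun n (adjoint_fun A) (u i) l = of_real (s i) * v i l)"

text \<open>The next right vector x maximizes |A x| among the unit vectors orthogonal to the earlier
  ones, and the next left vector is A x, normalized. Optimality shows that the adjoint returns it to
  a multiple of x. When the maximum is 0, any unit vector orthogonal to the u_j can be taken on the
  left.\<close>

lemma ex_singular_system:
  fixes A :: "nat \<Rightarrow> nat \<Rightarrow> complex"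
  assumes "k \<le> n"
  shows "\<exists>u v s. singular_system n A k u v s"
  using assms
proof (induction k)
  case 0
  then show ?case by (simp add: singular_system_def)
next
  case (Suc k)
  then obtain u v s where "singular_system n A k u v s" by (meson Suc_leD)
  then have
    orth: "\<And>i j. i < k \<Longrightarrow> j < k \<Longrightarrow> cdot n (u i) (u j) = (if i = j then 1 else 0)"
      "\<And>i j. i < k \<Longrightarrow> j < k \<Longrightarrow> cdot n (v i) (v j) = (if i = j then 1 else 0)"
    and s: "\<And>i. i < k \<Longrightarrow> 0 \<le> s i"
    and Av: "\<And>i l. i < k \<Longrightarrow> l < n \<Longrightarrow> apply_fun n A (v i) l = of_real (s i) * u i l"
    and Au: "\<And>i l. i < k \<Longrightarrow> l < n \<Longrightarrow> apply_fun n (adjoint_fun A) (u i) l = of_real (s i) * v i l"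
    unfolding singular_system_def by blast+
  let ?A = "apply_fun n A" and ?B = "apply_fun n (adjoint_fun A)"
  have kn: "k < n" using Suc.prems by simp
  let ?K = "{w :: nat \<Rightarrow> complex. (\<forall>i\<ge>n. w i = 0) \<and> cdot n w w = 1 \<and> (\<forall>j<k. cdot n (v j) w = 0)}"
  define q where "q x = Re (cdot n (?A x) (?A x))" for x
  have scale_q: "q (\<lambda>i. c * x i) = (norm c)\<^sup>2 * q x" for c x
    unfolding q_def apply_fun_scale cdot_scale_right
    by (subst cdot_commute, subst cdot_scale_right)
      (simp add: cdot_self norm_mult power_mult_distrib mult.assoc[symmetric] complex_norm_square[symmetric] del: of_real_sum of_real_power)
  have "?K \<noteq> {}" using ex_unit_orthogonal[OF kn, of v] by blast
  moreover have "continuous_on ?K q"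
    unfolding q_def cdot_def apply_fun_def
    by (intro continuous_intros continuous_on_subset[OF continuous_on_product_coordinates]) auto
  ultimately obtain x where x: "x \<in> ?K" and max: "\<And>w. w \<in> ?K \<Longrightarrow> q w \<le> q x"
    using continuous_attains_sup[OF compact_unit_orthogonal, of n k v q] by blast
  \<comment> \<open>Homogeneous form of maximality: a nonzero vector orthogonal to the v_j becomes
    admissible once it is scaled to length 1 and cut off at n.\<close>
  have q_le: "q w \<le> q x * Re (cdot n w w)" if "\<And>j. j < k \<Longrightarrow> cdot n (v j) w = 0" for w
  proof (cases "cdot n w w = 0")
    case True
    then have "\<And>l. l < n \<Longrightarrow> w l = 0" by (simp add: cdot_self_eq_0_iff)
    then have "q w = 0" by (simp add: q_def cdot_def apply_fun_def)
    then show ?thesis using True by simp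
  next
    case False
    define r where "r = Re (cdot n w w)"
    have r: "cdot n w w = of_real r" "0 \<le> r" by (simp_all add: r_def cdot_self sum_nonneg del: of_real_sum)
    then have "0 < r" using False by (cases "r = 0") auto
    define w' where "w' i = (if i < n then of_real (1 / sqrt r) * w i else 0)" for i
    have w'w: "cdot n y w' = of_real (1 / sqrt r) * cdot n y w" for y
      unfolding cdot_scale_right[symmetric] by (intro cdot_cong) (auto simp: w'_def)
    have "cdot n w' w' = of_real (1 / sqrt r) * cnj (of_real (1 / sqrt r) * cdot n w w)"
      by (subst w'w, subst cdot_commute, subst w'w) simp
    also have "\<dots> = of_real (1 / sqrt r * (1 / sqrt r * r))"
      by (simp only: r(1) complex_cnj_complex_of_real of_real_mult complex_cnj_mult)
    also have "1 / sqrt r * (1 / sqrt r * r) = 1" using \<open>0 < r\<close> by (simp add: real_div_sqrt)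
    finally have "cdot n w' w' = 1" by simp
    then have "w' \<in> ?K" using that w'w by (simp add: w'_def)
    then have "q w' \<le> q x" by (rule max)
    moreover have "?A w' = ?A (\<lambda>i. of_real (1 / sqrt r) * w i)"
      by (simp add: apply_fun_def w'_def fun_eq_iff)
    then have "q w' = q (\<lambda>i. of_real (1 / sqrt r) * w i)" by (simp only: q_def)
    then have "q w' = (norm (complex_of_real (1 / sqrt r)))\<^sup>2 * q w" by (simp only: scale_q)
    then have "q w' = q w / r" using \<open>0 < r\<close> by (simp add: norm_divide power_divide)
    ultimately show ?thesis using \<open>0 < r\<close> unfolding r_def[symmetric] by (simp add: field_simps)
  qed
  have xx: "cdot n x x = 1" and xv: "\<And>j. j < k \<Longrightarrow> cdot n (v j) x = 0" using x by auto
  have A_perp: "cdot n (?A x) (?A w) = 0"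
    if "\<And>j. j < k \<Longrightarrow> cdot n (v j) w = 0" "cdot n x w = 0" for w
  proof (rule quadratic_form_maximal_imp_orthogonal[OF _ xx that(2)])
    fix c
    show "Re (cdot n (?A (\<lambda>i. x i + c * w i)) (?A (\<lambda>i. x i + c * w i)))
      \<le> Re (cdot n (?A x) (?A x)) * Re (cdot n (\<lambda>i. x i + c * w i) (\<lambda>i. x i + c * w i))"
      unfolding q_def[symmetric] by (rule q_le) (simp add: cdot_add_right cdot_scale_right that xv)
  qed
  define \<sigma> where "\<sigma> = sqrt (q x)"
  have q0: "q y \<ge> 0" for y by (simp add: q_def cdot_self sum_nonneg)
  have \<sigma>0: "0 \<le> \<sigma>" and \<sigma>2: "\<sigma> * \<sigma> = q x" using q0 by (simp_all add: \<sigma>_def)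
  have AxAx: "cdot n (?A x) (?A x) = of_real (q x)"
    by (simp add: q_def cdot_self del: of_real_sum)
  have adj: "cdot n (?B y) z = cdot n y (?A z)" for y z
    by (simp only: cdot_apply_fun)
  have adj': "cdot n z (?B y) = cdot n (?A z) y" for y z
    by (simp only: cdot_apply_fun adjoint_fun_adjoint_fun)
  have u_perp: "cdot n (u j) (?A w) = 0" if "j < k" "cdot n (v j) w = 0" for j w
  proof -
    have "cdot n (u j) (?A w) = cdot n (?B (u j)) w" by (rule adj[symmetric])
    also have "\<dots> = cdot n (\<lambda>i. of_real (s j) * v j i) w" by (rule cdot_cong) (simp_all add: Au that)
    also have "\<dots> = 0" by (subst cdot_commute) (simp add: cdot_scale_right cdot_commute[of n w] that)
    finally show ?thesis .
  qed
  have v_perp: "cdot n (v j) (?B y) = 0" if "j < k" "cdot n (u j) y = 0" for j y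
  proof -
    have "cdot n (v j) (?B y) = cdot n (\<lambda>i. of_real (s j) * u j i) y"
      unfolding adj' by (rule cdot_cong) (simp_all add: Av that)
    also have "\<dots> = 0" by (subst cdot_commute) (simp add: cdot_scale_right cdot_commute[of n y] that)
    finally show ?thesis .
  qed
  have "\<exists>y. cdot n y y = 1 \<and> (\<forall>j<k. cdot n (u j) y = 0) \<and> (\<forall>l<n. ?A x l = of_real \<sigma> * y l)
     \<and> (\<forall>l<n. ?B y l = of_real \<sigma> * x l)"
  proof (cases "\<sigma> = 0")
    case True
    then have "q x = 0" using \<sigma>2 by simp
    have A0: "?A w l = 0" if "\<And>j. j < k \<Longrightarrow> cdot n (v j) w = 0" "l < n" for w l
    proof -
      have "q w = 0" using q_le[of w, OF that(1)] q0[of w] \<open>q x = 0\<close> by simp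
      then have "cdot n (?A w) (?A w) = 0" by (simp add: q_def cdot_self del: of_real_sum)
      then show ?thesis using that(2) by (simp add: cdot_self_eq_0_iff)
    qed
    obtain y where y: "cdot n y y = 1" "\<And>j. j < k \<Longrightarrow> cdot n (u j) y = 0"
      using ex_unit_orthogonal[OF kn, of u] by blast
    \<comment> \<open>The adjoint sends y into the complement of the v_j, where A vanishes; moving A
      across the inner product then shows that the adjoint annihilates y.\<close>
    have "?A (?B y) l = 0" if "l < n" for l
      by (rule A0[OF v_perp]) (use that y(2) in auto)
    then have "cdot n (?B y) (?B y) = 0"
      unfolding adj by (simp add: cdot_def)
    then have "\<forall>l<n. ?B y l = 0" by (simp add: cdot_self_eq_0_iff)
    then show ?thesis using y A0[OF xv] True by auto
  next
    case False
    define y where "y l = of_real (1 / \<sigma>) * ?A x l" for l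
    have "cdot n y y = of_real (1 / \<sigma>) * cnj (of_real (1 / \<sigma>) * cdot n (?A x) (?A x))"
      unfolding y_def by (subst cdot_scale_right, subst cdot_commute, subst cdot_scale_right) simp
    also have "\<dots> = of_real (1 / \<sigma> * (1 / \<sigma> * q x))"
      by (simp only: AxAx complex_cnj_complex_of_real of_real_mult complex_cnj_mult)
    also have "1 / \<sigma> * (1 / \<sigma> * q x) = 1" using False by (simp add: \<sigma>2[symmetric])
    finally have yy: "cdot n y y = 1" by simp
    have uy: "cdot n (u j) y = 0" if "j < k" for j
      unfolding y_def cdot_scale_right using u_perp[OF that xv[OF that]] by simp
    \<comment> \<open>The deviation of x from being an eigenvector of the adjoint of A times A. It
      is orthogonal to x and to the v_j, so optimality gives <A x, A w> = 0, and from this <w, w> =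
      0.\<close>
    define w where "w = (\<lambda>l. ?B (?A x) l - of_real (q x) * x l)"
    have wv: "cdot n (v j) w = 0" if "j < k" for j
      unfolding w_def cdot_diff_right cdot_scale_right using v_perp[OF that u_perp[OF that xv[OF that]]] xv[OF that] by simp
    have wx: "cdot n x w = 0"
      unfolding w_def cdot_diff_right cdot_scale_right adj' by (simp add: AxAx xx)
    have "cdot n w w = cdot n w (?B (?A x)) - of_real (q x) * cdot n w x"
      by (subst (2) w_def) (simp only: cdot_diff_right cdot_scale_right)
    also have "\<dots> = 0"
      unfolding adj' using A_perp[OF wv wx] wx by (subst (1 2) cdot_commute) simp
    finally have "\<forall>l<n. w l = 0" by (simp add: cdot_self_eq_0_iff)
    then have AAx: "?B (?A x) l = of_real (q x) * x l" if "l < n" for l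
      using that by (simp add: w_def)
    have "?B y l = of_real \<sigma> * x l" if "l < n" for l
    proof -
      have "?B y l = of_real (1 / \<sigma>) * (of_real (q x) * x l)"
        unfolding y_def apply_fun_scale AAx[OF that] ..
      also have "\<dots> = of_real (1 / \<sigma> * (\<sigma> * \<sigma>)) * x l" by (simp only: \<sigma>2 of_real_mult mult.assoc)
      also have "1 / \<sigma> * (\<sigma> * \<sigma>) = \<sigma>" using False by simp
      finally show ?thesis .
    qed
    moreover have "?A x l = of_real \<sigma> * y l" for l using False by (simp add: y_def)
    ultimately show ?thesis using yy uy by blast
  qed
  then obtain y where y: "cdot n y y = 1" "\<And>j. j < k \<Longrightarrow> cdot n (u j) y = 0"
    "\<And>l. l < n \<Longrightarrow> ?A x l = of_real \<sigma> * y l"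
    "\<And>l. l < n \<Longrightarrow> ?B y l = of_real \<sigma> * x l" by blast
  have sym: "cdot n y (u j) = 0" "cdot n x (v j) = 0" if "j < k" for j
    using that by (simp_all add: cdot_commute[of n y] cdot_commute[of n x] y(2) xv)
  show ?case
    by (rule exI[of _ "u(k := y)"], rule exI[of _ "v(k := x)"], rule exI[of _ "s(k := \<sigma>)"])
      (auto simp: singular_system_def less_Suc_eq orth s Av Au xx xv y sym \<sigma>0)
qed

lemma svd_exists:
  fixes A :: "nat \<Rightarrow> nat \<Rightarrow> complex"
  obtains P Q s where "unitary_fun n P" "unitary_fun n Q" "\<And>k. k < n \<Longrightarrow> 0 \<le> s k"
    "\<And>i j. i < n \<Longrightarrow> j < n \<Longrightarrow> A i j = (\<Sum>k<n. P i k * of_real (s k) * Q k j)"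
proof -
  obtain u v s where "singular_system n A n u v s" using ex_singular_system[OF order_refl] by blast
  then have
    orth: "\<And>i j. i < n \<Longrightarrow> j < n \<Longrightarrow> cdot n (u i) (u j) = (if i = j then 1 else 0)"
      "\<And>i j. i < n \<Longrightarrow> j < n \<Longrightarrow> cdot n (v i) (v j) = (if i = j then 1 else 0)"
    and s: "\<And>i. i < n \<Longrightarrow> 0 \<le> s i"
    and Av: "\<And>i l. i < n \<Longrightarrow> l < n \<Longrightarrow> apply_fun n A (v i) l = of_real (s i) * u i l"
    unfolding singular_system_def by blast+
  have U: "unitary_fun n (\<lambda>i k. f k i)" if "\<And>i j. i < n \<Longrightarrow> j < n \<Longrightarrow> cdot n (f i) (f j) = (if i = j then 1 else 0)"
    for f :: "nat \<Rightarrow> nat \<Rightarrow> complex"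
  proof -
    let ?M = "Matrix.mat n n (\<lambda>(i,k). f k i)"
    have "adj ?M * ?M = 1\<^sub>m n"
      using that by (intro eq_matI) (auto simp: adj_def scalar_prod_def cdot_def lessThan_atLeast0)
    moreover from this have "?M * adj ?M = 1\<^sub>m n"
      by (intro mat_mult_left_right_inverse[of "adj ?M" n]) (auto simp: adj_def)
    ultimately have "unitary_mat n ?M" by (simp add: unitary_mat_def)
    then show ?thesis by (simp only: unitary_mat_iff_unitary_fun)
  qed
  have V: "unitary_fun n (\<lambda>i k. v k i)" by (rule U[OF orth(2)])
  have "A i j = (\<Sum>k<n. u k i * of_real (s k) * cnj (v k j))" if ij: "i < n" "j < n" for i j
  proof -
    have "(\<Sum>k<n. u k i * of_real (s k) * cnj (v k j)) = (\<Sum>k<n. apply_fun n A (v k) i * cnj (v k j))"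
      using ij by (intro sum.cong refl) (simp add: Av mult_ac)
    also have "\<dots> = (\<Sum>k<n. \<Sum>l<n. A i l * (v k l * cnj (v k j)))"
      by (simp only: apply_fun_def sum_distrib_right mult.assoc)
    also have "\<dots> = (\<Sum>l<n. \<Sum>k<n. A i l * (v k l * cnj (v k j)))" by (rule sum.swap)
    also have "\<dots> = (\<Sum>l<n. A i l * (\<Sum>k<n. v k l * cnj (v k j)))" by (simp only: sum_distrib_left)
    also have "\<dots> = (\<Sum>l<n. if l = j then A i l else 0)"
      using V ij by (intro sum.cong refl) (auto simp: unitary_fun_def)
    also have "\<dots> = A i j" using ij by simp
    finally show ?thesis by simp
  qed
  moreover have "unitary_fun n (\<lambda>k j. cnj (v k j))"
    using V unfolding unitary_fun_def by (auto simp: mult.commute)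
  ultimately show thesis using s by (intro that[OF U[OF orth(1)], of "\<lambda>k j. cnj (v k j)" s]) auto
qed

section \<open>Singular values of matrices and duality for the trace norm\<close>

lemma adj_carrier: "A \<in> carrier_mat n m \<Longrightarrow> adj A \<in> carrier_mat m n"
  by (simp add: adj_def)

lemma adj_adj: "adj (adj A) = A"
  by (intro eq_matI) (auto simp: adj_def)

lemma adj_mult:
  assumes "A \<in> carrier_mat n m" "B \<in> carrier_mat m k"
  shows "adj (A * B) = adj B * adj A"
  using assms by (intro eq_matI) (auto simp: adj_def scalar_prod_def mult.commute)

lemma unitary_mat_mult:
  assumes "unitary_mat n A" "unitary_mat n B"
  shows "unitary_mat n (A * B)"
proof -
  have A: "A \<in> carrier_mat n n" "adj A \<in> carrier_mat n n" "adj A * A = 1\<^sub>m n" "A * adj A = 1\<^sub>m n"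
    and B: "B \<in> carrier_mat n n" "adj B \<in> carrier_mat n n" "adj B * B = 1\<^sub>m n" "B * adj B = 1\<^sub>m n"
    using assms by (auto simp: unitary_mat_def adj_carrier)
  have "adj (A * B) * (A * B) = adj B * (adj A * A) * B"
    unfolding adj_mult[OF A(1) B(1)] using A(1,2) B(1,2) by (simp add: assoc_mult_mat[of _ n n _ n _ n])
  moreover have "(A * B) * adj (A * B) = A * (B * adj B) * adj A"
    unfolding adj_mult[OF A(1) B(1)] using A(1,2) B(1,2) by (simp add: assoc_mult_mat[of _ n n _ n _ n])
  ultimately show ?thesis using A B by (simp add: unitary_mat_def)
qed

lemma unitary_fun_mult:
  assumes "unitary_fun n V" "unitary_fun n W"
  shows "unitary_fun n (\<lambda>i j. \<Sum>k<n. V i k * W k j)"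
proof -
  have "Matrix.mat n n (\<lambda>(i,j). \<Sum>k<n. V i k * W k j) = Matrix.mat n n (\<lambda>(i,j). V i j) * Matrix.mat n n (\<lambda>(i,j). W i j)"
    by (intro eq_matI) (auto simp: scalar_prod_def lessThan_atLeast0)
  then show ?thesis
    using unitary_mat_mult[of n "Matrix.mat n n (\<lambda>(i,j). V i j)" "Matrix.mat n n (\<lambda>(i,j). W i j)"] assms
    unfolding unitary_mat_iff_unitary_fun[symmetric] by (simp only:)
qed

lemma unitary_fun_adjoint: "unitary_fun n V \<Longrightarrow> unitary_fun n (adjoint_fun V)"
  by (auto simp: unitary_fun_def adjoint_fun_def)

lemma proots_prod_list_linear_factors: "proots (\<Prod>a\<leftarrow>xs. [:- a, 1:]) = mset (xs :: complex list)"
proof (induction xs)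
  case (Cons x xs)
  have "(\<Prod>a\<leftarrow>xs. [:- a, 1:]) \<noteq> 0" by (auto simp: prod_list_zero_iff)
  with Cons show ?case by (simp add: proots_mult del: mult_pCons_left)
qed simp

text \<open>\<open>sing_vals\<close> is defined through roots of a characteristic polynomial. With D
  the diagonal matrix of the s_k and M = P D Q, the matrix \<open>adj M * M\<close> is unitarily
  similar to D^2, whose polynomial splits; so every decomposition exhibits the same
  multiset.\<close>

lemma sing_vals_svd:
  assumes M: "M \<in> carrier_mat n n" and P: "unitary_fun n P" and Q: "unitary_fun n Q"
    and s: "\<And>k. k < n \<Longrightarrow> 0 \<le> s k"
    and svd: "\<And>i j. i < n \<Longrightarrow> j < n \<Longrightarrow> M $$ (i,j) = (\<Sum>k<n. P i k * of_real (s k) * Q k j)"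
  shows "sing_vals M = image_mset s (mset_set {..<n})"
proof -
  let ?P = "Matrix.mat n n (\<lambda>(i,j). P i j)" and ?Q = "Matrix.mat n n (\<lambda>(i,j). Q i j)"
  let ?D = "Matrix.mat n n (\<lambda>(i,j). if i = j then complex_of_real (s i) else 0)"
  let ?D2 = "Matrix.mat n n (\<lambda>(i,j). if i = j then complex_of_real ((s i)\<^sup>2) else 0)"
  have uP: "unitary_mat n ?P" and uQ: "unitary_mat n ?Q" using P Q by (simp_all only: unitary_mat_iff_unitary_fun)
  have c: "?P \<in> carrier_mat n n" "?Q \<in> carrier_mat n n" "?D \<in> carrier_mat n n" "adj ?P \<in> carrier_mat n n"
    "adj ?Q \<in> carrier_mat n n" "adj ?D \<in> carrier_mat n n" by (auto simp: adj_def)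
  have PD: "?P * ?D = Matrix.mat n n (\<lambda>(i,j). P i j * of_real (s j))"
  proof (intro eq_matI)
    fix i j assume "i < dim_row (Matrix.mat n n (\<lambda>(i,j). P i j * complex_of_real (s j)))"
      "j < dim_col (Matrix.mat n n (\<lambda>(i,j). P i j * complex_of_real (s j)))"
    then have ij: "i < n" "j < n" by auto
    then have "(?P * ?D) $$ (i,j) = (\<Sum>k<n. P i k * (if k = j then of_real (s k) else 0))"
      by (simp add: scalar_prod_def lessThan_atLeast0)
    also have "\<dots> = (\<Sum>k<n. if k = j then P i k * of_real (s k) else 0)" by (intro sum.cong refl) simp
    finally show "(?P * ?D) $$ (i,j) = Matrix.mat n n (\<lambda>(i,j). P i j * of_real (s j)) $$ (i,j)" using ij by simp
  qed auto
  have eM: "M = ?P * ?D * ?Q"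
    unfolding PD using M svd by (intro eq_matI) (auto simp: scalar_prod_def lessThan_atLeast0)
  have D2: "adj ?D * ?D = ?D2"
  proof (intro eq_matI)
    fix i j assume "i < dim_row ?D2" "j < dim_col ?D2"
    then have ij: "i < n" "j < n" by auto
    then have "(adj ?D * ?D) $$ (i,j) = (\<Sum>k<n. cnj (if k = i then of_real (s k) else 0) * (if k = j then of_real (s k) else 0))"
      by (simp add: scalar_prod_def adj_def lessThan_atLeast0)
    also have "\<dots> = (\<Sum>k<n. if k = i then if i = j then of_real ((s k)\<^sup>2) else 0 else 0)"
      by (intro sum.cong refl) (auto simp: power2_eq_square)
    finally show "(adj ?D * ?D) $$ (i,j) = ?D2 $$ (i,j)" using ij by simp
  qed (auto simp: adj_def)
  have "adj (p * m * q) * (p * m * q) = adj q * (adj m * (adj p * p) * m) * q"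
    if "p \<in> carrier_mat n n" "m \<in> carrier_mat n n" "q \<in> carrier_mat n n" for p m q
  proof -
    have "adj (p * m * q) = adj q * (adj m * adj p)"
      by (simp only: adj_mult[OF mult_carrier_mat[OF that(1,2)] that(3)] adj_mult[OF that(1,2)])
    then show ?thesis using that adj_carrier[OF that(1)] adj_carrier[OF that(2)] adj_carrier[OF that(3)]
      by (simp add: assoc_mult_mat[of _ n n _ n _ n])
  qed
  then have "adj M * M = adj ?Q * (adj ?D * (adj ?P * ?P) * ?D) * ?Q"
    unfolding eM using c by blast
  also have "\<dots> = adj ?Q * ?D2 * ?Q"
    using uP c unfolding D2[symmetric] by (simp add: unitary_mat_def)
  finally have "similar_mat_wit (adj M * M) ?D2 (adj ?Q) ?Q"
    using uQ c M by (intro similar_mat_witI[where n = n]) (auto simp: unitary_mat_def adj_carrier intro!: mult_carrier_mat[of _ n n])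
  then have "char_poly (adj M * M) = char_poly ?D2"
    by (intro char_poly_similar) (auto simp: similar_mat_def)
  also have "\<dots> = (\<Prod>a\<leftarrow>diag_mat ?D2. [:- a, 1:])"
    by (rule char_poly_upper_triangular[where n = n]) (auto simp: upper_triangular_def)
  also have "diag_mat ?D2 = map (\<lambda>i. complex_of_real ((s i)\<^sup>2)) [0..<n]"
    by (auto simp: diag_mat_def)
  finally have "proots (char_poly (adj M * M)) = image_mset (\<lambda>i. complex_of_real ((s i)\<^sup>2)) (mset [0..<n])"
    by (simp only: proots_prod_list_linear_factors mset_map)
  then have "sing_vals M = image_mset (\<lambda>i. sqrt ((s i)\<^sup>2)) (mset [0..<n])"
    by (simp add: sing_vals_def image_mset.compositionality o_def)
  also have "mset [0..<n] = mset_set {..<n}" by (simp add: mset_upt lessThan_atLeast0)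
  also have "image_mset (\<lambda>i. sqrt ((s i)\<^sup>2)) (mset_set {..<n}) = image_mset s (mset_set {..<n})"
    by (intro image_mset_cong) (simp add: s)
  finally show ?thesis .
qed

lemma obtain_svd:
  assumes M: "M \<in> carrier_mat n n"
  obtains P Q s where "unitary_fun n P" "unitary_fun n Q" "\<And>k. k < n \<Longrightarrow> 0 \<le> s k"
    "\<And>i j. i < n \<Longrightarrow> j < n \<Longrightarrow> M $$ (i,j) = (\<Sum>k<n. P i k * of_real (s k) * Q k j)"
    "\<And>p. schatten (ereal p) M = (\<Sum>k<n. s k powr p) powr (1 / p)"
    "schatten \<infinity> M = Max (insert 0 (s ` {..<n}))"
    "trace_norm M = (\<Sum>k<n. s k)"
proof (rule svd_exists[of n "\<lambda>i j. M $$ (i,j)"])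
  fix P Q s assume 1: "unitary_fun n P" "unitary_fun n Q" "\<And>k. k < n \<Longrightarrow> 0 \<le> s k"
    "\<And>i j. i < n \<Longrightarrow> j < n \<Longrightarrow> M $$ (i,j) = (\<Sum>k<n. P i k * of_real (s k) * Q k j)"
  have sv: "sing_vals M = image_mset s (mset_set {..<n})" by (rule sing_vals_svd[OF M 1])
  have 2: "schatten (ereal p) M = (\<Sum>k<n. s k powr p) powr (1 / p)" for p
    by (simp add: schatten_def sv image_mset.compositionality o_def sum_unfold_sum_mset)
  have 3: "schatten \<infinity> M = Max (insert 0 (s ` {..<n}))"
    by (simp add: schatten_def sv)
  have "(\<Sum>k<n. s k powr 1) = (\<Sum>k<n. s k)" using 1(3) by (intro sum.cong refl) simp
  moreover have "0 \<le> (\<Sum>k<n. s k)" using 1(3) by (intro sum_nonneg) auto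
  ultimately have 4: "trace_norm M = (\<Sum>k<n. s k)" unfolding one_ereal_def 2 by simp
  show thesis by (rule that[OF 1 2 3 4])
qed

text \<open>The double sum is the trace of X M, and the maximizer is the adjoint of the unitary
  factor P Q of M.\<close>

lemma trace_norm_attained:
  assumes M: "M \<in> carrier_mat n n"
  obtains X where "unitary_fun n X" "(\<Sum>i<n. \<Sum>j<n. X j i * M $$ (i,j)) = of_real (trace_norm M)"
proof -
  obtain P Q s where svd: "unitary_fun n P" "unitary_fun n Q"
    "\<And>i j. i < n \<Longrightarrow> j < n \<Longrightarrow> M $$ (i,j) = (\<Sum>k<n. P i k * of_real (s k) * Q k j)"
    "trace_norm M = (\<Sum>k<n. s k)"
    by (rule obtain_svd[OF M]) blast
  define X where "X j i = (\<Sum>l<n. adjoint_fun Q j l * adjoint_fun P l i)" for j i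
  have X: "unitary_fun n X"
    unfolding X_def by (intro unitary_fun_mult unitary_fun_adjoint svd)
  have "(\<Sum>j<n. \<Sum>k<n. X j i * (P i k * of_real (s k) * Q k j)) = (\<Sum>k<n. cnj (P i k) * P i k * of_real (s k))" if "i < n" for i
  proof -
    have "(\<Sum>j<n. \<Sum>k<n. X j i * (P i k * of_real (s k) * Q k j)) = (\<Sum>j<n. \<Sum>k<n. \<Sum>l<n. cnj (Q l j) * Q k j * (cnj (P i l) * P i k * of_real (s k)))"
      unfolding X_def sum_distrib_right by (intro sum.cong refl) (simp add: adjoint_fun_def mult_ac)
    also have "\<dots> = (\<Sum>k<n. \<Sum>l<n. \<Sum>j<n. cnj (Q l j) * Q k j * (cnj (P i l) * P i k * of_real (s k)))"
      by (subst sum.swap) (intro sum.cong refl sum.swap)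
    also have "\<dots> = (\<Sum>k<n. \<Sum>l<n. (\<Sum>j<n. Q k j * cnj (Q l j)) * (cnj (P i l) * P i k * of_real (s k)))"
      unfolding sum_distrib_right by (intro sum.cong refl) (simp add: mult_ac)
    also have "\<dots> = (\<Sum>k<n. \<Sum>l<n. if l = k then cnj (P i l) * P i k * of_real (s k) else 0)"
    proof (intro sum.cong refl)
      fix k l assume "k \<in> {..<n}" "l \<in> {..<n}"
      then have "(\<Sum>j<n. Q k j * cnj (Q l j)) = (if l = k then 1 else 0)"
        using svd(2) by (auto simp: unitary_fun_def)
      then show "(\<Sum>j<n. Q k j * cnj (Q l j)) * (cnj (P i l) * P i k * of_real (s k)) =
        (if l = k then cnj (P i l) * P i k * of_real (s k) else 0)" by simp
    qed
    finally show ?thesis by simp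
  qed
  then have "(\<Sum>i<n. \<Sum>j<n. X j i * M $$ (i,j)) = (\<Sum>i<n. \<Sum>k<n. cnj (P i k) * P i k * of_real (s k))"
    by (simp add: svd(3) sum_distrib_left)
  also have "\<dots> = (\<Sum>k<n. \<Sum>i<n. cnj (P i k) * P i k * of_real (s k))" by (rule sum.swap)
  also have "\<dots> = (\<Sum>k<n. of_real (s k))"
    using svd(1) by (intro sum.cong refl) (simp add: unitary_fun_def flip: sum_distrib_right)
  finally show thesis using that[OF X] svd(4) by simp
qed

text \<open>By cyclicity the trace of X M is the sum of s_k Z_kk for the unitary Z = Q X P, whose
  entries have modulus at most 1.\<close>

lemma trace_norm_dual_le:
  assumes M: "M \<in> carrier_mat n n" and X: "unitary_fun n X"
  shows "norm (\<Sum>i<n. \<Sum>j<n. X j i * M $$ (i,j)) \<le> trace_norm M"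
proof -
  obtain P Q s where svd: "unitary_fun n P" "unitary_fun n Q" "\<And>k. k < n \<Longrightarrow> 0 \<le> s k"
    "\<And>i j. i < n \<Longrightarrow> j < n \<Longrightarrow> M $$ (i,j) = (\<Sum>k<n. P i k * of_real (s k) * Q k j)"
    "trace_norm M = (\<Sum>k<n. s k)"
    by (rule obtain_svd[OF M]) blast
  define Z where "Z k l = (\<Sum>i<n. (\<Sum>j<n. Q k j * X j i) * P i l)" for k l
  have Z: "unitary_fun n Z"
    unfolding Z_def by (intro unitary_fun_mult svd X)
  have "(\<Sum>i<n. \<Sum>j<n. X j i * M $$ (i,j)) = (\<Sum>i<n. \<Sum>j<n. \<Sum>k<n. X j i * (P i k * of_real (s k) * Q k j))"
    by (simp add: svd(4) sum_distrib_left)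
  also have "\<dots> = (\<Sum>i<n. \<Sum>k<n. \<Sum>j<n. X j i * (P i k * of_real (s k) * Q k j))"
    by (intro sum.cong refl sum.swap)
  also have "\<dots> = (\<Sum>k<n. \<Sum>i<n. \<Sum>j<n. X j i * (P i k * of_real (s k) * Q k j))" by (rule sum.swap)
  also have "\<dots> = (\<Sum>k<n. of_real (s k) * Z k k)"
    unfolding Z_def sum_distrib_left sum_distrib_right by (intro sum.cong refl) (simp add: mult_ac)
  also have "norm \<dots> \<le> (\<Sum>k<n. s k)"
  proof (rule sum_norm_le)
    fix k assume "k \<in> {..<n}"
    then show "norm (of_real (s k) * Z k k) \<le> s k"
      using unitary_fun_norm_le_1[OF Z, of k k] svd(3)[of k] by (simp add: norm_mult mult_left_le)
  qed
  finally show ?thesis using svd(5) by simp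
qed

section \<open>Measurable choice of almost optimal unitaries\<close>

lemma measurable_map_list:
  assumes "\<And>p. p \<in> set ps \<Longrightarrow> (\<lambda>u. f p u) \<in> measurable M (count_space (UNIV :: 'c :: countable set))"
  shows "(\<lambda>u. map (\<lambda>p. f p u) ps) \<in> measurable M (count_space UNIV)"
  using assms
proof (induction ps)
  case (Cons p ps)
  have "(\<lambda>u. (\<lambda>a u. a # map (\<lambda>p. f p u) ps) (f p u) u) \<in> measurable M (count_space UNIV)"
  proof (rule measurable_compose_countable[where f = "\<lambda>a u. a # map (\<lambda>p. f p u) ps" and g = "f p"])
    fix a
    have "(\<lambda>u. map (\<lambda>p. f p u) ps) \<in> measurable M (count_space UNIV)" using Cons by simp
    then show "(\<lambda>u. a # map (\<lambda>p. f p u) ps) \<in> measurable M (count_space UNIV)"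
      by (rule measurable_compose) simp
  qed (use Cons in simp)
  then show ?case by simp
qed simp

text \<open>Rounding the entries makes the matrix-valued map countably valued, so that optimal unitaries can be
  chosen measurably.\<close>
lemma ex_measurable_almost_optimal_unitary:
  fixes T :: "'a \<Rightarrow> nat \<Rightarrow> nat \<Rightarrow> complex"
  assumes T: "\<And>i j. i < n \<Longrightarrow> j < n \<Longrightarrow> (\<lambda>u. T u i j) \<in> borel_measurable M" and "0 < \<epsilon>"
  obtains X :: "'a \<Rightarrow> nat \<Rightarrow> nat \<Rightarrow> complex" where
    "\<And>u. unitary_fun n (X u)" "\<And>i j. (\<lambda>u. X u i j) \<in> borel_measurable M"
    "\<And>u. trace_norm (Matrix.mat n n (\<lambda>(i,j). T u i j)) \<le> Re (\<Sum>i<n. \<Sum>j<n. X u j i * T u i j) + \<epsilon>"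
proof -
  \<comment> \<open>Rounding moves an entry by at most 2 \<delta>. Going from T to its rounding and
    back costs this twice for each of the n^2 entries, in total at most \<epsilon>. The summand 1
    covers n = 0.\<close>
  define \<delta> where "\<delta> = \<epsilon> / (4 * (real n ^ 2 + 1))"
  have \<delta>: "0 < \<delta>" "real n ^ 2 * (4 * \<delta>) \<le> \<epsilon>"
    using \<open>0 < \<epsilon>\<close> by (simp_all add: \<delta>_def field_simps add_pos_nonneg)
  define r where "r z = (\<lfloor>Re z / \<delta>\<rfloor>, \<lfloor>Im z / \<delta>\<rfloor>)" for z
  define dec where "dec p = Complex (\<delta> * of_int (fst p)) (\<delta> * of_int (snd p))" for p :: "int \<times> int"
  have dec_r: "norm (z - dec (r z)) \<le> 2 * \<delta>" for z
  proof -
    have fl: "\<bar>x - \<delta> * of_int \<lfloor>x / \<delta>\<rfloor>\<bar> \<le> \<delta>" for x :: real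
    proof -
      have "\<delta> * of_int \<lfloor>x / \<delta>\<rfloor> \<le> \<delta> * (x / \<delta>)" using \<delta>(1) by (intro mult_left_mono) auto
      moreover have "\<delta> * (x / \<delta>) \<le> \<delta> * (of_int \<lfloor>x / \<delta>\<rfloor> + 1)" using \<delta>(1) by (intro mult_left_mono) (linarith, simp)
      ultimately show ?thesis using \<delta>(1) by (simp add: distrib_left abs_le_iff)
    qed
    have "norm (z - dec (r z)) \<le> \<bar>Re (z - dec (r z))\<bar> + \<bar>Im (z - dec (r z))\<bar>" by (rule cmod_le)
    also have "\<dots> \<le> \<delta> + \<delta>" using fl[of "Re z"] fl[of "Im z"] by (intro add_mono) (simp_all add: dec_def r_def)
    finally show ?thesis by simp
  qed
  define code where "code u = map (\<lambda>m. r (T u (m div n) (m mod n))) [0..<n * n]" for u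
  define R where "R l i j = dec (l ! (i * n + j))" for l i j
  have idx: "i * n + j < n * n" if "i < n" "j < n" for i j
  proof -
    have "i * n + j < i * n + n" using that by simp
    also have "\<dots> = Suc i * n" by simp
    also have "\<dots> \<le> n * n" using that by (intro mult_le_mono1) simp
    finally show ?thesis .
  qed
  have R_code: "R (code u) i j = dec (r (T u i j))" if "i < n" "j < n" for u i j
    using idx[OF that] that by (simp add: R_def code_def)
  have code_meas: "code \<in> measurable M (count_space UNIV)"
  proof -
    have "(\<lambda>u. r (T u (m div n) (m mod n))) \<in> measurable M (count_space UNIV)" if "m \<in> set [0..<n * n]" for m
    proof -
      have "m div n < n" "m mod n < n"
        using that by (auto simp: less_mult_imp_div_less intro!: mod_less_divisor) (metis less_nat_zero_code mult_0_right neq0_conv)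
      from T[OF this] have t: "(\<lambda>u. T u (m div n) (m mod n)) \<in> borel_measurable M" .
      have "(\<lambda>u. \<lfloor>Re (T u (m div n) (m mod n)) / \<delta>\<rfloor>) \<in> measurable M (count_space UNIV)"
        "(\<lambda>u. \<lfloor>Im (T u (m div n) (m mod n)) / \<delta>\<rfloor>) \<in> measurable M (count_space UNIV)"
        using t by measurable
      then show ?thesis unfolding r_def by measurable
    qed
    then show ?thesis unfolding code_def by (rule measurable_map_list)
  qed
  define tr where "tr X Y = (\<Sum>i<n. \<Sum>j<n. X j i * Y i j)" for X Y :: "nat \<Rightarrow> nat \<Rightarrow> complex"
  define mt where "mt Y = Matrix.mat n n (\<lambda>(i,j). Y i j)" for Y :: "nat \<Rightarrow> nat \<Rightarrow> complex"
  have mt: "mt Y \<in> carrier_mat n n" "(\<Sum>i<n. \<Sum>j<n. X j i * mt Y $$ (i,j)) = tr X Y" for X Y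
    by (auto simp: mt_def tr_def)
  have ex: "\<exists>X. unitary_fun n X \<and> tr X Y = of_real (trace_norm (mt Y))" for Y
    using trace_norm_attained[OF mt(1)[of Y]] unfolding mt(2) by metis
  \<comment> \<open>One choice for each code. Since \<open>code\<close> is measurable into a
    discrete space, every function of it is measurable, whatever the choice operator picks.\<close>
  define G where "G l = (SOME X. unitary_fun n X \<and> tr X (R l) = of_real (trace_norm (mt (R l))))" for l
  have G: "unitary_fun n (G l)" "tr (G l) (R l) = of_real (trace_norm (mt (R l)))" for l
    using someI_ex[OF ex[of "R l"]] unfolding G_def by blast+
  have close: "Re (tr X Y) \<le> Re (tr X Z) + real n ^ 2 * (2 * \<delta>)"
    if X: "unitary_fun n X" and YZ: "\<And>i j. i < n \<Longrightarrow> j < n \<Longrightarrow> norm (Y i j - Z i j) \<le> 2 * \<delta>" for X Y Z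
  proof -
    have "Re (tr X Y) - Re (tr X Z) = Re (\<Sum>i<n. \<Sum>j<n. X j i * (Y i j - Z i j))"
      by (simp add: tr_def right_diff_distrib sum_subtractf)
    also have "\<dots> \<le> norm (\<Sum>i<n. \<Sum>j<n. X j i * (Y i j - Z i j))" by (rule complex_Re_le_cmod)
    also have "\<dots> \<le> (\<Sum>i<n. \<Sum>j<n. 1 * (2 * \<delta>))"
    proof (intro sum_norm_le)
      fix i j assume "i \<in> {..<n}" "j \<in> {..<n}"
      then show "norm (X j i * (Y i j - Z i j)) \<le> 1 * (2 * \<delta>)"
        unfolding norm_mult by (intro mult_mono unitary_fun_norm_le_1[OF X] YZ) auto
    qed
    also have "\<dots> = real n ^ 2 * (2 * \<delta>)" by (simp add: power2_eq_square)
    finally show ?thesis by simp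
  qed
  show thesis
  proof (rule that[of "\<lambda>u. G (code u)"])
    show "(\<lambda>u. G (code u) i j) \<in> borel_measurable M" for i j
      by (rule measurable_compose[OF code_meas]) simp
    fix u
    obtain X where X: "unitary_fun n X" "tr X (T u) = of_real (trace_norm (mt (T u)))" using ex by blast
    have d1: "norm (T u i j - R (code u) i j) \<le> 2 * \<delta>" if "i < n" "j < n" for i j
      using dec_r by (simp add: R_code[OF that])
    have d2: "norm (R (code u) i j - T u i j) \<le> 2 * \<delta>" if "i < n" "j < n" for i j
      using d1[OF that] by (simp add: norm_minus_commute)
    have "trace_norm (mt (T u)) = Re (tr X (T u))" using X(2) by simp
    also have "\<dots> \<le> Re (tr X (R (code u))) + real n ^ 2 * (2 * \<delta>)" by (rule close[OF X(1) d1])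
    also have "Re (tr X (R (code u))) \<le> norm (tr X (R (code u)))" by (rule complex_Re_le_cmod)
    also have "\<dots> \<le> trace_norm (mt (R (code u)))"
      using trace_norm_dual_le[OF mt(1)[of "R (code u)"] X(1)] unfolding mt(2) .
    also have "\<dots> = Re (tr (G (code u)) (R (code u)))" using G(2)[of "code u"] by simp
    also have "\<dots> \<le> Re (tr (G (code u)) (T u)) + real n ^ 2 * (2 * \<delta>)" by (rule close[OF G(1) d2])
    finally have "trace_norm (mt (T u)) \<le> Re (tr (G (code u)) (T u)) + real n ^ 2 * (4 * \<delta>)" by (simp add: algebra_simps)
    then show "trace_norm (Matrix.mat n n (\<lambda>(i,j). T u i j)) \<le> Re (\<Sum>i<n. \<Sum>j<n. G (code u) j i * T u i j) + \<epsilon>"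
      using \<delta>(2) unfolding mt_def tr_def by linarith
  qed (rule G)
qed

subsection \<open>The twirled operator\<close>

lemma sum_lessThan_mult:
  fixes f :: "nat \<Rightarrow> 'b :: comm_monoid_add"
  shows "(\<Sum>q<n * k. f q) = (\<Sum>x<n. \<Sum>m<k. f (x * k + m))"
proof -
  have shift: "sum f {x * k..<x * k + k} = (\<Sum>m<k. f (x * k + m))" for x
    using sum.shift_bounds_nat_ivl[of f 0 "x * k" k] by (simp add: lessThan_atLeast0 add.commute)
  show ?thesis unfolding shift[symmetric] by (rule sum.nat_group[symmetric])
qed

lemma block_index_less: "x < n \<Longrightarrow> m < k \<Longrightarrow> x * k + m < n * (k :: nat)"
proof -
  assume "x < n" "m < k"
  then have "x * k + m < Suc x * k" by simp
  also have "\<dots> \<le> n * k" using \<open>x < n\<close> by (intro mult_le_mono1) simp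
  finally show ?thesis .
qed

lemma kron_carrier: "A \<in> carrier_mat n m \<Longrightarrow> B \<in> carrier_mat k l \<Longrightarrow> kron A B \<in> carrier_mat (n * k) (m * l)"
  by (simp add: kron_def)

lemma kron_index:
  assumes "A \<in> carrier_mat n m" "B \<in> carrier_mat k l" "i < n" "j < m" "p < k" "q < l"
  shows "kron A B $$ (i * k + p, j * l + q) = A $$ (i,j) * B $$ (p,q)"
proof -
  have "i * k + p < n * k" "j * l + q < m * l" using assms by (auto intro: block_index_less)
  moreover have "(i * k + p) div k = i" "(j * l + q) div l = j" using assms by auto
  ultimately show ?thesis using assms by (simp add: kron_def)
qed

lemma adj_kron: "adj (kron A B) = kron (adj A) (adj B)"
proof (intro eq_matI)
  fix i j assume "i < dim_row (kron (adj A) (adj B))" "j < dim_col (kron (adj A) (adj B))"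
  then have ij: "i < dim_col A * dim_col B" "j < dim_row A * dim_row B" by (auto simp: kron_def adj_def)
  have "dim_col B > 0" "dim_row B > 0" using ij by (auto intro!: Nat.gr0I)
  then have "i div dim_col B < dim_col A" "i mod dim_col B < dim_col B"
    "j div dim_row B < dim_row A" "j mod dim_row B < dim_row B"
    using ij by (auto simp: less_mult_imp_div_less)
  then show "adj (kron A B) $$ (i,j) = kron (adj A) (adj B) $$ (i,j)"
    using ij by (simp add: kron_def adj_def)
qed (auto simp: kron_def adj_def)

lemma mult_mat_index_sum:
  assumes "A \<in> carrier_mat n m" "B \<in> carrier_mat m k" "i < n" "j < k"
  shows "(A * B) $$ (i,j) = (\<Sum>l<m. A $$ (i,l) * B $$ (l,j))"
  using assms by (simp add: scalar_prod_def lessThan_atLeast0)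

lemma adj_one: "adj (1\<^sub>m n) = 1\<^sub>m n"
  by (intro eq_matI) (auto simp: adj_def)

text \<open>The row vector d <Phi| (U (x) 1): for m = a d + i, with a the index of A and i that of
  A', the entry of <Phi| (U (x) 1) is d^(-1/2) U_ia. One of the two factors d of the prefactor d^2
  is absorbed here.\<close>

definition twirl_coeff :: "nat \<Rightarrow> (nat \<times> nat \<Rightarrow> complex) \<Rightarrow> nat \<Rightarrow> complex" where
  "twirl_coeff d U m = of_real (sqrt (real d)) * U (m mod d, m div d)"

lemma adj_Phi_kron_index:
  assumes U: "U \<in> carrier_mat d d" and m: "m < d * d"
  shows "(adj (Phi d) * kron U (1\<^sub>m d)) $$ (0,m) = of_real (1 / sqrt (real d)) * U $$ (m mod d, m div d)"
proof -
  have "d > 0" using m by (auto intro!: Nat.gr0I)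
  then have md: "m div d < d" "m mod d < d" using m by (auto simp: less_mult_imp_div_less)
  have "(adj (Phi d) * kron U (1\<^sub>m d)) $$ (0,m) = (\<Sum>l<d * d. adj (Phi d) $$ (0,l) * kron U (1\<^sub>m d) $$ (l,m))"
    using U m by (intro mult_mat_index_sum[where k = "d * d"]) (auto simp: adj_def Phi_def kron_def)
  also have "\<dots> = (\<Sum>a<d. \<Sum>i<d. if i = a then if i = m mod d then of_real (1 / sqrt (real d)) * U $$ (a, m div d) else 0 else 0)"
    unfolding sum_lessThan_mult
  proof (intro sum.cong refl)
    fix a i assume "a \<in> {..<d}" "i \<in> {..<d}"
    then have ai: "a < d" "i < d" by auto
    have "kron U (1\<^sub>m d) $$ (a * d + i, (m div d) * d + m mod d) = U $$ (a, m div d) * 1\<^sub>m d $$ (i, m mod d)"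
      by (rule kron_index[OF U one_carrier_mat ai(1) md(1) ai(2) md(2)])
    then show "adj (Phi d) $$ (0, a * d + i) * kron U (1\<^sub>m d) $$ (a * d + i, m) =
      (if i = a then if i = m mod d then of_real (1 / sqrt (real d)) * U $$ (a, m div d) else 0 else 0)"
      using ai md block_index_less[OF ai] by (simp add: adj_def Phi_def)
  qed
  also have "\<dots> = of_real (1 / sqrt (real d)) * U $$ (m mod d, m div d)" using md by simp
  finally show ?thesis .
qed

text \<open>The factors right of Y are the adjoints of those on the left, so Theta is d^2 G Y times
  the adjoint of G, with G = 1 (x) <Phi| (U (x) 1) diagonal in the C E index. Each side then takes
  one factor d.\<close>

lemma Theta_index:
  assumes Y: "Y \<in> carrier_mat (dC * dE * (d * d)) (dC * dE * (d * d))"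
    and x: "x < dC * dE" and y: "y < dC * dE"
  shows "Theta dC dE d Y (Matrix.mat d d U) $$ (x,y) =
    (\<Sum>m<d * d. \<Sum>m'<d * d. twirl_coeff d U m * cnj (twirl_coeff d U m') * Y $$ (x * (d * d) + m, y * (d * d) + m'))"
proof -
  define n where "n = dC * dE"
  define D where "D = d * d"
  define V where "V = Matrix.mat d d U"
  define s where "s = complex_of_real (1 / sqrt (real d))"
  note [simp] = n_def[symmetric] D_def[symmetric]
  have V: "V \<in> carrier_mat d d" by (simp add: V_def)
  let ?K1 = "kron (1\<^sub>m n) (adj (Phi d))" and ?K2 = "kron (1\<^sub>m n) (kron V (1\<^sub>m d))"
  let ?K3 = "kron (1\<^sub>m n) (kron (adj V) (1\<^sub>m d))" and ?K4 = "kron (1\<^sub>m n) (Phi d)"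
  have P: "Phi d \<in> carrier_mat D 1" "adj (Phi d) \<in> carrier_mat 1 D" by (auto simp: Phi_def adj_def)
  have kV: "kron V (1\<^sub>m d) \<in> carrier_mat D D" "kron (adj V) (1\<^sub>m d) \<in> carrier_mat D D"
    using kron_carrier[OF V one_carrier_mat[of d]] kron_carrier[OF adj_carrier[OF V] one_carrier_mat[of d]] by simp_all
  have c: "?K1 \<in> carrier_mat n (n * D)" "?K2 \<in> carrier_mat (n * D) (n * D)" "?K3 \<in> carrier_mat (n * D) (n * D)"
    "?K4 \<in> carrier_mat (n * D) n"
    using kron_carrier[OF one_carrier_mat[of n] P(2)] kron_carrier[OF one_carrier_mat[of n] kV(1)]
      kron_carrier[OF one_carrier_mat[of n] kV(2)] kron_carrier[OF one_carrier_mat[of n] P(1)] by simp_all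
  have Y: "Y \<in> carrier_mat (n * D) (n * D)" using assms(1) by simp
  define G where "G = ?K1 * ?K2"
  have G: "G \<in> carrier_mat n (n * D)" unfolding G_def using c by (intro mult_carrier_mat)
  have aG: "adj G \<in> carrier_mat (n * D) n" by (rule adj_carrier[OF G])
  have adjG: "adj G = ?K3 * ?K4"
    unfolding G_def adj_mult[OF c(1,2)] by (simp add: adj_kron adj_one adj_adj)
  have "?K1 * ?K2 * Y * ?K3 * ?K4 = G * Y * (?K3 * ?K4)"
    unfolding G_def using c Y by (intro assoc_mult_mat) auto
  then have prod: "?K1 * ?K2 * Y * ?K3 * ?K4 = G * Y * adj G" by (simp only: adjG)
  let ?v = "\<lambda>m. s * V $$ (m mod d, m div d)"
  have Gi: "G $$ (z, w * D + m) = (if w = z then ?v m else 0)"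
    if z: "z < n" and w: "w < n" and m: "m < D" for z w m
  proof -
    have "G $$ (z, w * D + m) = (\<Sum>l<n * D. ?K1 $$ (z,l) * ?K2 $$ (l, w * D + m))"
      unfolding G_def by (rule mult_mat_index_sum[OF c(1,2) z block_index_less[OF w m]])
    also have "\<dots> = (\<Sum>l<n. \<Sum>p<D. if l = z then if w = z then adj (Phi d) $$ (0,p) * kron V (1\<^sub>m d) $$ (p,m) else 0 else 0)"
      unfolding sum_lessThan_mult
    proof (intro sum.cong refl)
      fix l p assume "l \<in> {..<n}" "p \<in> {..<D}"
      then have lp: "l < n" "p < D" by auto
      have "?K1 $$ (z * 1 + 0, l * D + p) = 1\<^sub>m n $$ (z,l) * adj (Phi d) $$ (0,p)"
        by (rule kron_index[OF one_carrier_mat P(2) z lp(1) _ lp(2)]) simp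
      moreover have "?K2 $$ (l * D + p, w * D + m) = 1\<^sub>m n $$ (l,w) * kron V (1\<^sub>m d) $$ (p,m)"
        by (rule kron_index[OF one_carrier_mat kV(1) lp(1) w lp(2) m])
      ultimately show "?K1 $$ (z, l * D + p) * ?K2 $$ (l * D + p, w * D + m) =
        (if l = z then if w = z then adj (Phi d) $$ (0,p) * kron V (1\<^sub>m d) $$ (p,m) else 0 else 0)"
        using z w lp by auto
    qed
    also have "\<dots> = (if w = z then (\<Sum>p<D. adj (Phi d) $$ (0,p) * kron V (1\<^sub>m d) $$ (p,m)) else 0)"
      using z by (simp only: sum_if_const) simp
    also have "(\<Sum>p<D. adj (Phi d) $$ (0,p) * kron V (1\<^sub>m d) $$ (p,m)) = (adj (Phi d) * kron V (1\<^sub>m d)) $$ (0,m)"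
      by (rule mult_mat_index_sum[symmetric, OF P(2) kV(1) _ m]) simp
    also have "\<dots> = ?v m"
      unfolding s_def using adj_Phi_kron_index[OF V] m by simp
    finally show ?thesis .
  qed
  have xy: "x < n" "y < n" using x y by simp_all
  have "(G * Y * adj G) $$ (x,y) = (\<Sum>q'<n * D. (G * Y) $$ (x,q') * adj G $$ (q',y))"
    by (rule mult_mat_index_sum[OF mult_carrier_mat[OF G Y] aG xy])
  also have "\<dots> = (\<Sum>q'<n * D. (\<Sum>q<n * D. G $$ (x,q) * Y $$ (q,q')) * cnj (G $$ (y,q')))"
    using G Y xy by (intro sum.cong refl) (simp add: mult_mat_index_sum[OF G Y] adj_def del: index_mult_mat)
  also have "\<dots> = (\<Sum>w'<n. \<Sum>m'<D. if w' = y then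
      (\<Sum>w<n. \<Sum>m<D. if w = x then ?v m * Y $$ (w * D + m, w' * D + m') else 0) *
      cnj (?v m') else 0)"
    unfolding sum_lessThan_mult
    using xy by (intro sum.cong refl arg_cong2[where f = "(*)"]) (auto simp: Gi intro!: sum.cong)
  also have "\<dots> = (\<Sum>m'<D. (\<Sum>m<D. ?v m * Y $$ (x * D + m, y * D + m')) * cnj (?v m'))"
    using xy by (simp only: sum_if_const) simp
  also have "\<dots> = (\<Sum>m'<D. \<Sum>m<D. ?v m * Y $$ (x * D + m, y * D + m') * cnj (?v m'))"
    by (simp only: sum_distrib_right)
  also have "\<dots> = (\<Sum>m<D. \<Sum>m'<D. ?v m * Y $$ (x * D + m, y * D + m') * cnj (?v m'))"
    by (rule sum.swap)
  finally have entry: "(G * Y * adj G) $$ (x,y) = (\<Sum>m<D. \<Sum>m'<D. ?v m * Y $$ (x * D + m, y * D + m') * cnj (?v m'))" .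
  have "Theta dC dE d Y V $$ (x,y) = of_nat d ^ 2 * (G * Y * adj G) $$ (x,y)"
    unfolding Theta_def n_def[symmetric] prod using xy G aG by (subst index_smult_mat) (simp_all only: carrier_matD index_mult_mat)
  also have "\<dots> = (\<Sum>m<D. \<Sum>m'<D. twirl_coeff d U m * cnj (twirl_coeff d U m') * Y $$ (x * D + m, y * D + m'))"
    unfolding entry sum_distrib_left
  proof (intro sum.cong refl)
    fix m m' assume mm: "m \<in> {..<D}" "m' \<in> {..<D}"
    then have "d > 0" by (auto intro!: Nat.gr0I simp: D_def simp del: D_def[symmetric])
    then have md: "m div d < d" "m mod d < d" "m' div d < d" "m' mod d < d"
      using mm by (auto simp: less_mult_imp_div_less D_def simp del: D_def[symmetric])
    have "real d * (1 / sqrt (real d)) = sqrt (real d)" by (simp add: real_div_sqrt)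
    then have "complex_of_real (real d * (1 / sqrt (real d))) = of_real (sqrt (real d))" by (simp only:)
    then have ds: "of_nat d * s = of_real (sqrt (real d))"
      by (simp only: s_def of_real_mult of_real_of_nat_eq)
    have "k ^ 2 * (s * v * z * cnj (s * v')) = ((k * s) * v) * cnj ((k * s) * v') * z" if "cnj k = k" for k v v' z
      using that by (simp add: power2_eq_square mult_ac)
    from this[of "of_nat d", unfolded ds]
    show "of_nat d ^ 2 * (?v m * Y $$ (x * D + m, y * D + m') * cnj (?v m')) =
      twirl_coeff d U m * cnj (twirl_coeff d U m') * Y $$ (x * D + m, y * D + m')"
      using md by (simp add: twirl_coeff_def V_def)
  qed
  finally show ?thesis by (simp only: V_def D_def)
qed

section \<open>Unitary invariance and the two pointwise pairing inequalities\<close>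

lemma unitary_fun_transpose:
  assumes "unitary_fun n V" shows "unitary_fun n (\<lambda>i j. V j i)"
  unfolding unitary_fun_def
proof (intro conjI allI impI)
  fix i k assume ik: "i < n" "k < n"
  have "(\<Sum>p<n. cnj (V p k) * V p i) = (if k = i then 1 else 0)" using assms ik by (simp add: unitary_fun_def)
  then show "(\<Sum>p<n. V p i * cnj (V p k)) = (if i = k then 1 else 0)"
    by (simp only: mult.commute eq_commute[of i k])
  have "(\<Sum>p<n. V k p * cnj (V i p)) = (if k = i then 1 else 0)" using assms ik by (simp add: unitary_fun_def)
  then show "(\<Sum>p<n. cnj (V i p) * V k p) = (if i = k then 1 else 0)"
    by (simp only: mult.commute eq_commute[of i k])
qed

lemma unitary_fun_isometry:
  assumes V: "unitary_fun n V"
  shows "(\<Sum>i<n. (norm (\<Sum>x<n. V i x * f x))\<^sup>2) = (\<Sum>x<n. (norm (f x))\<^sup>2)"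
proof -
  have "apply_fun n (adjoint_fun V) (apply_fun n V f) x = f x" if "x < n" for x
  proof -
    have "apply_fun n (adjoint_fun V) (apply_fun n V f) x = (\<Sum>l<n. \<Sum>y<n. cnj (V l x) * V l y * f y)"
      by (simp only: apply_fun_def adjoint_fun_def sum_distrib_left mult.assoc)
    also have "\<dots> = (\<Sum>y<n. (\<Sum>l<n. cnj (V l x) * V l y) * f y)"
      by (subst sum.swap) (simp only: sum_distrib_right)
    also have "\<dots> = (\<Sum>y<n. if y = x then f y else 0)"
      using V that by (intro sum.cong refl) (auto simp: unitary_fun_def)
    finally show ?thesis using that by simp
  qed
  then have "cdot n (apply_fun n (adjoint_fun V) (apply_fun n V f)) f = cdot n f f" by (intro cdot_cong) auto
  then have "cdot n (apply_fun n V f) (apply_fun n V f) = cdot n f f" by (simp only: cdot_apply_fun)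
  then show ?thesis unfolding cdot_self of_real_eq_iff by (simp only: apply_fun_def)
qed

lemma unitary_fun_frobenius:
  assumes A: "unitary_fun n A" and B: "unitary_fun n B"
  shows "(\<Sum>i<n. \<Sum>k<n. (norm (\<Sum>x<n. \<Sum>y<n. A i x * T x y * B y k))\<^sup>2) = (\<Sum>x<n. \<Sum>y<n. (norm (T x y))\<^sup>2)"
proof -
  have "(\<Sum>i<n. \<Sum>k<n. (norm (\<Sum>x<n. \<Sum>y<n. A i x * T x y * B y k))\<^sup>2) =
    (\<Sum>k<n. \<Sum>i<n. (norm (\<Sum>x<n. A i x * (\<Sum>y<n. T x y * B y k)))\<^sup>2)"
    by (subst sum.swap) (simp only: sum_distrib_left mult.assoc)
  also have "\<dots> = (\<Sum>x<n. \<Sum>k<n. (norm (\<Sum>y<n. B y k * T x y))\<^sup>2)"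
    unfolding unitary_fun_isometry[OF A] by (subst sum.swap) (simp only: mult.commute)
  also have "\<dots> = (\<Sum>x<n. \<Sum>y<n. (norm (T x y))\<^sup>2)"
    by (simp only: unitary_fun_isometry[OF unitary_fun_transpose[OF B]])
  finally show ?thesis .
qed

lemma two_mult_le_sum_squares: "2 * (a * b) \<le> a\<^sup>2 + (b :: real)\<^sup>2"
  using zero_le_power2[of "a - b"] by (simp add: power2_eq_square algebra_simps)

text \<open>Cauchy-Schwarz for a unitary between two contractive diagonal factors would give |p|
  |q|. The mean of the squares is used instead because it is linear in quantities whose Haar means
  are known exactly.\<close>

lemma unitary_fun_pairing_le:
  assumes Q: "unitary_fun n Q" and \<xi>: "\<And>i. i < n \<Longrightarrow> norm (\<xi> i) \<le> 1" and \<omega>: "\<And>k. k < n \<Longrightarrow> norm (\<omega> k) \<le> 1"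
  shows "norm (\<Sum>i<n. \<Sum>k<n. Q k i * (p i * q k) * \<xi> i * \<omega> k) \<le> ((\<Sum>i<n. (norm (p i))\<^sup>2) + (\<Sum>k<n. (norm (q k))\<^sup>2)) / 2"
proof -
  let ?r = "\<lambda>k. \<Sum>i<n. Q k i * (\<xi> i * p i)"
  have "(\<Sum>i<n. \<Sum>k<n. Q k i * (p i * q k) * \<xi> i * \<omega> k) = (\<Sum>k<n. (\<omega> k * q k) * ?r k)"
    by (subst sum.swap) (simp add: sum_distrib_left mult_ac)
  also have "norm \<dots> \<le> (\<Sum>k<n. ((norm (q k))\<^sup>2 + (norm (?r k))\<^sup>2) / 2)"
  proof (rule sum_norm_le)
    fix k assume "k \<in> {..<n}"
    then have "norm (\<omega> k * q k) \<le> norm (q k)" using \<omega>[of k] by (simp add: norm_mult mult_left_le_one_le)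
    then have "norm (\<omega> k * q k) * norm (?r k) \<le> norm (q k) * norm (?r k)" by (rule mult_right_mono) simp
    also have "\<dots> \<le> ((norm (q k))\<^sup>2 + (norm (?r k))\<^sup>2) / 2"
      using two_mult_le_sum_squares[of "norm (q k)" "norm (?r k)"] by simp
    finally show "norm (\<omega> k * q k * ?r k) \<le> ((norm (q k))\<^sup>2 + (norm (?r k))\<^sup>2) / 2" by (simp only: norm_mult)
  qed
  also have "\<dots> = ((\<Sum>k<n. (norm (q k))\<^sup>2) + (\<Sum>k<n. (norm (?r k))\<^sup>2)) / 2"
    by (simp only: sum.distrib sum_divide_distrib[symmetric])
  also have "(\<Sum>k<n. (norm (?r k))\<^sup>2) = (\<Sum>i<n. (norm (\<xi> i * p i))\<^sup>2)" by (rule unitary_fun_isometry[OF Q])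
  also have "\<dots> \<le> (\<Sum>i<n. (norm (p i))\<^sup>2)"
    using \<xi> by (intro sum_mono power_mono) (auto simp: norm_mult mult_left_le_one_le)
  finally show ?thesis by simp
qed

text \<open>The numbers |Q_ki|^2 form a doubly stochastic matrix and |\<xi>_i|^2 |\<omega>_k|^2 is
  at most half the sum of the fourth powers, so the weights Q_ki \<xi>_i \<omega>_k have l^2 norm at
  most 1: this is where l^4 enters. The parameter c can then be tuned to the mean size of S after
  integration.\<close>

lemma unitary_fun_weighted_pairing_le:
  assumes Q: "unitary_fun n Q" and \<xi>: "(\<Sum>i<n. norm (\<xi> i) ^ 4) \<le> 1" and \<omega>: "(\<Sum>k<n. norm (\<omega> k) ^ 4) \<le> 1"
    and c: "0 < c"
  shows "norm (\<Sum>i<n. \<Sum>k<n. Q k i * S i k * \<xi> i * \<omega> k) \<le> c / 2 + (\<Sum>i<n. \<Sum>k<n. (norm (S i k))\<^sup>2) / (2 * c)"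
proof -
  have col: "(\<Sum>k<n. (norm (Q k i))\<^sup>2) = 1" if "i < n" for i
  proof -
    have "complex_of_real (\<Sum>k<n. (norm (Q k i))\<^sup>2) = (\<Sum>k<n. cnj (Q k i) * Q k i)"
      by (simp add: complex_norm_square mult.commute del: of_real_power)
    also have "\<dots> = 1" using Q that by (simp add: unitary_fun_def)
    finally show ?thesis using of_real_eq_1_iff by blast
  qed
  have row: "(\<Sum>i<n. (norm (Q k i))\<^sup>2) = 1" if "k < n" for k
  proof -
    have "complex_of_real (\<Sum>i<n. (norm (Q k i))\<^sup>2) = (\<Sum>i<n. Q k i * cnj (Q k i))"
      by (simp add: complex_norm_square del: of_real_power)
    also have "\<dots> = 1" using Q that by (simp add: unitary_fun_def)
    finally show ?thesis using of_real_eq_1_iff by blast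
  qed
  have "norm (\<Sum>i<n. \<Sum>k<n. Q k i * S i k * \<xi> i * \<omega> k) \<le>
    (\<Sum>i<n. \<Sum>k<n. c / 4 * ((norm (Q k i))\<^sup>2 * norm (\<xi> i) ^ 4) + c / 4 * ((norm (Q k i))\<^sup>2 * norm (\<omega> k) ^ 4) + (norm (S i k))\<^sup>2 / (2 * c))"
  proof (intro sum_norm_le)
    fix i k
    have "q * s * x * w \<le> c / 4 * (q\<^sup>2 * x ^ 4) + c / 4 * (q\<^sup>2 * w ^ 4) + s\<^sup>2 / (2 * c)" for q s x w :: real
    proof -
      have "2 * ((c * (q * x * w)) * s) \<le> (c * (q * x * w))\<^sup>2 + s\<^sup>2" by (rule two_mult_le_sum_squares)
      then have "q * s * x * w \<le> (c * (q * x * w))\<^sup>2 / (2 * c) + s\<^sup>2 / (2 * c)"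
        using c by (simp add: field_simps)
      also have "(c * (q * x * w))\<^sup>2 / (2 * c) = c / 4 * (q\<^sup>2 * (2 * (x\<^sup>2 * w\<^sup>2)))"
        using c by (simp add: power_mult_distrib power2_eq_square[of c])
      also have "\<dots> \<le> c / 4 * (q\<^sup>2 * (x ^ 4 + w ^ 4))"
        using two_mult_le_sum_squares[of "x\<^sup>2" "w\<^sup>2"] c by (intro mult_left_mono) (auto simp flip: power_mult)
      finally show ?thesis by (simp add: distrib_left)
    qed
    then show "norm (Q k i * S i k * \<xi> i * \<omega> k) \<le>
      c / 4 * ((norm (Q k i))\<^sup>2 * norm (\<xi> i) ^ 4) + c / 4 * ((norm (Q k i))\<^sup>2 * norm (\<omega> k) ^ 4) + (norm (S i k))\<^sup>2 / (2 * c)"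
      by (simp only: norm_mult)
  qed
  also have "\<dots> = c / 4 * (\<Sum>i<n. \<Sum>k<n. (norm (Q k i))\<^sup>2 * norm (\<xi> i) ^ 4) + c / 4 * (\<Sum>i<n. \<Sum>k<n. (norm (Q k i))\<^sup>2 * norm (\<omega> k) ^ 4)
     + (\<Sum>i<n. \<Sum>k<n. (norm (S i k))\<^sup>2) / (2 * c)"
    by (simp only: sum.distrib sum_distrib_left sum_divide_distrib)
  also have "(\<Sum>i<n. \<Sum>k<n. (norm (Q k i))\<^sup>2 * norm (\<xi> i) ^ 4) = (\<Sum>i<n. norm (\<xi> i) ^ 4)"
    by (intro sum.cong refl) (simp add: sum_distrib_right[symmetric] col)
  also have "(\<Sum>i<n. \<Sum>k<n. (norm (Q k i))\<^sup>2 * norm (\<omega> k) ^ 4) = (\<Sum>k<n. norm (\<omega> k) ^ 4)"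
    by (subst sum.swap, intro sum.cong refl) (simp add: sum_distrib_right[symmetric] row)
  also have "c / 4 * (\<Sum>i<n. norm (\<xi> i) ^ 4) + c / 4 * (\<Sum>k<n. norm (\<omega> k) ^ 4) \<le> c / 4 * 1 + c / 4 * 1"
    using c \<xi> \<omega> by (intro add_mono mult_left_mono) auto
  finally show ?thesis by simp
qed

section \<open>Bounded measurable functions and the centred map\<close>

context haar_measure
begin

text \<open>A class closed under arithmetic, so that integrability follows from the shape of a term.
  The bound is asked at unitary arguments only, since entries are unbounded on the whole sample
  space.\<close>

definition bdd_meas :: "((nat \<times> nat \<Rightarrow> complex) \<Rightarrow> 'b :: {real_normed_field, banach, second_countable_topology}) \<Rightarrow> bool" where
  "bdd_meas F \<longleftrightarrow> F \<in> borel_measurable \<mu> \<and>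
     (\<exists>B. \<forall>U. unitary_fun d (\<lambda>i j. U (i,j)) \<longrightarrow> norm (F U) \<le> B)"

lemma bdd_measI:
  "F \<in> borel_measurable \<mu> \<Longrightarrow> (\<And>U. unitary_fun d (\<lambda>i j. U (i,j)) \<Longrightarrow> norm (F U) \<le> B) \<Longrightarrow> bdd_meas F"
  by (auto simp: bdd_meas_def)

lemma bdd_meas_integrable: "bdd_meas F \<Longrightarrow> integrable \<mu> F"
  unfolding bdd_meas_def by (auto intro!: integrable_AE_bound AE_I2)

lemma bdd_meas_const: "bdd_meas (\<lambda>U. c)"
  by (rule bdd_measI[of _ "norm c"]) auto

lemma bdd_meas_add:
  assumes "bdd_meas F" "bdd_meas G"
  shows "bdd_meas (\<lambda>U. F U + G U)"
proof -
  obtain B C where "\<forall>U. unitary_fun d (\<lambda>i j. U (i,j)) \<longrightarrow> norm (F U) \<le> B" "\<forall>U. unitary_fun d (\<lambda>i j. U (i,j)) \<longrightarrow> norm (G U) \<le> C"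
    using assms unfolding bdd_meas_def by blast
  then show ?thesis using assms
    by (intro bdd_measI[of _ "B + C"]) (auto simp: bdd_meas_def intro: norm_triangle_mono)
qed

lemma bdd_meas_mult:
  assumes "bdd_meas F" "bdd_meas G"
  shows "bdd_meas (\<lambda>U. F U * G U)"
proof -
  obtain B C where "\<forall>U. unitary_fun d (\<lambda>i j. U (i,j)) \<longrightarrow> norm (F U) \<le> B" "\<forall>U. unitary_fun d (\<lambda>i j. U (i,j)) \<longrightarrow> norm (G U) \<le> C"
    using assms unfolding bdd_meas_def by blast
  then show ?thesis using assms
    by (intro bdd_measI[of _ "\<bar>B\<bar> * \<bar>C\<bar>"])
      (auto simp: bdd_meas_def norm_mult intro!: mult_mono intro: order.trans[OF _ abs_ge_self])
qed

lemma bdd_meas_diff: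
  assumes "bdd_meas F" "bdd_meas G"
  shows "bdd_meas (\<lambda>U. F U - G U)"
  using bdd_meas_add[OF assms(1) bdd_meas_mult[OF bdd_meas_const[of "- 1"] assms(2)]] by simp

lemma bdd_meas_sum:
  "(\<And>i. i \<in> I \<Longrightarrow> bdd_meas (F i)) \<Longrightarrow> bdd_meas (\<lambda>U. \<Sum>i\<in>I. F i U)"
  by (induction I rule: infinite_finite_induct) (auto intro: bdd_meas_const bdd_meas_add)

lemma bdd_meas_cnj: "bdd_meas F \<Longrightarrow> bdd_meas (\<lambda>U. cnj (F U))"
  unfolding bdd_meas_def by auto

lemma bdd_meas_norm:
  fixes F :: "_ \<Rightarrow> complex"
  shows "bdd_meas F \<Longrightarrow> bdd_meas (\<lambda>U. norm (F U))"
  unfolding bdd_meas_def by auto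

lemma bdd_meas_norm_sq:
  fixes F :: "_ \<Rightarrow> complex"
  shows "bdd_meas F \<Longrightarrow> bdd_meas (\<lambda>U. (norm (F U))\<^sup>2)"
  unfolding power2_eq_square by (intro bdd_meas_mult bdd_meas_norm)

lemma bdd_meas_entry: "i < d \<Longrightarrow> j < d \<Longrightarrow> bdd_meas (\<lambda>U. U (i,j))"
  by (rule bdd_measI[of _ 1]) (auto intro: unitary_fun_norm_le_1)

lemmas bdd_meas_intros = bdd_meas_const bdd_meas_add bdd_meas_mult
  bdd_meas_diff bdd_meas_sum bdd_meas_cnj bdd_meas_norm_sq bdd_meas_norm

lemma bdd_meas_twirl_coeff:
  assumes "m < d * d" shows "bdd_meas (\<lambda>U. twirl_coeff d U m)"
proof -
  have "0 < d" using assms by (cases d) auto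
  then show ?thesis using assms unfolding twirl_coeff_def
    by (intro bdd_meas_mult bdd_meas_const bdd_meas_entry)
      (auto simp: less_mult_imp_div_less)
qed

lemma twirl_form_eq:
  "(\<Sum>m<d * d. \<Sum>m'<d * d. twirl_coeff d U m * cnj (twirl_coeff d U m') * w m m') =
   of_nat d * (\<Sum>a<d. \<Sum>i<d. \<Sum>b<d. \<Sum>j<d. w (a * d + i) (b * d + j) * (U (i,a) * cnj (U (j,b))))"
proof -
  have tc: "twirl_coeff d U (a * d + i) = of_real (sqrt (real d)) * U (i,a)" if "a < d" "i < d" for a i
    using that by (simp add: twirl_coeff_def)
  have "complex_of_real (sqrt (real d) * sqrt (real d)) = of_nat d" by simp
  then have dd: "complex_of_real (sqrt (real d)) * of_real (sqrt (real d)) = of_nat d" by (simp only: of_real_mult)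
  have "(\<Sum>m<d * d. \<Sum>m'<d * d. twirl_coeff d U m * cnj (twirl_coeff d U m') * w m m') =
    (\<Sum>a<d. \<Sum>i<d. \<Sum>b<d. \<Sum>j<d. (of_real (sqrt (real d)) * of_real (sqrt (real d))) * (w (a * d + i) (b * d + j) * (U (i,a) * cnj (U (j,b)))))"
    unfolding sum_lessThan_mult by (intro sum.cong refl) (simp add: tc mult_ac)
  then show ?thesis unfolding dd by (simp only: sum_distrib_left)
qed

lemma integral_twirl_form:
  "(\<integral>U. (\<Sum>m<d * d. \<Sum>m'<d * d. twirl_coeff d U m * cnj (twirl_coeff d U m') * w m m') \<partial>\<mu>) = (\<Sum>m<d * d. w m m)"
proof (cases "d = 0")
  case False
  then show ?thesis unfolding twirl_form_eq unfolding integral_mult_right_zero sum_lessThan_mult[of _ d d]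
    using integral_entry_form[of "\<lambda>a i b j. w (a * d + i) (b * d + j)"] by simp
qed simp

lemma twirl_form_variance:
  "(\<integral>U. (norm ((\<Sum>m<d * d. \<Sum>m'<d * d. twirl_coeff d U m * cnj (twirl_coeff d U m') * w m m') - (\<Sum>m<d * d. w m m)))\<^sup>2 \<partial>\<mu>)
     \<le> 4 / 3 * (\<Sum>m<d * d. \<Sum>m'<d * d. (norm (w m m'))\<^sup>2)"
  unfolding twirl_form_eq unfolding sum_lessThan_mult[of _ d d]
  by (rule entry_form_variance[of "\<lambda>a i b j. w (a * d + i) (b * d + j)"])

text \<open>The entries of Theta minus its Haar mean, for an operator given by its entry function.
  The mean is written as the partial trace over A and A', its value by
  \<open>integral_twirl_form\<close>, so that no integral occurs here.\<close>

definition twirl :: "(nat \<Rightarrow> nat \<Rightarrow> complex) \<Rightarrow> (nat \<times> nat \<Rightarrow> complex) \<Rightarrow> nat \<Rightarrow> nat \<Rightarrow> complex" where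
  "twirl W U x y =
    (\<Sum>m<d * d. \<Sum>m'<d * d. twirl_coeff d U m * cnj (twirl_coeff d U m') * W (x * (d * d) + m) (y * (d * d) + m'))
    - (\<Sum>m<d * d. W (x * (d * d) + m) (y * (d * d) + m))"

lemma bdd_meas_twirl: "bdd_meas (\<lambda>U. twirl W U x y)"
  unfolding twirl_def
  by (intro bdd_meas_intros bdd_meas_twirl_coeff) auto

lemma integral_twirl_sq_le:
  "(\<integral>U. (\<Sum>x<n. \<Sum>y<n. (norm (twirl W U x y))\<^sup>2) \<partial>\<mu>) \<le> 4 / 3 * (\<Sum>q<n * (d * d). \<Sum>q'<n * (d * d). (norm (W q q'))\<^sup>2)"
proof -
  have "(\<integral>U. (\<Sum>x<n. \<Sum>y<n. (norm (twirl W U x y))\<^sup>2) \<partial>\<mu>) = (\<Sum>x<n. \<Sum>y<n. \<integral>U. (norm (twirl W U x y))\<^sup>2 \<partial>\<mu>)"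
    by (intro integral_double_sum bdd_meas_integrable bdd_meas_norm_sq bdd_meas_twirl)
  also have "\<dots> \<le> (\<Sum>x<n. \<Sum>y<n. 4 / 3 * (\<Sum>m<d * d. \<Sum>m'<d * d. (norm (W (x * (d * d) + m) (y * (d * d) + m')))\<^sup>2))"
    unfolding twirl_def by (intro sum_mono twirl_form_variance)
  also have "\<dots> = 4 / 3 * (\<Sum>x<n. \<Sum>y<n. \<Sum>m<d * d. \<Sum>m'<d * d. (norm (W (x * (d * d) + m) (y * (d * d) + m')))\<^sup>2)"
    by (simp only: sum_distrib_left)
  also have "(\<Sum>x<n. \<Sum>y<n. \<Sum>m<d * d. \<Sum>m'<d * d. (norm (W (x * (d * d) + m) (y * (d * d) + m')))\<^sup>2) =
    (\<Sum>x<n. \<Sum>m<d * d. \<Sum>y<n. \<Sum>m'<d * d. (norm (W (x * (d * d) + m) (y * (d * d) + m')))\<^sup>2)"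
    by (intro sum.cong[OF refl] sum.swap)
  finally show ?thesis by (simp only: sum_lessThan_mult[of _ n "d * d"])
qed

text \<open>The vector (1 (x) d <Phi| (U (x) 1)) u. Theta sends the rank-one operator |u><v| to the
  rank-one operator built from \<open>twirl_vec u U\<close> and
  \<open>twirl_vec v U\<close>.\<close>

definition twirl_vec :: "(nat \<Rightarrow> complex) \<Rightarrow> (nat \<times> nat \<Rightarrow> complex) \<Rightarrow> nat \<Rightarrow> complex" where
  "twirl_vec u U x = (\<Sum>m<d * d. twirl_coeff d U m * u (x * (d * d) + m))"

lemma bdd_meas_twirl_vec: "bdd_meas (\<lambda>U. twirl_vec u U x)"
  unfolding twirl_vec_def by (intro bdd_meas_intros bdd_meas_twirl_coeff) auto

lemma twirl_vec_prod:
  "twirl_vec u U x * cnj (twirl_vec v U y) =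
    (\<Sum>m<d * d. \<Sum>m'<d * d. twirl_coeff d U m * cnj (twirl_coeff d U m') * (u (x * (d * d) + m) * cnj (v (y * (d * d) + m'))))"
  unfolding twirl_vec_def cnj_sum sum_product by (intro sum.cong refl) (simp add: mult_ac)

text \<open>Squared length is preserved on average: the mean of the rank-one form with u on both
  sides is the partial trace of |u><u|, and summing its diagonal gives the full trace.\<close>

lemma integral_twirl_vec_sq: "(\<integral>U. (\<Sum>x<n. (norm (twirl_vec u U x))\<^sup>2) \<partial>\<mu>) = (\<Sum>q<n * (d * d). (norm (u q))\<^sup>2)"
proof -
  have "(\<integral>U. (norm (twirl_vec u U x))\<^sup>2 \<partial>\<mu>) = (\<Sum>m<d * d. (norm (u (x * (d * d) + m)))\<^sup>2)" for x
  proof -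
    have "complex_of_real (\<integral>U. (norm (twirl_vec u U x))\<^sup>2 \<partial>\<mu>) = (\<integral>U. complex_of_real ((norm (twirl_vec u U x))\<^sup>2) \<partial>\<mu>)"
      by (rule integral_complex_of_real[symmetric])
    also have "\<dots> = (\<Sum>m<d * d. u (x * (d * d) + m) * cnj (u (x * (d * d) + m)))"
      unfolding complex_norm_square twirl_vec_prod by (rule integral_twirl_form)
    also have "\<dots> = complex_of_real (\<Sum>m<d * d. (norm (u (x * (d * d) + m)))\<^sup>2)"
      unfolding complex_norm_square[symmetric] by (simp only: of_real_sum)
    finally show ?thesis by (simp only: of_real_eq_iff)
  qed
  moreover have "(\<integral>U. (\<Sum>x<n. (norm (twirl_vec u U x))\<^sup>2) \<partial>\<mu>) = (\<Sum>x<n. \<integral>U. (norm (twirl_vec u U x))\<^sup>2 \<partial>\<mu>)"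
    by (intro Bochner_Integration.integral_sum bdd_meas_integrable bdd_meas_norm_sq bdd_meas_twirl_vec)
  ultimately show ?thesis by (simp only: sum_lessThan_mult[of _ n "d * d"])
qed

lemma twirl_rank_one:
  "twirl (\<lambda>q q'. u q * cnj (v q')) U x y =
    twirl_vec u U x * cnj (twirl_vec v U y) - (\<integral>V. twirl_vec u V x * cnj (twirl_vec v V y) \<partial>\<mu>)"
  unfolding twirl_vec_prod twirl_def by (simp only: integral_twirl_form)

end

subsection \<open>The trilinear form and its endpoint bounds\<close>

lemma norm_integral_le_integral:
  fixes f :: "'a \<Rightarrow> 'b :: {banach, second_countable_topology}"
  assumes "integrable M f" "integrable M g" "\<And>x. norm (f x) \<le> g x"
  shows "norm (\<integral>x. f x \<partial>M) \<le> (\<integral>x. g x \<partial>M)"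
  by (rule order.trans[OF integral_norm_bound integral_mono[OF integrable_norm[OF assms(1)] assms(2)]])
    (rule assms(3))

lemma (in haar_measure) twirl_linear:
  "twirl (\<lambda>q q'. \<Sum>j\<in>J. e j * W j q q') U x y = (\<Sum>j\<in>J. e j * twirl (W j) U x y)"
proof -
  have "(\<Sum>m<d * d. \<Sum>m'<d * d. twirl_coeff d U m * cnj (twirl_coeff d U m') * (\<Sum>j\<in>J. e j * W j (x * (d * d) + m) (y * (d * d) + m'))) =
    (\<Sum>m<d * d. \<Sum>m'<d * d. \<Sum>j\<in>J. e j * (twirl_coeff d U m * cnj (twirl_coeff d U m') * W j (x * (d * d) + m) (y * (d * d) + m')))"
    unfolding sum_distrib_left by (intro sum.cong refl) (simp add: mult_ac)
  also have "\<dots> = (\<Sum>m<d * d. \<Sum>j\<in>J. \<Sum>m'<d * d. e j * (twirl_coeff d U m * cnj (twirl_coeff d U m') * W j (x * (d * d) + m) (y * (d * d) + m')))"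
    by (intro sum.cong[OF refl] sum.swap)
  also have "\<dots> = (\<Sum>j\<in>J. \<Sum>m<d * d. \<Sum>m'<d * d. e j * (twirl_coeff d U m * cnj (twirl_coeff d U m') * W j (x * (d * d) + m) (y * (d * d) + m')))"
    by (rule sum.swap)
  finally have 1: "(\<Sum>m<d * d. \<Sum>m'<d * d. twirl_coeff d U m * cnj (twirl_coeff d U m') * (\<Sum>j\<in>J. e j * W j (x * (d * d) + m) (y * (d * d) + m'))) =
    (\<Sum>j\<in>J. e j * (\<Sum>m<d * d. \<Sum>m'<d * d. twirl_coeff d U m * cnj (twirl_coeff d U m') * W j (x * (d * d) + m) (y * (d * d) + m')))"
    by (simp only: sum_distrib_left)
  have 2: "(\<Sum>m<d * d. \<Sum>j\<in>J. e j * W j (x * (d * d) + m) (y * (d * d) + m)) = (\<Sum>j\<in>J. e j * (\<Sum>m<d * d. W j (x * (d * d) + m) (y * (d * d) + m)))"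
    by (subst sum.swap) (simp only: sum_distrib_left)
  show ?thesis unfolding twirl_def 1 2 by (simp only: right_diff_distrib sum_subtractf)
qed

locale twirl_trilinear = haar_measure +
  fixes n :: nat and X :: "(nat \<times> nat \<Rightarrow> complex) \<Rightarrow> nat \<Rightarrow> nat \<Rightarrow> complex"
    and A1 A2 B1 B2 Z1 Z2 :: "nat \<Rightarrow> nat \<Rightarrow> complex"
  assumes X: "\<And>U. unitary_fun n (X U)" and X_meas: "\<And>i j. (\<lambda>U. X U i j) \<in> borel_measurable \<mu>"
    and A1: "unitary_fun n A1" and A2: "unitary_fun n A2" and B1: "unitary_fun n B1" and B2: "unitary_fun n B2"
    and Z1: "unitary_fun (n * (d * d)) Z1" and Z2: "unitary_fun (n * (d * d)) Z2"
begin

text \<open>By cyclicity the trace of X A1 \<xi> A2 T B1 \<omega> B2 is the sum over i and k of the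
  products of \<open>outer\<close> at (k, i), \<xi>_i, \<open>inner\<close> at (i, k) and
  \<omega>_k. This separates a unitary from the centred operator T in rotated bases.\<close>

definition outer :: "(nat \<times> nat \<Rightarrow> complex) \<Rightarrow> nat \<Rightarrow> nat \<Rightarrow> complex" where
  "outer U k i = (\<Sum>y<n. B2 k y * (\<Sum>x<n. X U y x * A1 x i))"

definition inner :: "(nat \<Rightarrow> nat \<Rightarrow> complex) \<Rightarrow> (nat \<times> nat \<Rightarrow> complex) \<Rightarrow> nat \<Rightarrow> nat \<Rightarrow> complex" where
  "inner W U i k = (\<Sum>x<n. \<Sum>y<n. A2 i x * twirl W U x y * B1 y k)"

definition coeff :: "nat \<Rightarrow> nat \<Rightarrow> nat \<Rightarrow> complex" where
  "coeff i j k = (\<integral>U. outer U k i * inner (\<lambda>q q'. Z1 q j * Z2 j q') U i k \<partial>\<mu>)"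

lemma unitary_outer: "unitary_fun n (outer U)"
  unfolding outer_def by (intro unitary_fun_mult B2 X A1)

lemma bdd_meas_outer: "bdd_meas (\<lambda>U. outer U k i)"
proof -
  have "bdd_meas (\<lambda>U. X U y x)" if "y < n" "x < n" for y x
    using X_meas unitary_fun_norm_le_1[OF X that] by (intro bdd_measI[of _ 1]) auto
  then show ?thesis unfolding outer_def by (intro bdd_meas_intros) auto
qed

lemma bdd_meas_inner: "bdd_meas (\<lambda>U. inner W U i k)"
  unfolding inner_def by (intro bdd_meas_intros bdd_meas_twirl)

lemma inner_linear:
  "inner (\<lambda>q q'. \<Sum>j\<in>J. e j * W j q q') U i k = (\<Sum>j\<in>J. e j * inner (W j) U i k)"
proof -
  have "inner (\<lambda>q q'. \<Sum>j\<in>J. e j * W j q q') U i k = (\<Sum>x<n. \<Sum>y<n. \<Sum>j\<in>J. e j * (A2 i x * twirl (W j) U x y * B1 y k))"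
    unfolding inner_def twirl_linear sum_distrib_left sum_distrib_right
    by (intro sum.cong refl) (simp add: mult_ac)
  also have "\<dots> = (\<Sum>x<n. \<Sum>j\<in>J. \<Sum>y<n. e j * (A2 i x * twirl (W j) U x y * B1 y k))"
    by (intro sum.cong[OF refl] sum.swap)
  also have "\<dots> = (\<Sum>j\<in>J. \<Sum>x<n. \<Sum>y<n. e j * (A2 i x * twirl (W j) U x y * B1 y k))" by (rule sum.swap)
  finally show ?thesis by (simp only: inner_def sum_distrib_left)
qed

lemma sum_coeff:
  "(\<Sum>i<n. \<Sum>j<n * (d * d). \<Sum>k<n. coeff i j k * \<xi> i * \<eta> j * \<omega> k) =
   (\<integral>U. (\<Sum>i<n. \<Sum>k<n. outer U k i * inner (\<lambda>q q'. \<Sum>j<n * (d * d). \<eta> j * (Z1 q j * Z2 j q')) U i k * \<xi> i * \<omega> k) \<partial>\<mu>)"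
proof -
  let ?J = "{..<n * (d * d)}"
  let ?W = "\<lambda>j q q'. Z1 q j * Z2 j q'"
  have int: "integrable \<mu> (\<lambda>U. outer U k i * inner W U i k * c)" for i k W c
    by (intro bdd_meas_integrable bdd_meas_mult bdd_meas_outer bdd_meas_inner
        bdd_meas_const)
  have "(\<integral>U. (\<Sum>i<n. \<Sum>k<n. outer U k i * inner (\<lambda>q q'. \<Sum>j\<in>?J. \<eta> j * ?W j q q') U i k * \<xi> i * \<omega> k) \<partial>\<mu>) =
    (\<integral>U. (\<Sum>i<n. \<Sum>k<n. \<Sum>j\<in>?J. outer U k i * inner (?W j) U i k * (\<xi> i * \<eta> j * \<omega> k)) \<partial>\<mu>)"
    unfolding inner_linear sum_distrib_left sum_distrib_right
    by (intro Bochner_Integration.integral_cong sum.cong refl) (simp add: mult_ac)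
  also have "\<dots> = (\<Sum>i<n. \<Sum>k<n. \<integral>U. (\<Sum>j\<in>?J. outer U k i * inner (?W j) U i k * (\<xi> i * \<eta> j * \<omega> k)) \<partial>\<mu>)"
    by (intro integral_double_sum Bochner_Integration.integrable_sum int)
  also have "\<dots> = (\<Sum>i<n. \<Sum>k<n. \<Sum>j\<in>?J. \<integral>U. outer U k i * inner (?W j) U i k * (\<xi> i * \<eta> j * \<omega> k) \<partial>\<mu>)"
    by (intro sum.cong refl Bochner_Integration.integral_sum int)
  also have "\<dots> = (\<Sum>i<n. \<Sum>k<n. \<Sum>j\<in>?J. coeff i j k * \<xi> i * \<eta> j * \<omega> k)"
    unfolding integral_mult_left_zero coeff_def by (simp only: mult.assoc)
  also have "\<dots> = (\<Sum>i<n. \<Sum>j\<in>?J. \<Sum>k<n. coeff i j k * \<xi> i * \<eta> j * \<omega> k)"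
    by (intro sum.cong[OF refl] sum.swap)
  finally show ?thesis by (rule sym)
qed

text \<open>By the triangle inequality in \<eta> a single j is enough. There the operator is rank
  one with unit vectors on both sides, and the value of Theta and its mean each pair to at most 1 on
  average.\<close>

lemma sum_coeff_le_2:
  assumes \<xi>: "\<And>i. i < n \<Longrightarrow> norm (\<xi> i) \<le> 1" and \<omega>: "\<And>k. k < n \<Longrightarrow> norm (\<omega> k) \<le> 1"
    and \<eta>: "(\<Sum>j<n * (d * d). norm (\<eta> j)) \<le> 1"
  shows "norm (\<Sum>i<n. \<Sum>j<n * (d * d). \<Sum>k<n. coeff i j k * \<xi> i * \<eta> j * \<omega> k) \<le> 2"
proof -
  let ?J = "{..<n * (d * d)}"
  let ?G = "\<lambda>j U. \<Sum>i<n. \<Sum>k<n. outer U k i * inner (\<lambda>q q'. Z1 q j * Z2 j q') U i k * \<xi> i * \<omega> k"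
  have le2: "norm (\<integral>U. ?G j U \<partial>\<mu>) \<le> 2"
    if j: "j < n * (d * d)" for j
  proof -
    define u where "u q = Z1 q j" for q
    define v where "v q = cnj (Z2 j q)" for q
    define p where "p U i = (\<Sum>x<n. A2 i x * twirl_vec u U x)" for U i
    define r where "r U k = (\<Sum>y<n. B1 y k * cnj (twirl_vec v U y))" for U k
    have bm: "bdd_meas (\<lambda>U. p U i)" "bdd_meas (\<lambda>U. r U k)" for i k
      unfolding p_def r_def by (intro bdd_meas_intros bdd_meas_twirl_vec)+
    have prod: "p U i * r U k = (\<Sum>x<n. \<Sum>y<n. A2 i x * B1 y k * (twirl_vec u U x * cnj (twirl_vec v U y)))" for U i k
      unfolding p_def r_def sum_product by (intro sum.cong refl) (simp add: mult_ac)
    have mean: "(\<integral>V. p V i * r V k \<partial>\<mu>) =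
      (\<Sum>x<n. \<Sum>y<n. A2 i x * B1 y k * (\<integral>V. twirl_vec u V x * cnj (twirl_vec v V y) \<partial>\<mu>))" for i k
      unfolding prod integral_mult_right_zero[symmetric]
      by (intro integral_double_sum bdd_meas_integrable bdd_meas_intros bdd_meas_twirl_vec)
    have inner: "inner (\<lambda>q q'. Z1 q j * Z2 j q') U i k = p U i * r U k - (\<integral>V. p V i * r V k \<partial>\<mu>)" for U i k
    proof -
      have "(\<lambda>q q'. Z1 q j * Z2 j q') = (\<lambda>q q'. u q * cnj (v q'))" by (simp add: u_def v_def)
      then have "inner (\<lambda>q q'. Z1 q j * Z2 j q') U i k = (\<Sum>x<n. \<Sum>y<n. A2 i x *
        (twirl_vec u U x * cnj (twirl_vec v U y) - (\<integral>V. twirl_vec u V x * cnj (twirl_vec v V y) \<partial>\<mu>)) * B1 y k)"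
        by (simp only: inner_def twirl_rank_one)
      also have "\<dots> = (\<Sum>x<n. \<Sum>y<n. A2 i x * B1 y k * (twirl_vec u U x * cnj (twirl_vec v U y)) -
         A2 i x * B1 y k * (\<integral>V. twirl_vec u V x * cnj (twirl_vec v V y) \<partial>\<mu>))"
        by (intro sum.cong refl) (simp add: algebra_simps)
      finally show ?thesis unfolding mean by (simp only: prod sum_subtractf)
    qed
    define N where "N U = ((\<Sum>i<n. (norm (p U i))\<^sup>2) + (\<Sum>k<n. (norm (r U k))\<^sup>2)) / 2" for U
    \<comment> \<open>The test unitary sits at U and the rank-one operator at an independent V. The
      diagonal \<open>H U U\<close> is the random term, the average over V is the mean term, and the
      same bound \<open>N V\<close> serves both.\<close>
    define H where "H U V = (\<Sum>i<n. \<Sum>k<n. outer U k i * (p V i * r V k) * \<xi> i * \<omega> k)" for U V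
    have H_le: "norm (H U V) \<le> N V" for U V
      unfolding H_def N_def by (rule unitary_fun_pairing_le[OF unitary_outer \<xi> \<omega>])
    have N_eq: "N U = ((\<Sum>x<n. (norm (twirl_vec u U x))\<^sup>2) + (\<Sum>y<n. (norm (twirl_vec v U y))\<^sup>2)) / 2" for U
      unfolding N_def p_def r_def unitary_fun_isometry[OF A2] unitary_fun_isometry[OF unitary_fun_transpose[OF B1]]
      by (simp only: complex_mod_cnj)
    have int_N: "integrable \<mu> N" unfolding N_def divide_inverse
      by (intro bdd_meas_integrable bdd_meas_intros bm)
    have uv: "(\<Sum>q\<in>?J. (norm (u q))\<^sup>2) = 1" "(\<Sum>q\<in>?J. (norm (v q))\<^sup>2) = 1"
    proof -
      have "complex_of_real (\<Sum>q\<in>?J. (norm (u q))\<^sup>2) = (\<Sum>q\<in>?J. cnj (Z1 q j) * Z1 q j)"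
        by (simp add: u_def complex_norm_square mult.commute del: of_real_power)
      also have "\<dots> = 1" using Z1 j by (simp add: unitary_fun_def)
      finally show "(\<Sum>q\<in>?J. (norm (u q))\<^sup>2) = 1" by (simp only: of_real_eq_1_iff)
      have "complex_of_real (\<Sum>q\<in>?J. (norm (v q))\<^sup>2) = (\<Sum>q\<in>?J. Z2 j q * cnj (Z2 j q))"
        by (simp add: v_def complex_norm_square mult.commute del: of_real_power)
      also have "\<dots> = 1" using Z2 j by (simp add: unitary_fun_def)
      finally show "(\<Sum>q\<in>?J. (norm (v q))\<^sup>2) = 1" by (simp only: of_real_eq_1_iff)
    qed
    have mean_N: "(\<integral>U. N U \<partial>\<mu>) = 1"
    proof -
      have i: "integrable \<mu> (\<lambda>U. \<Sum>x<n. (norm (twirl_vec f U x))\<^sup>2)" for f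
        by (intro bdd_meas_integrable bdd_meas_intros bdd_meas_twirl_vec)
      show ?thesis unfolding N_eq integral_divide_zero Bochner_Integration.integral_add[OF i i] integral_twirl_vec_sq uv by simp
    qed
    have int_H: "integrable \<mu> (\<lambda>V. H U V)" for U unfolding H_def
      by (intro bdd_meas_integrable bdd_meas_intros bm)
    have mean_H: "(\<integral>V. H U V \<partial>\<mu>) = (\<Sum>i<n. \<Sum>k<n. outer U k i * (\<integral>V. p V i * r V k \<partial>\<mu>) * \<xi> i * \<omega> k)" for U
    proof -
      have "(\<integral>V. H U V \<partial>\<mu>) = (\<Sum>i<n. \<Sum>k<n. \<integral>V. outer U k i * (p V i * r V k) * \<xi> i * \<omega> k \<partial>\<mu>)"
        unfolding H_def by (intro integral_double_sum bdd_meas_integrable bdd_meas_intros bm)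
      then show ?thesis by (simp only: integral_mult_left_zero integral_mult_right_zero)
    qed
    have G: "?G j U = H U U - (\<integral>V. H U V \<partial>\<mu>)" for U
      unfolding inner mean_H unfolding H_def by (simp only: right_diff_distrib left_diff_distrib sum_subtractf)
    have "norm (\<integral>U. H U U - (\<integral>V. H U V \<partial>\<mu>) \<partial>\<mu>) \<le> (\<integral>U. N U + 1 \<partial>\<mu>)"
    proof (rule norm_integral_le_integral)
      show "integrable \<mu> (\<lambda>U. H U U - (\<integral>V. H U V \<partial>\<mu>))" unfolding mean_H unfolding H_def
        by (intro bdd_meas_integrable bdd_meas_intros bm bdd_meas_outer)
      show "integrable \<mu> (\<lambda>U. N U + 1)"
        by (intro Bochner_Integration.integrable_add int_N bdd_meas_integrable bdd_meas_const)
      fix U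
      have "norm (\<integral>V. H U V \<partial>\<mu>) \<le> (\<integral>V. N V \<partial>\<mu>)"
        by (rule norm_integral_le_integral[OF int_H int_N]) (rule H_le)
      then show "norm (H U U - (\<integral>V. H U V \<partial>\<mu>)) \<le> N U + 1"
        using H_le[of U U] norm_triangle_ineq4[of "H U U" "\<integral>V. H U V \<partial>\<mu>"] unfolding mean_N by linarith
    qed
    also have "\<dots> = 2"
      using Bochner_Integration.integral_add[OF int_N bdd_meas_integrable[OF bdd_meas_const[of 1]]]
      by (simp add: mean_N measure_space_haar)
    finally show ?thesis unfolding G .
  qed
  have "(\<Sum>i<n. \<Sum>j\<in>?J. \<Sum>k<n. coeff i j k * \<xi> i * \<eta> j * \<omega> k) =
    (\<Sum>j\<in>?J. \<eta> j * (\<integral>U. ?G j U \<partial>\<mu>))"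
  proof -
    have "(\<integral>U. ?G j U \<partial>\<mu>) =
      (\<Sum>i<n. \<Sum>k<n. coeff i j k * \<xi> i * \<omega> k)" for j
    proof -
      have "(\<integral>U. ?G j U \<partial>\<mu>) =
        (\<Sum>i<n. \<Sum>k<n. \<integral>U. outer U k i * inner (\<lambda>q q'. Z1 q j * Z2 j q') U i k * \<xi> i * \<omega> k \<partial>\<mu>)"
        by (intro integral_double_sum bdd_meas_integrable bdd_meas_intros
            bdd_meas_outer bdd_meas_inner)
      then show ?thesis by (simp only: integral_mult_left_zero coeff_def)
    qed
    then have "(\<Sum>j\<in>?J. \<eta> j * (\<integral>U. ?G j U \<partial>\<mu>)) =
      (\<Sum>j\<in>?J. \<Sum>i<n. \<Sum>k<n. \<eta> j * (coeff i j k * \<xi> i * \<omega> k))"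
      by (simp only: sum_distrib_left)
    also have "\<dots> = (\<Sum>i<n. \<Sum>j\<in>?J. \<Sum>k<n. \<eta> j * (coeff i j k * \<xi> i * \<omega> k))" by (rule sum.swap)
    also have "\<dots> = (\<Sum>i<n. \<Sum>j\<in>?J. \<Sum>k<n. coeff i j k * \<xi> i * \<eta> j * \<omega> k)"
      by (intro sum.cong refl) (simp add: mult_ac)
    finally show ?thesis by (rule sym)
  qed
  also have "norm \<dots> \<le> (\<Sum>j\<in>?J. norm (\<eta> j) * 2)"
    by (rule sum_norm_le) (simp only: norm_mult, intro mult_left_mono le2, auto)
  also have "\<dots> \<le> 2" using \<eta> by (simp add: sum_distrib_right[symmetric])
  finally show ?thesis .
qed

text \<open>Pointwise the form is at most c / 2 + S / (2 c), and the variance bound makes the mean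
  of S at most 4 / 3. The resulting sum is least at c^2 = 4 / 3, where both halves equal c /
  2.\<close>

lemma sum_coeff_le_l4_l2_l4:
  assumes \<xi>: "(\<Sum>i<n. norm (\<xi> i) ^ 4) \<le> 1" and \<omega>: "(\<Sum>k<n. norm (\<omega> k) ^ 4) \<le> 1"
    and \<eta>: "(\<Sum>j<n * (d * d). (norm (\<eta> j))\<^sup>2) \<le> 1"
  shows "norm (\<Sum>i<n. \<Sum>j<n * (d * d). \<Sum>k<n. coeff i j k * \<xi> i * \<eta> j * \<omega> k) \<le> 2 / sqrt 3"
proof -
  define W where "W q q' = (\<Sum>j<n * (d * d). \<eta> j * (Z1 q j * Z2 j q'))" for q q'
  define c where "c = 2 / sqrt 3"
  have c: "0 < c" "c * c = 4 / 3" by (simp_all add: c_def)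
  define S where "S U = (\<Sum>x<n. \<Sum>y<n. (norm (twirl W U x y))\<^sup>2)" for U
  have int_S: "integrable \<mu> S" unfolding S_def
    by (intro bdd_meas_integrable bdd_meas_intros bdd_meas_twirl)
  have W_norm: "(\<Sum>q<n * (d * d). \<Sum>q'<n * (d * d). (norm (W q q'))\<^sup>2) = (\<Sum>j<n * (d * d). (norm (\<eta> j))\<^sup>2)"
  proof -
    \<comment> \<open>W is Z1 \<eta> Z2 with \<eta> as a diagonal matrix; in this shape unitary
      invariance of the Hilbert-Schmidt norm applies.\<close>
    have "W q q' = (\<Sum>x<n * (d * d). \<Sum>y<n * (d * d). Z1 q x * (if y = x then \<eta> x else 0) * Z2 y q')" for q q'
    proof -
      have "(\<Sum>y<n * (d * d). Z1 q x * (if y = x then \<eta> x else 0) * Z2 y q') = \<eta> x * (Z1 q x * Z2 x q')" if "x < n * (d * d)" for x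
      proof -
        have "(\<Sum>y<n * (d * d). Z1 q x * (if y = x then \<eta> x else 0) * Z2 y q') = (\<Sum>y<n * (d * d). if y = x then \<eta> x * (Z1 q x * Z2 x q') else 0)"
          by (intro sum.cong refl) simp
        then show ?thesis using that by simp
      qed
      then show ?thesis unfolding W_def by simp
    qed
    then have "(\<Sum>q<n * (d * d). \<Sum>q'<n * (d * d). (norm (W q q'))\<^sup>2) =
      (\<Sum>x<n * (d * d). \<Sum>y<n * (d * d). (norm (if y = x then \<eta> x else 0))\<^sup>2)"
      by (simp only: unitary_fun_frobenius[OF Z1 Z2])
    also have "\<dots> = (\<Sum>x<n * (d * d). \<Sum>y<n * (d * d). if y = x then (norm (\<eta> x))\<^sup>2 else 0)"
      by (intro sum.cong refl) simp
    finally show ?thesis by simp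
  qed
  have "norm (\<integral>U. (\<Sum>i<n. \<Sum>k<n. outer U k i * inner W U i k * \<xi> i * \<omega> k) \<partial>\<mu>) \<le> (\<integral>U. c / 2 + S U / (2 * c) \<partial>\<mu>)"
  proof (rule norm_integral_le_integral)
    show "integrable \<mu> (\<lambda>U. \<Sum>i<n. \<Sum>k<n. outer U k i * inner W U i k * \<xi> i * \<omega> k)"
      by (intro bdd_meas_integrable bdd_meas_intros bdd_meas_outer bdd_meas_inner)
    show "integrable \<mu> (\<lambda>U. c / 2 + S U / (2 * c))"
      by (intro Bochner_Integration.integrable_add bdd_meas_integrable[OF bdd_meas_const] integrable_divide int_S)
    fix U
    have "norm (\<Sum>i<n. \<Sum>k<n. outer U k i * inner W U i k * \<xi> i * \<omega> k) \<le> c / 2 + (\<Sum>i<n. \<Sum>k<n. (norm (inner W U i k))\<^sup>2) / (2 * c)"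
      by (rule unitary_fun_weighted_pairing_le[OF unitary_outer \<xi> \<omega> c(1)])
    also have "(\<Sum>i<n. \<Sum>k<n. (norm (inner W U i k))\<^sup>2) = S U"
      unfolding inner_def S_def by (rule unitary_fun_frobenius[OF A2 B1])
    finally show "norm (\<Sum>i<n. \<Sum>k<n. outer U k i * inner W U i k * \<xi> i * \<omega> k) \<le> c / 2 + S U / (2 * c)" .
  qed
  also have "\<dots> = c / 2 + (\<integral>U. S U \<partial>\<mu>) / (2 * c)"
    using Bochner_Integration.integral_add[OF bdd_meas_integrable[OF bdd_meas_const[of "c / 2"]] integrable_divide[OF int_S, of "2 * c"]]
    by (simp add: measure_space_haar)
  also have "(\<integral>U. S U \<partial>\<mu>) \<le> 4 / 3 * 1"
    using integral_twirl_sq_le[where n = n and W = W] \<eta> unfolding S_def W_norm by linarith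
  also have "c / 2 + (4 / 3 * 1) / (2 * c) = c" unfolding mult_1_right c(2)[symmetric] using c(1) by simp
  finally show ?thesis using c(1) unfolding sum_coeff W_def[symmetric] c_def[symmetric]
    by (simp add: divide_right_mono)
qed

end

section \<open>Normalized singular values and interpolation between the endpoints\<close>

lemma sum_swap_pairs:
  "(\<Sum>x\<in>A. \<Sum>y\<in>B. \<Sum>i\<in>I. \<Sum>k\<in>K. F x y i k) = (\<Sum>i\<in>I. \<Sum>k\<in>K. \<Sum>x\<in>A. \<Sum>y\<in>B. F x y i k)"
proof -
  have "(\<Sum>x\<in>A. \<Sum>y\<in>B. \<Sum>i\<in>I. \<Sum>k\<in>K. F x y i k) = (\<Sum>x\<in>A. \<Sum>i\<in>I. \<Sum>y\<in>B. \<Sum>k\<in>K. F x y i k)"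
    by (intro sum.cong[OF refl] sum.swap)
  also have "\<dots> = (\<Sum>i\<in>I. \<Sum>x\<in>A. \<Sum>y\<in>B. \<Sum>k\<in>K. F x y i k)" by (rule sum.swap)
  also have "\<dots> = (\<Sum>i\<in>I. \<Sum>x\<in>A. \<Sum>k\<in>K. \<Sum>y\<in>B. F x y i k)" by (intro sum.cong[OF refl] sum.swap)
  also have "\<dots> = (\<Sum>i\<in>I. \<Sum>k\<in>K. \<Sum>x\<in>A. \<Sum>y\<in>B. F x y i k)" by (intro sum.cong[OF refl] sum.swap)
  finally show ?thesis .
qed

text \<open>The first claim is an inequality in order to include N = 0: then every
  \<open>x i\<close> vanishes, division by 0 gives 0, and both claims survive.\<close>

lemma normalize_powr_sum:
  fixes x :: "'i \<Rightarrow> real"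
  assumes "finite I" "0 < p" and nn: "\<And>i. i \<in> I \<Longrightarrow> 0 \<le> x i"
  defines "N \<equiv> (\<Sum>i\<in>I. x i powr p) powr (1 / p)"
  shows "(\<Sum>i\<in>I. (x i / N) powr p) \<le> 1" "\<And>i. i \<in> I \<Longrightarrow> x i = N * (x i / N)"
proof -
  define S where "S = (\<Sum>i\<in>I. x i powr p)"
  have S0: "0 \<le> S" unfolding S_def by (intro sum_nonneg) simp
  have "(\<Sum>i\<in>I. (x i / N) powr p) \<le> 1 \<and> (\<forall>i\<in>I. x i = N * (x i / N))"
  proof (cases "S = 0")
    case True
    then have "\<And>i. i \<in> I \<Longrightarrow> x i = 0" using assms(1) by (simp add: S_def sum_nonneg_eq_0_iff)
    then show ?thesis by simp
  next
    case False
    then have S: "0 < S" using S0 by simp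
    have N: "0 < N" "N powr p = S" using S \<open>0 < p\<close> by (simp_all add: N_def S_def[symmetric] powr_powr)
    have "(\<Sum>i\<in>I. (x i / N) powr p) = (\<Sum>i\<in>I. x i powr p / S)"
      using N nn by (intro sum.cong refl) (simp add: powr_divide)
    also have "\<dots> = 1" using S by (simp add: sum_divide_distrib[symmetric] S_def[symmetric])
    finally show ?thesis using N by simp
  qed
  then show "(\<Sum>i\<in>I. (x i / N) powr p) \<le> 1" "\<And>i. i \<in> I \<Longrightarrow> x i = N * (x i / N)" by blast+
qed

lemma obtain_svd_normalized:
  assumes M: "M \<in> carrier_mat n n" and \<alpha>: "0 < \<alpha>"
  obtains P Q s where "unitary_fun n P" "unitary_fun n Q" "\<And>k. k < n \<Longrightarrow> 0 \<le> s k"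
    "\<And>i j. i < n \<Longrightarrow> j < n \<Longrightarrow> M $$ (i,j) = (\<Sum>k<n. P i k * of_real (schatten (ereal \<alpha>) M * s k) * Q k j)"
    "(\<Sum>k<n. s k powr \<alpha>) \<le> 1" "0 \<le> schatten (ereal \<alpha>) M"
proof (rule obtain_svd[OF M])
  fix P Q s assume 1: "unitary_fun n P" "unitary_fun n Q" "\<And>k. k < n \<Longrightarrow> 0 \<le> s k"
    "\<And>i j. i < n \<Longrightarrow> j < n \<Longrightarrow> M $$ (i,j) = (\<Sum>k<n. P i k * of_real (s k) * Q k j)"
    "\<And>p. schatten (ereal p) M = (\<Sum>k<n. s k powr p) powr (1 / p)"
  define N where "N = schatten (ereal \<alpha>) M"
  have N: "N = (\<Sum>k<n. s k powr \<alpha>) powr (1 / \<alpha>)" unfolding N_def by (rule 1(5))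
  then have N0: "0 \<le> N" by simp
  note norm = normalize_powr_sum[of "{..<n}" \<alpha> s, folded N]
  show thesis
  proof (rule that[of P Q "\<lambda>k. s k / N"])
    show "0 \<le> s k / N" if "k < n" for k using 1(3)[OF that] N0 by simp
    show "(\<Sum>k<n. (s k / N) powr \<alpha>) \<le> 1" using norm(1) \<alpha> 1(3) by auto
    show "M $$ (i,j) = (\<Sum>k<n. P i k * of_real (schatten (ereal \<alpha>) M * (s k / N)) * Q k j)" if "i < n" "j < n" for i j
    proof -
      have "s k = N * (s k / N)" if "k < n" for k using norm(2)[of k] \<alpha> 1(3) that by auto
      then have "(\<Sum>k<n. P i k * of_real (s k) * Q k j) = (\<Sum>k<n. P i k * of_real (N * (s k / N)) * Q k j)"
        by (intro sum.cong refl arg_cong2[where f = "(*)"] arg_cong[where f = of_real]) simp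
      then show ?thesis unfolding 1(4)[OF that] N_def .
    qed
  qed (use 1 N0 in \<open>simp_all add: N_def\<close>)
qed

text \<open>At \<alpha> = 1 the exponent 2 \<alpha>' is \<infinity> and normalization bounds the
  largest singular value; for larger \<alpha> it bounds a power sum. Stating both as implications
  postpones the case split to the interpolation.\<close>

lemma obtain_svd_normalized_conj:
  assumes M: "M \<in> carrier_mat n n" and \<alpha>: "1 \<le> \<alpha>"
  defines "N \<equiv> schatten (2 * conj_exp \<alpha>) M"
  obtains P Q s where "unitary_fun n P" "unitary_fun n Q" "\<And>k. k < n \<Longrightarrow> 0 \<le> s k"
    "\<And>i j. i < n \<Longrightarrow> j < n \<Longrightarrow> M $$ (i,j) = (\<Sum>k<n. P i k * of_real (N * s k) * Q k j)"
    "\<alpha> = 1 \<Longrightarrow> (\<forall>k<n. s k \<le> 1)" "1 < \<alpha> \<Longrightarrow> (\<Sum>k<n. s k powr (2 * \<alpha> / (\<alpha> - 1))) \<le> 1" "0 \<le> N"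
proof (cases "\<alpha> = 1")
  case True
  show thesis
  proof (rule obtain_svd[OF M])
    fix P Q s assume 1: "unitary_fun n P" "unitary_fun n Q" "\<And>k. k < n \<Longrightarrow> 0 \<le> s k"
      "\<And>i j. i < n \<Longrightarrow> j < n \<Longrightarrow> M $$ (i,j) = (\<Sum>k<n. P i k * of_real (s k) * Q k j)"
      "schatten \<infinity> M = Max (insert 0 (s ` {..<n}))"
    have N: "N = Max (insert 0 (s ` {..<n}))" unfolding N_def using True 1(5) by (simp add: conj_exp_def)
    have N0: "0 \<le> N" unfolding N by simp
    have sN: "s k \<le> N" if "k < n" for k unfolding N using that by simp
    have le: "s k / N \<le> 1" if "k < n" for k
      using sN[OF that] N0 by (cases "N = 0") (simp_all add: divide_le_eq)
    have eq: "s k = N * (s k / N)" if "k < n" for k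
      using sN[OF that] 1(3)[OF that] by (cases "N = 0") simp_all
    show thesis
    proof (rule that[of P Q "\<lambda>k. s k / N"])
      show "0 \<le> s k / N" if "k < n" for k using 1(3)[OF that] N0 by simp
      show "M $$ (i,j) = (\<Sum>k<n. P i k * of_real (N * (s k / N)) * Q k j)" if "i < n" "j < n" for i j
      proof -
        have "(\<Sum>k<n. P i k * of_real (s k) * Q k j) = (\<Sum>k<n. P i k * of_real (N * (s k / N)) * Q k j)"
          by (intro sum.cong refl arg_cong2[where f = "(*)"] arg_cong[where f = of_real]) (use eq in simp)
        then show ?thesis unfolding 1(4)[OF that] .
      qed
    qed (use 1 N0 le True in auto)
  qed
next
  case False
  then have p: "0 < 2 * \<alpha> / (\<alpha> - 1)" "1 < \<alpha>" using \<alpha> by simp_all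
  have N: "schatten (ereal (2 * \<alpha> / (\<alpha> - 1))) M = N" unfolding N_def using False by (simp add: conj_exp_def)
  show thesis
  proof (rule obtain_svd_normalized[OF M p(1), unfolded N])
    fix P Q s assume 1: "unitary_fun n P" "unitary_fun n Q" "\<And>k. k < n \<Longrightarrow> 0 \<le> s k"
      "\<And>i j. i < n \<Longrightarrow> j < n \<Longrightarrow> M $$ (i,j) = (\<Sum>k<n. P i k * of_real (N * s k) * Q k j)"
      "(\<Sum>k<n. s k powr (2 * \<alpha> / (\<alpha> - 1))) \<le> 1" "0 \<le> N"
    show thesis by (rule that[OF 1(1-4)]) (use 1(5,6) False in auto)
  qed
qed

lemma (in twirl_trilinear) sum_coeff_le_interpolated:
  assumes \<alpha>: "1 \<le> \<alpha>" "\<alpha> \<le> 2"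
    and nn: "\<And>i. i < n \<Longrightarrow> 0 \<le> x i" "\<And>j. j < n * (d * d) \<Longrightarrow> 0 \<le> y j" "\<And>k. k < n \<Longrightarrow> 0 \<le> w k"
    and x: "\<alpha> = 1 \<Longrightarrow> (\<forall>k<n. x k \<le> 1)" "1 < \<alpha> \<Longrightarrow> (\<Sum>k<n. x k powr (2 * \<alpha> / (\<alpha> - 1))) \<le> 1"
    and w: "\<alpha> = 1 \<Longrightarrow> (\<forall>k<n. w k \<le> 1)" "1 < \<alpha> \<Longrightarrow> (\<Sum>k<n. w k powr (2 * \<alpha> / (\<alpha> - 1))) \<le> 1"
    and y: "(\<Sum>j<n * (d * d). y j powr \<alpha>) \<le> 1"
  shows "norm (\<Sum>i<n. \<Sum>j<n * (d * d). \<Sum>k<n. coeff i j k * of_real (x i) * of_real (y j) * of_real (w k))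
    \<le> 2 * 3 powr ((1 - \<alpha>) / \<alpha>)"
proof (cases "\<alpha> = 1")
  \<comment> \<open>Interpolation asks for \<theta> > 0, so \<alpha> = 1 is taken from the first
    endpoint directly.\<close>
  case True
  have "(\<Sum>j<n * (d * d). norm (complex_of_real (y j))) = (\<Sum>j<n * (d * d). y j powr 1)"
    using nn(2) by (intro sum.cong refl) simp
  then have y1: "(\<Sum>j<n * (d * d). norm (complex_of_real (y j))) \<le> 1" using y True by simp
  have "norm (\<Sum>i<n. \<Sum>j<n * (d * d). \<Sum>k<n. coeff i j k * of_real (x i) * of_real (y j) * of_real (w k)) \<le> 2"
    by (rule sum_coeff_le_2[OF _ _ y1]) (use nn x(1)[OF True] w(1)[OF True] in auto)
  then show ?thesis using True by simp
next
  case False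
  then have a: "1 < \<alpha>" using \<alpha> by simp
  \<comment> \<open>The solution of 1 - \<theta> / 2 = 1 / \<alpha>; it also satisfies 4 / \<theta>
    = 2 \<alpha> / (\<alpha> - 1), so one parameter matches all three exponents.\<close>
  define \<theta> where "\<theta> = 2 * (\<alpha> - 1) / \<alpha>"
  have \<theta>: "0 < \<theta>" "\<theta> \<le> 1" using a \<alpha> by (simp_all add: \<theta>_def field_simps)
  have e: "4 / \<theta> = 2 * \<alpha> / (\<alpha> - 1)" "1 / (1 - \<theta> / 2) = \<alpha>" using a by (simp_all add: \<theta>_def field_simps)
  have "norm (\<Sum>i<n. \<Sum>j<n * (d * d). \<Sum>k<n. coeff i j k * of_real (x i) * of_real (y j) * of_real (w k))
    \<le> 2 powr (1 - \<theta>) * (2 / sqrt 3) powr \<theta>"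
  proof (rule trilinear_riesz_thorin[OF _ _ _ _ _ _ _ \<theta>])
    show "norm (\<Sum>i<n. \<Sum>j<n * (d * d). \<Sum>k<n. coeff i j k * \<xi> i * \<eta> j * \<omega> k) \<le> 2"
      if "\<And>i. i \<in> {..<n} \<Longrightarrow> norm (\<xi> i) \<le> 1" "(\<Sum>j<n * (d * d). norm (\<eta> j)) \<le> 1" "\<And>k. k \<in> {..<n} \<Longrightarrow> norm (\<omega> k) \<le> 1"
      for \<xi> \<eta> \<omega>
      by (rule sum_coeff_le_2) (use that in auto)
    show "norm (\<Sum>i<n. \<Sum>j<n * (d * d). \<Sum>k<n. coeff i j k * \<xi> i * \<eta> j * \<omega> k) \<le> 2 / sqrt 3"
      if "(\<Sum>i<n. norm (\<xi> i) ^ 4) \<le> 1" "(\<Sum>j<n * (d * d). norm (\<eta> j) ^ 2) \<le> 1" "(\<Sum>k<n. norm (\<omega> k) ^ 4) \<le> 1"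
      for \<xi> \<eta> \<omega>
      by (rule sum_coeff_le_l4_l2_l4[OF that(1,3,2)])
  qed (use nn x(2)[OF a] w(2)[OF a] y in \<open>simp_all add: e\<close>)
  \<comment> \<open>The powers of 2 recombine to 2, and sqrt 3 contributes 3^(- \<theta> /
    2).\<close>
  also have "2 powr (1 - \<theta>) * (2 / sqrt 3) powr \<theta> = 2 * 3 powr ((1 - \<alpha>) / \<alpha>)"
  proof -
    have "(2 / sqrt 3) powr \<theta> = 2 powr \<theta> / 3 powr (\<theta> / 2)"
      by (simp add: powr_divide powr_half_sqrt[symmetric] powr_powr)
    moreover have "2 powr (1 - \<theta>) * 2 powr \<theta> = (2::real)" by (simp add: powr_add[symmetric])
    moreover have "(1 - \<alpha>) / \<alpha> = - (\<theta> / 2)" using a by (simp add: \<theta>_def field_simps)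
    ultimately show ?thesis by (simp add: powr_minus_divide)
  qed
  finally show ?thesis .
qed

section \<open>Passing between matrices and the trilinear form\<close>

lemma sandwich_kron_one_index:
  assumes a: "a \<in> carrier_mat n n" and b: "b \<in> carrier_mat n n" and Z: "Z \<in> carrier_mat (n * D) (n * D)"
    and lt: "x < n" "y < n" "m < D" "m' < D"
  shows "(kron a (1\<^sub>m D) * Z * kron b (1\<^sub>m D)) $$ (x * D + m, y * D + m') =
    (\<Sum>x'<n. \<Sum>y'<n. a $$ (x,x') * Z $$ (x' * D + m, y' * D + m') * b $$ (y',y))"
proof -
  have c: "kron a (1\<^sub>m D) \<in> carrier_mat (n * D) (n * D)" "kron b (1\<^sub>m D) \<in> carrier_mat (n * D) (n * D)"
    using kron_carrier[OF a one_carrier_mat[of D]] kron_carrier[OF b one_carrier_mat[of D]] by simp_all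
  have left: "(kron a (1\<^sub>m D) * Z) $$ (x * D + m, q) = (\<Sum>x'<n. a $$ (x,x') * Z $$ (x' * D + m, q))" if "q < n * D" for q
  proof -
    have "(kron a (1\<^sub>m D) * Z) $$ (x * D + m, q) = (\<Sum>l<n * D. kron a (1\<^sub>m D) $$ (x * D + m, l) * Z $$ (l, q))"
      by (rule mult_mat_index_sum[OF c(1) Z block_index_less[OF lt(1,3)] that])
    also have "\<dots> = (\<Sum>x'<n. \<Sum>p<D. if p = m then a $$ (x,x') * Z $$ (x' * D + m, q) else 0)"
      unfolding sum_lessThan_mult
      using lt by (intro sum.cong refl) (auto simp: kron_index[OF a one_carrier_mat])
    finally show ?thesis using lt by simp
  qed
  have "(kron a (1\<^sub>m D) * Z * kron b (1\<^sub>m D)) $$ (x * D + m, y * D + m') =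
    (\<Sum>l<n * D. (kron a (1\<^sub>m D) * Z) $$ (x * D + m, l) * kron b (1\<^sub>m D) $$ (l, y * D + m'))"
    by (rule mult_mat_index_sum[OF mult_carrier_mat[OF c(1) Z] c(2) block_index_less[OF lt(1,3)] block_index_less[OF lt(2,4)]])
  also have "\<dots> = (\<Sum>y'<n. \<Sum>p<D. if p = m' then (\<Sum>x'<n. a $$ (x,x') * Z $$ (x' * D + m, y' * D + m')) * b $$ (y',y) else 0)"
    unfolding sum_lessThan_mult
    using lt by (intro sum.cong refl)
      (auto simp: kron_index[OF b one_carrier_mat] left block_index_less simp del: index_mult_mat)
  also have "\<dots> = (\<Sum>y'<n. \<Sum>x'<n. a $$ (x,x') * Z $$ (x' * D + m, y' * D + m') * b $$ (y',y))"
    using lt by (simp add: sum_distrib_right)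
  also have "\<dots> = (\<Sum>x'<n. \<Sum>y'<n. a $$ (x,x') * Z $$ (x' * D + m, y' * D + m') * b $$ (y',y))" by (rule sum.swap)
  finally show ?thesis .
qed

text \<open>\<open>twirl\<close> acts on the A A' part of the index only, so multiplications on C E
  pass through it. As x and y are fixed, only one row of the left factor and one column of the right
  factor occur.\<close>

lemma (in haar_measure) twirl_sandwich:
  assumes Y: "\<And>m m'. m < d * d \<Longrightarrow> m' < d * d \<Longrightarrow> Y (x * (d * d) + m) (y * (d * d) + m') =
    (\<Sum>x'<n. \<Sum>y'<n. a x' * Z (x' * (d * d) + m) (y' * (d * d) + m') * b y')"
  shows "twirl Y U x y = (\<Sum>x'<n. \<Sum>y'<n. a x' * twirl Z U x' y' * b y')"
proof -
  \<comment> \<open>Moving a block to position (0, 0) makes the block index part of the operator, so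
    that linearity in the operator applies to the sum over pairs of blocks.\<close>
  have shift: "twirl W U x y = twirl (\<lambda>m m'. W (x * (d * d) + m) (y * (d * d) + m')) U 0 0" for W x y
    by (simp add: twirl_def)
  have Yp: "Y (x * (d * d) + m) (y * (d * d) + m') = (\<Sum>p\<in>{..<n} \<times> {..<n}. (a (fst p) * b (snd p)) *
      Z (fst p * (d * d) + m) (snd p * (d * d) + m'))" if "m < d * d" "m' < d * d" for m m'
    unfolding Y[OF that] sum.cartesian_product case_prod_beta by (intro sum.cong refl) (simp only: mult_ac)
  have "twirl Y U x y = twirl (\<lambda>m m'. \<Sum>p\<in>{..<n} \<times> {..<n}. (a (fst p) * b (snd p)) *
      Z (fst p * (d * d) + m) (snd p * (d * d) + m')) U 0 0"
    unfolding shift[of Y]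
    unfolding twirl_def by (intro arg_cong2[where f = "(-)"] sum.cong refl arg_cong2[where f = "(*)"])
      (simp_all only: Yp lessThan_iff add_0 mult_zero_left)
  also have "\<dots> = (\<Sum>p\<in>{..<n} \<times> {..<n}. (a (fst p) * b (snd p)) * twirl Z U (fst p) (snd p))"
    unfolding twirl_linear shift[of Z, symmetric] ..
  finally show ?thesis by (simp add: sum.cartesian_product case_prod_beta mult_ac)
qed

context twirl_trilinear
begin

lemma trace_twirl_eq:
  assumes a: "\<And>x x'. x < n \<Longrightarrow> x' < n \<Longrightarrow> a x x' = (\<Sum>i<n. A1 x i * \<xi> i * A2 i x')"
    and b: "\<And>y y'. y < n \<Longrightarrow> y' < n \<Longrightarrow> b y' y = (\<Sum>k<n. B1 y' k * \<omega> k * B2 k y)"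
    and t: "\<And>x y. x < n \<Longrightarrow> y < n \<Longrightarrow> t x y = (\<Sum>x'<n. \<Sum>y'<n. a x x' * twirl Z U x' y' * b y' y)"
  shows "(\<Sum>x<n. \<Sum>y<n. X U y x * t x y) = (\<Sum>i<n. \<Sum>k<n. outer U k i * inner Z U i k * \<xi> i * \<omega> k)"
proof -
  have "(\<Sum>x<n. \<Sum>y<n. X U y x * t x y) =
    (\<Sum>x<n. \<Sum>y<n. \<Sum>i<n. \<Sum>k<n. (B2 k y * (X U y x * A1 x i)) * (inner Z U i k * \<xi> i * \<omega> k))"
  proof (intro sum.cong refl)
    fix x y assume "x \<in> {..<n}" "y \<in> {..<n}"
    then have xy: "x < n" "y < n" by auto
    have "t x y = (\<Sum>x'<n. \<Sum>y'<n. \<Sum>i<n. \<Sum>k<n. (A1 x i * \<xi> i * A2 i x') * twirl Z U x' y' * (B1 y' k * \<omega> k * B2 k y))"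
      unfolding t[OF xy]
    proof (intro sum.cong refl)
      fix x' y' assume "x' \<in> {..<n}" "y' \<in> {..<n}"
      then have "a x x' * twirl Z U x' y' * b y' y =
        (\<Sum>i<n. A1 x i * \<xi> i * A2 i x' * twirl Z U x' y') * (\<Sum>k<n. B1 y' k * \<omega> k * B2 k y)"
        using xy by (simp only: a b lessThan_iff sum_distrib_right)
      then show "a x x' * twirl Z U x' y' * b y' y =
        (\<Sum>i<n. \<Sum>k<n. (A1 x i * \<xi> i * A2 i x') * twirl Z U x' y' * (B1 y' k * \<omega> k * B2 k y))"
        by (simp only: sum_product)
    qed
    also have "\<dots> = (\<Sum>i<n. \<Sum>k<n. \<Sum>x'<n. \<Sum>y'<n. (A1 x i * \<xi> i * A2 i x') * twirl Z U x' y' * (B1 y' k * \<omega> k * B2 k y))"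
      by (rule sum_swap_pairs)
    also have "\<dots> = (\<Sum>i<n. \<Sum>k<n. (B2 k y * A1 x i) * (inner Z U i k * \<xi> i * \<omega> k))"
      unfolding inner_def sum_distrib_left sum_distrib_right by (intro sum.cong refl) (simp add: mult_ac)
    finally have "t x y = (\<Sum>i<n. \<Sum>k<n. (B2 k y * A1 x i) * (inner Z U i k * \<xi> i * \<omega> k))" .
    then show "X U y x * t x y = (\<Sum>i<n. \<Sum>k<n. (B2 k y * (X U y x * A1 x i)) * (inner Z U i k * \<xi> i * \<omega> k))"
      by (simp only: sum_distrib_left) (intro sum.cong refl, simp add: mult_ac)
  qed
  also have "\<dots> = (\<Sum>i<n. \<Sum>k<n. \<Sum>x<n. \<Sum>y<n. (B2 k y * (X U y x * A1 x i)) * (inner Z U i k * \<xi> i * \<omega> k))"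
    by (rule sum_swap_pairs)
  also have "\<dots> = (\<Sum>i<n. \<Sum>k<n. outer U k i * (inner Z U i k * \<xi> i * \<omega> k))"
    unfolding outer_def sum_distrib_left sum_distrib_right by (intro sum.cong[OF refl] sum.swap)
  finally show ?thesis by (simp only: mult.assoc)
qed

end

context haar_measure
begin

text \<open>The interpolated bound concerns unit balls, so the three Schatten norms are first pulled
  out of the singular values and restored at the end by homogeneity of the trilinear form.\<close>

lemma trace_pairing_le:
  fixes n :: nat and X :: "(nat \<times> nat \<Rightarrow> complex) \<Rightarrow> nat \<Rightarrow> nat \<Rightarrow> complex"
  assumes X: "\<And>U. unitary_fun n (X U)" "\<And>i j. (\<lambda>U. X U i j) \<in> borel_measurable \<mu>"
    and a: "a \<in> carrier_mat n n" and b: "b \<in> carrier_mat n n" and Z: "Z \<in> carrier_mat (n * (d * d)) (n * (d * d))"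
    and \<alpha>: "1 \<le> \<alpha>" "\<alpha> \<le> 2"
    and Y: "Y = kron a (1\<^sub>m (d * d)) * Z * kron b (1\<^sub>m (d * d))"
  shows "norm (\<integral>U. (\<Sum>x<n. \<Sum>y<n. X U y x * twirl (\<lambda>q q'. Y $$ (q,q')) U x y) \<partial>\<mu>)
    \<le> 2 * 3 powr ((1 - \<alpha>) / \<alpha>) * (schatten (2 * conj_exp \<alpha>) a * schatten (ereal \<alpha>) Z * schatten (2 * conj_exp \<alpha>) b)"
    (is "norm (\<integral>U. ?tr U \<partial>\<mu>) \<le> _")
proof -
  define Na where "Na = schatten (2 * conj_exp \<alpha>) a"
  define Nb where "Nb = schatten (2 * conj_exp \<alpha>) b"
  define NZ where "NZ = schatten (ereal \<alpha>) Z"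
  have "0 < \<alpha>" using \<alpha> by simp
  obtain A1 A2 xs where A: "unitary_fun n A1" "unitary_fun n A2" "\<And>k. k < n \<Longrightarrow> 0 \<le> xs k"
    "\<And>i j. i < n \<Longrightarrow> j < n \<Longrightarrow> a $$ (i,j) = (\<Sum>k<n. A1 i k * of_real (Na * xs k) * A2 k j)"
    "\<alpha> = 1 \<Longrightarrow> (\<forall>k<n. xs k \<le> 1)" "1 < \<alpha> \<Longrightarrow> (\<Sum>k<n. xs k powr (2 * \<alpha> / (\<alpha> - 1))) \<le> 1" "0 \<le> Na"
    by (rule obtain_svd_normalized_conj[OF a \<alpha>(1), folded Na_def]) blast
  obtain B1 B2 ws where B: "unitary_fun n B1" "unitary_fun n B2" "\<And>k. k < n \<Longrightarrow> 0 \<le> ws k"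
    "\<And>i j. i < n \<Longrightarrow> j < n \<Longrightarrow> b $$ (i,j) = (\<Sum>k<n. B1 i k * of_real (Nb * ws k) * B2 k j)"
    "\<alpha> = 1 \<Longrightarrow> (\<forall>k<n. ws k \<le> 1)" "1 < \<alpha> \<Longrightarrow> (\<Sum>k<n. ws k powr (2 * \<alpha> / (\<alpha> - 1))) \<le> 1" "0 \<le> Nb"
    by (rule obtain_svd_normalized_conj[OF b \<alpha>(1), folded Nb_def]) blast
  obtain Z1 Z2 ys where ZZ: "unitary_fun (n * (d * d)) Z1" "unitary_fun (n * (d * d)) Z2" "\<And>k. k < n * (d * d) \<Longrightarrow> 0 \<le> ys k"
    "\<And>i j. i < n * (d * d) \<Longrightarrow> j < n * (d * d) \<Longrightarrow> Z $$ (i,j) = (\<Sum>k<n * (d * d). Z1 i k * of_real (NZ * ys k) * Z2 k j)"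
    "(\<Sum>k<n * (d * d). ys k powr \<alpha>) \<le> 1" "0 \<le> NZ"
    by (rule obtain_svd_normalized[OF Z \<open>0 < \<alpha>\<close>, folded NZ_def]) blast
  interpret twirl_trilinear d \<mu> n X A1 A2 B1 B2 Z1 Z2
    by unfold_locales (rule X A(1,2) B(1,2) ZZ(1,2))+
  let ?c = "\<Sum>i<n. \<Sum>j<n * (d * d). \<Sum>k<n. coeff i j k * of_real (xs i) * of_real (ys j) * of_real (ws k)"
  define Zf where "Zf q q' = (\<Sum>j<n * (d * d). of_real (NZ * ys j) * (Z1 q j * Z2 j q'))" for q q'
  have Zf: "Z $$ (q,q') = Zf q q'" if "q < n * (d * d)" "q' < n * (d * d)" for q q'
    unfolding ZZ(4)[OF that] Zf_def by (intro sum.cong refl) (simp add: mult_ac)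
  have tw: "twirl (\<lambda>q q'. Y $$ (q,q')) U x y = (\<Sum>x'<n. \<Sum>y'<n. a $$ (x,x') * twirl Zf U x' y' * b $$ (y',y))"
    if "x < n" "y < n" for U x y
  proof (rule twirl_sandwich)
    fix m m' assume mm: "m < d * d" "m' < d * d"
    show "Y $$ (x * (d * d) + m, y * (d * d) + m') =
      (\<Sum>x'<n. \<Sum>y'<n. a $$ (x,x') * Zf (x' * (d * d) + m) (y' * (d * d) + m') * b $$ (y',y))"
      unfolding Y sandwich_kron_one_index[OF a b Z that mm]
      using mm by (intro sum.cong refl) (simp add: Zf block_index_less)
  qed
  have "?tr U =
    (\<Sum>i<n. \<Sum>k<n. outer U k i * inner Zf U i k * of_real (Na * xs i) * of_real (Nb * ws k))" for U
    by (rule trace_twirl_eq[OF A(4) B(4) tw])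
  then have "(\<integral>U. ?tr U \<partial>\<mu>) =
    (\<Sum>i<n. \<Sum>j<n * (d * d). \<Sum>k<n. coeff i j k * of_real (Na * xs i) * of_real (NZ * ys j) * of_real (Nb * ws k))"
    unfolding sum_coeff Zf_def[symmetric] by (simp only:)
  also have "\<dots> = of_real (Na * NZ * Nb) *
    ?c"
    unfolding sum_distrib_left by (intro sum.cong refl) (simp add: mult_ac)
  finally have "norm (\<integral>U. ?tr U \<partial>\<mu>) = Na * NZ * Nb *
      norm ?c"
    using A(7) B(7) ZZ(6) by (simp only: norm_mult norm_of_real abs_of_nonneg mult_nonneg_nonneg)
  moreover have "norm ?c
      \<le> 2 * 3 powr ((1 - \<alpha>) / \<alpha>)"
    by (rule sum_coeff_le_interpolated[OF \<alpha> A(3) ZZ(3) B(3) A(5,6) B(5,6) ZZ(5)])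
  then have "Na * NZ * Nb * norm ?c
      \<le> Na * NZ * Nb * (2 * 3 powr ((1 - \<alpha>) / \<alpha>))"
    using A(7) B(7) ZZ(6) by (intro mult_left_mono mult_nonneg_nonneg)
  ultimately have "norm (\<integral>U. ?tr U \<partial>\<mu>)
      \<le> Na * NZ * Nb * (2 * 3 powr ((1 - \<alpha>) / \<alpha>))" by (simp only:)
  then show ?thesis unfolding Na_def Nb_def NZ_def by (simp only: mult_ac)
qed

section \<open>The expected trace norm and the infimum over factorizations\<close>

lemma Theta_minus_haar_mean:
  assumes Y: "Y \<in> carrier_mat (dC * dE * (d * d)) (dC * dE * (d * d))"
  shows "Theta dC dE d Y (Matrix.mat d d U) - haar_mean d \<mu> (dC * dE) (Theta dC dE d Y) =
    Matrix.mat (dC * dE) (dC * dE) (\<lambda>(x,y). twirl (\<lambda>q q'. Y $$ (q,q')) U x y)"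
proof (rule eq_matI)
  fix x y assume "x < dim_row (Matrix.mat (dC * dE) (dC * dE) (\<lambda>(x,y). twirl (\<lambda>q q'. Y $$ (q,q')) U x y))"
    "y < dim_col (Matrix.mat (dC * dE) (dC * dE) (\<lambda>(x,y). twirl (\<lambda>q q'. Y $$ (q,q')) U x y))"
  then have xy: "x < dC * dE" "y < dC * dE" by auto
  have "haar_mean d \<mu> (dC * dE) (Theta dC dE d Y) $$ (x,y) = (\<Sum>m<d * d. Y $$ (x * (d * d) + m, y * (d * d) + m))"
    using xy by (simp add: haar_mean_def Theta_index[OF Y] integral_twirl_form[of "\<lambda>m m'. Y $$ (x * (d * d) + m, y * (d * d) + m')"])
  then show "(Theta dC dE d Y (Matrix.mat d d U) - haar_mean d \<mu> (dC * dE) (Theta dC dE d Y)) $$ (x,y) =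
    Matrix.mat (dC * dE) (dC * dE) (\<lambda>(x,y). twirl (\<lambda>q q'. Y $$ (q,q')) U x y) $$ (x,y)"
    using xy by (subst index_minus_mat) (simp_all add: haar_mean_def Theta_index[OF Y] twirl_def)
qed (simp_all add: haar_mean_def)

text \<open>The measurable test unitaries are only almost optimal, so the bound is proved up to an
  arbitrary \<epsilon>. Pointwise the trace norm lies below the real part of an integrable pairing
  plus \<epsilon>.\<close>

lemma integral_trace_norm_le:
  assumes Y: "Y \<in> carrier_mat (dC * dE * (d * d)) (dC * dE * (d * d))" and \<alpha>: "1 \<le> \<alpha>" "\<alpha> \<le> 2"
    and a: "a \<in> carrier_mat (dC * dE) (dC * dE)" and b: "b \<in> carrier_mat (dC * dE) (dC * dE)"
    and Z: "Z \<in> carrier_mat (dC * dE * (d * d)) (dC * dE * (d * d))"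
    and Yeq: "Y = kron a (1\<^sub>m (d * d)) * Z * kron b (1\<^sub>m (d * d))"
  shows "(\<integral>U. trace_norm (Theta dC dE d Y (Matrix.mat d d U) - haar_mean d \<mu> (dC * dE) (Theta dC dE d Y)) \<partial>\<mu>)
    \<le> 2 * 3 powr ((1 - \<alpha>) / \<alpha>) * (schatten (2 * conj_exp \<alpha>) a * schatten (ereal \<alpha>) Z * schatten (2 * conj_exp \<alpha>) b)"
    (is "(\<integral>U. ?N U \<partial>\<mu>) \<le> ?R")
proof (rule field_le_epsilon)
  fix \<epsilon> :: real assume \<epsilon>: "0 < \<epsilon>"
  define n where "n = dC * dE"
  let ?T = "\<lambda>U x y. twirl (\<lambda>q q'. Y $$ (q,q')) U x y"
  have T_meas: "(\<lambda>U. ?T U i j) \<in> borel_measurable \<mu>" for i j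
    using bdd_meas_twirl unfolding bdd_meas_def by blast
  show "(\<integral>U. ?N U \<partial>\<mu>) \<le> ?R + \<epsilon>"
  proof (rule ex_measurable_almost_optimal_unitary[of n ?T \<mu> \<epsilon>])
    fix X :: "(nat \<times> nat \<Rightarrow> complex) \<Rightarrow> nat \<Rightarrow> nat \<Rightarrow> complex"
    assume X: "\<And>U. unitary_fun n (X U)" "\<And>i j. (\<lambda>U. X U i j) \<in> borel_measurable \<mu>"
      and opt: "\<And>U. trace_norm (Matrix.mat n n (\<lambda>(i,j). ?T U i j)) \<le> Re (\<Sum>i<n. \<Sum>j<n. X U j i * ?T U i j) + \<epsilon>"
    let ?tr = "\<lambda>U. \<Sum>i<n. \<Sum>j<n. X U j i * ?T U i j"
    have "bdd_meas (\<lambda>U. X U j i)" if "j < n" "i < n" for i j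
      using X unitary_fun_norm_le_1[OF X(1) that] by (intro bdd_measI[of _ 1]) auto
    then have int: "integrable \<mu> ?tr"
      by (intro bdd_meas_integrable bdd_meas_sum bdd_meas_mult bdd_meas_twirl) auto
    have R: "norm (\<integral>U. ?tr U \<partial>\<mu>) \<le> ?R"
      by (rule trace_pairing_le[OF X a[folded n_def] b[folded n_def] Z[folded n_def] \<alpha> Yeq])
    have int_Re: "integrable \<mu> (\<lambda>U. Re (?tr U))" by (rule integrable_Re[OF int])
    have int_c: "integrable \<mu> (\<lambda>U. \<epsilon>)" by (rule finite_measure.integrable_const[OF finite_measure_haar])
    have le: "?N U \<le> Re (?tr U) + \<epsilon>" for U
      unfolding Theta_minus_haar_mean[OF Y] unfolding n_def[symmetric] by (rule opt)
    have eq: "(\<integral>U. Re (?tr U) + \<epsilon> \<partial>\<mu>) = Re (\<integral>U. ?tr U \<partial>\<mu>) + \<epsilon>"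
      unfolding Bochner_Integration.integral_add[OF int_Re int_c] integral_Re[OF int] by (simp add: measure_space_haar)
    show ?thesis
    proof (cases "integrable \<mu> ?N")
      case True
      have "(\<integral>U. ?N U \<partial>\<mu>) \<le> (\<integral>U. Re (?tr U) + \<epsilon> \<partial>\<mu>)"
        by (rule integral_mono[OF True Bochner_Integration.integrable_add[OF int_Re int_c]]) (rule le)
      also have "\<dots> \<le> norm (\<integral>U. ?tr U \<partial>\<mu>) + \<epsilon>" unfolding eq by (intro add_right_mono complex_Re_le_cmod)
      finally show ?thesis using R by linarith
    next
      \<comment> \<open>The Bochner integral defaults to 0 for a function that is not integrable,
        and the right-hand side is nonnegative. The case split stands in for a measurability proof
        of the trace norm.\<close>
      case False
      then have "(\<integral>U. ?N U \<partial>\<mu>) = 0" by (rule not_integrable_integral_eq)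
      moreover have "0 \<le> ?R" using R norm_ge_zero order.trans by blast
      ultimately show ?thesis using \<epsilon> by linarith
    qed
  qed (use T_meas \<epsilon> in auto)
qed

lemma schatten_nonneg: "0 \<le> schatten p A"
  by (simp add: schatten_def)

text \<open>The trivial factorization with a = b = 1. It makes \<open>Inf\<close> in
  \<open>pisier_norm\<close> a genuine infimum, since on an empty set its value would carry no
  information.\<close>

lemma pisier_norm_nonempty:
  assumes Y: "Y \<in> carrier_mat (n * D) (n * D)"
  shows "\<exists>a Z b. a \<in> carrier_mat n n \<and> b \<in> carrier_mat n n \<and> Z \<in> carrier_mat (n * D) (n * D) \<and>
     Y = kron a (1\<^sub>m D) * Z * kron b (1\<^sub>m D)"
proof -
  have "kron (1\<^sub>m n) (1\<^sub>m D) = 1\<^sub>m (n * D)"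
  proof (rule eq_matI)
    fix i j assume "i < dim_row (1\<^sub>m (n * D))" "j < dim_col (1\<^sub>m (n * D))"
    then have ij: "i < n * D" "j < n * D" by auto
    then have "0 < D" by (auto intro!: Nat.gr0I)
    then have lt: "i div D < n" "j div D < n" "i mod D < D" "j mod D < D"
      using ij by (auto simp: less_mult_imp_div_less)
    have "i = j \<longleftrightarrow> i div D = j div D \<and> i mod D = j mod D"
      using div_mult_mod_eq[of i D] div_mult_mod_eq[of j D] by metis
    then show "kron (1\<^sub>m n) (1\<^sub>m D) $$ (i,j) = 1\<^sub>m (n * D) $$ (i,j)"
      using ij lt by (auto simp: kron_def)
  qed (auto simp: kron_def)
  then have "Y = kron (1\<^sub>m n) (1\<^sub>m D) * Y * kron (1\<^sub>m n) (1\<^sub>m D)" using Y by simp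
  then show ?thesis using Y by (intro exI[of _ "1\<^sub>m n"] exI[of _ Y]) auto
qed

lemma pisier_norm_nonneg:
  assumes "Y \<in> carrier_mat (n * D) (n * D)"
  shows "0 \<le> pisier_norm \<alpha> n D Y"
  unfolding pisier_norm_def
  by (rule cInf_greatest) (use pisier_norm_nonempty[OF assms] in \<open>auto intro!: mult_nonneg_nonneg schatten_nonneg\<close>)

lemma integral_trace_norm_le_pisier_norm:
  assumes Y: "Y \<in> carrier_mat (dC * dE * (d * d)) (dC * dE * (d * d))" and \<alpha>: "1 \<le> \<alpha>" "\<alpha> \<le> 2"
  shows "(\<integral>U. trace_norm (Theta dC dE d Y (Matrix.mat d d U) - haar_mean d \<mu> (dC * dE) (Theta dC dE d Y)) \<partial>\<mu>)
    \<le> 2 * 3 powr ((1 - \<alpha>) / \<alpha>) * pisier_norm \<alpha> (dC * dE) (d * d) Y"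
    (is "?I \<le> ?K * _")
proof -
  have K: "0 < ?K" by simp
  \<comment> \<open>After division by the positive constant the left side is a lower bound for all
    factorization values, hence for their infimum, attained or not.\<close>
  have "?I / ?K \<le> pisier_norm \<alpha> (dC * dE) (d * d) Y"
    unfolding pisier_norm_def
  proof (rule cInf_greatest)
    show "{schatten (2 * conj_exp \<alpha>) a * schatten (ereal \<alpha>) Z * schatten (2 * conj_exp \<alpha>) b | a Z b.
      a \<in> carrier_mat (dC * dE) (dC * dE) \<and> b \<in> carrier_mat (dC * dE) (dC * dE) \<and>
      Z \<in> carrier_mat (dC * dE * (d * d)) (dC * dE * (d * d)) \<and> Y = kron a (1\<^sub>m (d * d)) * Z * kron b (1\<^sub>m (d * d))} \<noteq> {}"
      using pisier_norm_nonempty[OF Y] by blast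
    fix s assume "s \<in> {schatten (2 * conj_exp \<alpha>) a * schatten (ereal \<alpha>) Z * schatten (2 * conj_exp \<alpha>) b | a Z b.
      a \<in> carrier_mat (dC * dE) (dC * dE) \<and> b \<in> carrier_mat (dC * dE) (dC * dE) \<and>
      Z \<in> carrier_mat (dC * dE * (d * d)) (dC * dE * (d * d)) \<and> Y = kron a (1\<^sub>m (d * d)) * Z * kron b (1\<^sub>m (d * d))}"
    then obtain a Z b where
      s: "s = schatten (2 * conj_exp \<alpha>) a * schatten (ereal \<alpha>) Z * schatten (2 * conj_exp \<alpha>) b"
      and abZ: "a \<in> carrier_mat (dC * dE) (dC * dE)" "b \<in> carrier_mat (dC * dE) (dC * dE)"
        "Z \<in> carrier_mat (dC * dE * (d * d)) (dC * dE * (d * d))" "Y = kron a (1\<^sub>m (d * d)) * Z * kron b (1\<^sub>m (d * d))"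
      by blast
    have "?I \<le> ?K * s" unfolding s by (rule integral_trace_norm_le[OF Y \<alpha> abZ])
    then show "?I / ?K \<le> s" using K by (simp only: pos_divide_le_eq mult.commute)
  qed
  then show ?thesis using K by (simp only: pos_divide_le_eq mult.commute)
qed

end

theorem theorem3p3:
  fixes dC dE d :: nat and \<mu> :: "(nat \<times> nat \<Rightarrow> complex) measure"
  assumes "haar d \<mu>"
  shows "(\<forall>Y \<alpha>. Y \<in> carrier_mat (dC * dE * (d * d)) (dC * dE * (d * d)) \<and> 1 \<le> \<alpha> \<and> \<alpha> \<le> 2 \<longrightarrow>
            (\<integral>U. trace_norm (Theta dC dE d Y (Matrix.mat d d U)
                   - haar_mean d \<mu> (dC * dE) (Theta dC dE d Y)) \<partial>\<mu>)
            \<le> 2 * 3 powr ((1 - \<alpha>) / \<alpha>) * pisier_norm \<alpha> (dC * dE) (d * d) Y)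
       \<and> (\<forall>\<tau> \<alpha>. positive_op (dC * dE * (d * d)) \<tau> \<and> 1 < \<alpha> \<and> \<alpha> \<le> 2 \<longrightarrow>
            (\<integral>U. trace_norm (Theta dC dE d \<tau> (Matrix.mat d d U)
                   - haar_mean d \<mu> (dC * dE) (Theta dC dE d \<tau>)) \<partial>\<mu>)
            \<le> 2 * exp ((1 - \<alpha>) / \<alpha> * (H_alpha \<alpha> dC dE d \<tau> + ln 3)))"
proof -
  interpret haar_measure d \<mu> by unfold_locales (rule assms)
  have "(\<integral>U. trace_norm (Theta dC dE d \<tau> (Matrix.mat d d U) - haar_mean d \<mu> (dC * dE) (Theta dC dE d \<tau>)) \<partial>\<mu>)
      \<le> 2 * exp ((1 - \<alpha>) / \<alpha> * (H_alpha \<alpha> dC dE d \<tau> + ln 3))"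
    if \<tau>: "positive_op (dC * dE * (d * d)) \<tau>" and \<alpha>: "1 < \<alpha>" "\<alpha> \<le> 2" for \<tau> \<alpha>
  proof -
    define N where "N = pisier_norm \<alpha> (dC * dE) (d * d) \<tau>"
    have c: "\<tau> \<in> carrier_mat (dC * dE * (d * d)) (dC * dE * (d * d))" using \<tau> by (simp add: positive_op_def)
    have N0: "0 \<le> N" unfolding N_def by (rule pisier_norm_nonneg[OF c])
    \<comment> \<open>The factor - \<alpha> / (\<alpha> - 1) in \<open>H_alpha\<close> is the
      reciprocal of (1 - \<alpha>) / \<alpha>, so \<open>ln N\<close> enters with coefficient
      1.\<close>
    have "(1 - \<alpha>) / \<alpha> * (H_alpha \<alpha> dC dE d \<tau> + ln 3) = ln N + (1 - \<alpha>) / \<alpha> * ln 3"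
      using \<alpha> unfolding H_alpha_def N_def[symmetric] by (simp add: field_simps)
    then have e: "exp ((1 - \<alpha>) / \<alpha> * (H_alpha \<alpha> dC dE d \<tau> + ln 3)) = exp (ln N) * 3 powr ((1 - \<alpha>) / \<alpha>)"
      by (simp add: exp_add powr_def)
    \<comment> \<open>If \<open>N = 0\<close>, the junk value \<open>ln 0 = 0\<close> only makes the right-hand side larger.\<close>
    have "N \<le> exp (ln N)" using N0 by (cases "N = 0") simp_all
    then have "2 * 3 powr ((1 - \<alpha>) / \<alpha>) * N \<le> 2 * 3 powr ((1 - \<alpha>) / \<alpha>) * exp (ln N)" by (intro mult_left_mono) auto
    also have "\<dots> = 2 * exp ((1 - \<alpha>) / \<alpha> * (H_alpha \<alpha> dC dE d \<tau> + ln 3))" unfolding e by simp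
    finally show ?thesis
      using integral_trace_norm_le_pisier_norm[OF c, of \<alpha>] \<alpha> unfolding N_def[symmetric] by linarith
  qed
  then show ?thesis using integral_trace_norm_le_pisier_norm by blast
qed

end
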